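(* Let $\mu$ be a locally square-integrable invariant random measure on $\mathbb{H}^n$. Then $$\limsup_{R\to+\infty}\frac{\mathrm{NV}_\mu(R)}{\mathrm{Vol}_{\mathbb{H}^n}(B_R)}>0 .$$ Moreover, (1) if $\hat\eta_\mu^{(c)}(\{0\})>0$, then $$\liminf_{R\to+\infty}\frac{\mathrm{NV}_\mu(R)}{R^2\,\mathrm{Vol}_{\mathbb{H}^n}(B_R)}>0 ;$$ (2) if $\hat\eta_\mu^{(c)}\big([\delta\tfrac{n-1}{2},\tfrac{n-1}{2})\big)>0$ for some $\delta\in(0,1)$, then $$\liminf_{R\to+\infty}\frac{\mathrm{NV}_\mu(R)}{\mathrm{Vol}_{\mathbb{H}^n}(B_R)^{1+\delta}}>0 .$$
   Context: Let $n\ge2$. $\mathbb{H}^n=\{x\in\mathbb{R}^{1+n}:[x,x]=1,\ x_0>0\}$ with $[x,y]=x_0y_0-x_1y_1-\dots-x_ny_n$, metric $d(x,y)=\mathrm{arccosh}([x,y])$, base point $o=(1,0,\dots,0)$, group $G=\mathrm{SO}^\circ(1,n)$ of orientation-preserving isometries, $K=\mathrm{Stab}_G(o)\cong \mathrm{SO}(n)$. $B_R$ is the metric ball of radius $R$ about $o$ and $\mathrm{Vol}_{\mathbb{H}^n}$ is the $G$-invariant hyperbolic volume. A random measure on $\mathbb{H}^n$ is a probability measure $\mu$ on the set $\mathscr{M}_+(\mathbb{H}^n)$ of positive locally finite Borel measures on $\mathbb{H}^n$ (with the $\sigma$-algebra generated by the maps $p\mapsto p(f)=\int f\,dp$, $f$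 bounded measurable of bounded support). It is invariant if preserved by the push-forward action of $G$, and locally square-integrable if $\int p(B)^2d\mu(p)<\infty$ for all bounded Borel sets $B$. The intensity $\iota_\mu>0$ of such a $\mu$ is the constant with $\int p(B)\,d\mu(p)=\iota_\mu\mathrm{Vol}_{\mathbb{H}^n}(B)$ for all bounded Borel sets $B$. Write $Sf(p)=\int f\,dp$. The number variance is $\mathrm{NV}_\mu(R)=\mathrm{Var}_\mu(S\chi_{B_R})=\int|p(B_R)-\iota_\mu\mathrm{Vol}_{\mathbb{H}^n}(B_R)|^2d\mu(p)$, where $\chi_{B_R}$ is the indicator function of $B_R$. Spherical functions: for $\lambda\in\mathbb{C}$, $\omega^{(n)}_\lambda(g)=1$ for $g\in K$ and otherwise, with $\ell(g)=d(g.o,o)$, $$\omega_\lambda^{(n)}(g)=\frac{2^{\frac{n-1}{2}}\Gamma(\frac n2)}{\sqrt\pi\,\Gamma(\frac{n-1}{2})}\sinh(\ell(g))^{2-n}\int_0^{\ell(g)}(\cosh \ell(g)-\cosh s)^{\frac{n-3}{2}}\cos(\lambda s)\,ds .$$ Spherical transform of a bounded measurable bi-$K$-invariant function $\varphi$ on $G$ of bounded support: $\hat\varphi(\lambda)=\int_G\varphi\,\overline{\omega^{(n)}_\lambda}\,dm_G$, with $m_G$ a fixed Haar measure on $G$. Diffraction: there is a unique positive Radon measure $\hat\eta_\mu$ on $\Omega_n^+=(0,\infty)\cup i[0,\frac{n-1}{2}]\subset\mathbb{C}$, the diffraction measure of $\mu$, such that $\mathrm{Cov}_\mu(Sf_1,Sf_2)=\int_{\Omega_n^+}\hat\varphi_1\overline{\hat\varphi_2}\,d\hat\eta_\mu$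 for all $K$-invariant bounded measurable $f_1,f_2$ on $\mathbb{H}^n$ of bounded support, where $\varphi_j(g)=f_j(g.o)$; it satisfies $\hat\eta_\mu(\{i\frac{n-1}{2}\})=0$. The complementary diffraction measure $\hat\eta_\mu^{(c)}$ is the restriction of $\hat\eta_\mu$ to $i[0,\frac{n-1}{2})$, regarded as a measure on $[0,\frac{n-1}{2})$ via $i\lambda\leftrightarrow\lambda$. The limits may be $+\infty$.
   Formalization: The first limsup claim assumes that μ is not concentrated on a single constant multiple c·Vol of the hyperbolic volume; for such μ (e.g. the point mass at Vol) the number variance vanishes identically and the claim fails. *)

theory Defs
  imports "HOL-Probability.Probability"
begin

text \<open>
  Throughout, n = CARD('n), and R^(1+n) is the type real ^ ('n option): the coordinate of index
  None is x_0, and the coordinates of index Some i are x_1, ..., x_n.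
\<close>

definition lor :: "real ^ ('n::finite option) \<Rightarrow> real ^ ('n option) \<Rightarrow> real" where
  "lor x y = x $ None * y $ None - (\<Sum>i\<in>UNIV. x $ Some i * y $ Some i)"

definition hyp :: "(real ^ ('n::finite option)) set" where
  "hyp = {x. lor x x = 1 \<and> x $ None > 0}"

definition hdist :: "real ^ ('n::finite option) \<Rightarrow> real ^ ('n option) \<Rightarrow> real" where
  "hdist x y = arcosh (lor x y)"

definition base :: "real ^ ('n::finite option)" where
  "base = axis None 1"

definition hball :: "real \<Rightarrow> (real ^ ('n::finite option)) set" where
  "hball R = {x \<in> hyp. hdist x base < R}"

definition hbounded :: "(real ^ ('n::finite option)) set \<Rightarrow> bool" where
  "hbounded B \<longleftrightarrow> (\<exists>R. B \<subseteq> hball R)"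

definition hborel :: "(real ^ ('n::finite option)) measure" where
  "hborel = restrict_space borel hyp"

definition hlift :: "real ^ 'n::finite \<Rightarrow> real ^ ('n option)" where
  "hlift y = (\<chi> i. case i of None \<Rightarrow> sqrt (1 + (norm y)\<^sup>2) | Some j \<Rightarrow> y $ j)"

text \<open>The Riemannian volume of the hyperboloid is dx_1 ... dx_n / x_0 in the global chart
  (x_0, x_1, ..., x_n) |-> (x_1, ..., x_n), whose inverse is hlift.\<close>

definition hvol :: "(real ^ ('n::finite option)) measure" where
  "hvol = distr (density lborel (\<lambda>y. ennreal (1 / sqrt (1 + (norm y)\<^sup>2)))) hborel hlift"

text \<open>The identity component of SO(1,n) consists of the elements of SO(1,n) that map the upper
  sheet of the hyperboloid to itself.\<close>

definition SO1 :: "(real ^ ('n::finite option) ^ ('n option)) set" where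
  "SO1 = {g. (\<forall>x y. lor (g *v x) (g *v y) = lor x y) \<and> det g = 1 \<and> (\<forall>x\<in>hyp. g *v x \<in> hyp)}"

definition stab :: "(real ^ ('n::finite option) ^ ('n option)) set" where
  "stab = {g \<in> SO1. g *v base = base}"

text \<open>Regularity is automatic for Borel measures finite on compact sets, as the closed set SO1 of
  matrices is locally compact and second countable; the same applies to diffraction measures.\<close>

definition haar_measure :: "(real ^ ('n::finite option) ^ ('n option)) measure \<Rightarrow> bool" where
  "haar_measure m \<longleftrightarrow>
     sets m = sets (restrict_space borel SO1) \<and>
     (\<forall>g\<in>SO1. distr m m (\<lambda>h. g ** h) = m) \<and>
     (\<forall>C. compact C \<and> C \<subseteq> SO1 \<longrightarrow> emeasure m C < \<infinity>) \<and>
     emeasure m SO1 \<noteq> 0"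

text \<open>The values of a test function outside hyp are irrelevant.\<close>

definition test_fun :: "(real ^ ('n::finite option) \<Rightarrow> 'b::real_normed_vector) \<Rightarrow> bool" where
  "test_fun f \<longleftrightarrow>
     f \<in> borel_measurable hborel \<and> bounded (f ` hyp) \<and> hbounded {x \<in> hyp. f x \<noteq> 0}"

definition linstat ::
    "('a \<Rightarrow> 'b::{banach, second_countable_topology}) \<Rightarrow> 'a measure \<Rightarrow> 'b" where
  "linstat f p = (LINT x|p. f x)"

definition lf_measures :: "(real ^ ('n::finite option)) measure set" where
  "lf_measures = {p. sets p = sets hborel \<and>
     (\<forall>B\<in>sets hborel. hbounded B \<longrightarrow> emeasure p B < \<infinity>)}"

definition lf_algebra :: "(real ^ ('n::finite option)) measure measure" where
  "lf_algebra = sigma lf_measures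
     {{p \<in> lf_measures. linstat f p \<in> U} | (f :: real ^ ('n option) \<Rightarrow> real) U.
        test_fun f \<and> U \<in> sets borel}"

definition random_measure :: "(real ^ ('n::finite option)) measure measure \<Rightarrow> bool" where
  "random_measure \<mu> \<longleftrightarrow> prob_space \<mu> \<and> sets \<mu> = sets lf_algebra"

definition invariant_rm :: "(real ^ ('n::finite option)) measure measure \<Rightarrow> bool" where
  "invariant_rm \<mu> \<longleftrightarrow>
     (\<forall>g\<in>SO1. distr \<mu> lf_algebra (\<lambda>p. distr p hborel (\<lambda>x. g *v x)) = \<mu>)"

definition locally_square_integrable ::
    "(real ^ ('n::finite option)) measure measure \<Rightarrow> bool" where
  "locally_square_integrable \<mu> \<longleftrightarrow>
     (\<forall>B\<in>sets hborel. hbounded B \<longrightarrow> (\<integral>\<^sup>+p. (emeasure p B)\<^sup>2 \<partial>\<mu>) < \<infinity>)"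

definition covar :: "'a measure \<Rightarrow> ('a \<Rightarrow> complex) \<Rightarrow> ('a \<Rightarrow> complex) \<Rightarrow> complex" where
  "covar \<mu> X Y = (LINT p|\<mu>. (X p - (LINT q|\<mu>. X q)) * cnj (Y p - (LINT q|\<mu>. Y q)))"

definition number_variance ::
    "(real ^ ('n::finite option)) measure measure \<Rightarrow> real \<Rightarrow> real" where
  "number_variance \<mu> R =
     (LINT p|\<mu>. (linstat (indicator (hball R)) p - (LINT q|\<mu>. linstat (indicator (hball R)) q))\<^sup>2)"

text \<open>Among the invariant random measures these are exactly the almost surely constant ones; their
  number variance vanishes identically, e.g. for the point mass at hvol, which has intensity 1.\<close>

definition deterministic_rm :: "(real ^ ('n::finite option)) measure measure \<Rightarrow> bool" where
  "deterministic_rm \<mu> \<longleftrightarrow> (\<exists>c\<ge>0. AE p in \<mu>. p = scale_measure (ennreal c) hvol)"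

definition spherical :: "complex \<Rightarrow> real ^ ('n::finite option) ^ ('n option) \<Rightarrow> complex" where
  "spherical z g =
     (if g \<in> stab then 1
      else (let n = real CARD('n); l = hdist (g *v base) base in
        complex_of_real
          (2 powr ((n - 1) / 2) * Gamma (n / 2) / (sqrt pi * Gamma ((n - 1) / 2))
            * sinh l powr (2 - n))
        * (LINT s:{0..l}|lborel.
            complex_of_real ((cosh l - cosh s) powr ((n - 3) / 2)) * cos (z * complex_of_real s))))"

definition spherical_transform ::
    "(real ^ ('n::finite option) ^ ('n option)) measure \<Rightarrow>
     (real ^ ('n option) ^ ('n option) \<Rightarrow> complex) \<Rightarrow> complex \<Rightarrow> complex" where
  "spherical_transform m \<phi> z = (LINT g|m. \<phi> g * cnj (spherical z g))"

definition Omega_plus :: "nat \<Rightarrow> complex set" where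
  "Omega_plus n = complex_of_real ` {0<..} \<union> (\<lambda>t. \<i> * complex_of_real t) ` {0..(real n - 1) / 2}"

text \<open>The covariance identity determines a diffraction measure uniquely, given the random measure
  and the Haar measure m that normalises the spherical transform.\<close>

definition diffraction_measure ::
    "(real ^ ('n::finite option) ^ ('n option)) measure \<Rightarrow>
     (real ^ ('n option)) measure measure \<Rightarrow> complex measure \<Rightarrow> bool" where
  "diffraction_measure m \<mu> \<eta> \<longleftrightarrow>
     sets \<eta> = sets (restrict_space borel (Omega_plus CARD('n))) \<and>
     (\<forall>C. compact C \<and> C \<subseteq> Omega_plus CARD('n) \<longrightarrow> emeasure \<eta> C < \<infinity>) \<and>
     (\<forall>f1 f2 :: real ^ ('n option) \<Rightarrow> complex.
        test_fun f1 \<and> test_fun f2 \<and>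
        (\<forall>k\<in>stab. \<forall>x\<in>hyp. f1 (k *v x) = f1 x) \<and> (\<forall>k\<in>stab. \<forall>x\<in>hyp. f2 (k *v x) = f2 x) \<longrightarrow>
        (let F1 = spherical_transform m (\<lambda>g. f1 (g *v base));
             F2 = spherical_transform m (\<lambda>g. f2 (g *v base))
         in integrable \<eta> (\<lambda>z. F1 z * cnj (F2 z)) \<and>
            covar \<mu> (linstat f1) (linstat f2) = (LINT z|\<eta>. F1 z * cnj (F2 z))))"

definition complementary_diffraction :: "nat \<Rightarrow> complex measure \<Rightarrow> real measure" where
  "complementary_diffraction n \<eta> =
     distr (restrict_space \<eta> ((\<lambda>t. \<i> * complex_of_real t) ` {0..<(real n - 1) / 2}))
       (restrict_space borel {0..<(real n - 1) / 2}) Im"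

end

theory Submission
  imports Defs "HOL-Real_Asymp.Real_Asymp"
begin

text \<open>
  Write \<open>\<rho> = (n - 1) / 2\<close>. The covariance identity applied to the indicator of a ball turns the number
  variance into the integral of \<open>\<bar>F R z\<bar>\<^sup>2\<close> against the diffraction measure, where \<open>F R\<close> is the spherical
  transform of the ball. Everything rests on a closed formula for this transform. A spherical function
  is an Abel integral of a cosine, and integrating it over a ball in polar coordinates raises the
  exponent of the Abel kernel by one (\<open>integral_sinh_abel_cos\<close>), so that up to a positive constant
  \<open>F R z\<close> is the integral of \<open>(cosh R - cosh s) powr \<rho> * cos (z * s)\<close> over \<open>0 \<le> s \<le> R\<close>
  (\<open>spherical_transform_ball\<close>).

  On the complementary spectrum \<open>z = \<i> * t\<close> the cosine is a hyperbolic cosine and nothing cancels: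
  \<open>F R z\<close> is at least of order \<open>exp ((\<rho> + t) * R)\<close>, and of order \<open>R * exp (\<rho> * R)\<close> at \<open>z = 0\<close>. The volume
  of the ball is at most of order \<open>exp (2 * \<rho> * R)\<close>, and both lower limits follow.

  On the principal spectrum \<open>z = l > 0\<close>, an integration by parts shows that \<open>exp (- \<rho> * R) * F R l\<close> is
  asymptotic to \<open>Im (exp (\<i> * l * R) * A)\<close>, where \<open>A\<close> is a nonzero multiple of \<open>Beta \<rho> (1 + \<i> * l)\<close>
  (\<open>abel_cos_real_asymptotics\<close>). This oscillates, but it cannot be small at two radii whose distance is
  not a multiple of \<open>pi / l\<close>. If the number variance were of smaller order than the volume, Fatou's lemma
  along such pairs of radii would make the diffraction measure zero
  (\<open>diffraction_null_of_small_variance\<close>).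

  A random measure with zero diffraction measure is deterministic. All its radial linear statistics
  have variance zero; by invariance the same holds for their translates, so almost every realisation
  gives every translate of a small tent function the same mass. Two measures for which the mass of
  these tents does not depend on the centre are proportional (\<open>invariant_measure_unique\<close>), and the
  hyperbolic volume is one of them. The proportionality theorem is also what relates Haar
  measure to the hyperbolic volume (\<open>haar_distr_orbit\<close>) and what gives the behaviour of Lebesgue measure
  under linear involutions, from which the invariance of the hyperbolic volume is deduced.
\<close>

section \<open>Uniformly distributed measures are proportional\<close>

text \<open>The set \<open>X\<close> carries the trace of the ambient Borel algebra instead of a type of its own, so that
  the results below apply both to Euclidean space and to the hyperboloid.\<close>

definition loc_fin :: "'a::euclidean_space set \<Rightarrow> 'a measure \<Rightarrow> bool" where
  "loc_fin X A \<longleftrightarrow> sets A = sets (restrict_space borel X) \<and>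
     (\<forall>U. open U \<and> bounded U \<longrightarrow> emeasure A (U \<inter> X) < \<infinity>)"

lemma loc_fin_space: "loc_fin X A \<Longrightarrow> space A = X"
  using sets_eq_imp_space_eq[of A "restrict_space borel X"] by (simp add: loc_fin_def space_restrict_space)

lemma loc_fin_sets_Int: "loc_fin X A \<Longrightarrow> T \<in> sets borel \<Longrightarrow> T \<inter> X \<in> sets A"
  by (auto simp: loc_fin_def sets_restrict_space)

lemma loc_fin_sigma_finite:
  assumes A: "loc_fin X A" shows "sigma_finite_measure A"
proof
  let ?C = "range (\<lambda>k::nat. ball 0 (real k) \<inter> X)"
  have "\<Union>?C = X"
  proof safe
    fix x assume "x \<in> X"
    moreover obtain k :: nat where "norm x < real k" using reals_Archimedean2 by blast
    ultimately show "x \<in> \<Union>?C" by (auto simp: dist_norm)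
  qed
  moreover have "?C \<subseteq> sets A" using loc_fin_sets_Int[OF A] by auto
  moreover have "\<forall>a\<in>?C. emeasure A a \<noteq> \<infinity>"
  proof
    fix a assume "a \<in> ?C"
    then obtain k :: nat where "a = ball 0 (real k) \<inter> X" by blast
    then show "emeasure A a \<noteq> \<infinity>" using A unfolding loc_fin_def
      by (metis open_ball bounded_ball less_irrefl)
  qed
  ultimately show "\<exists>C. countable C \<and> C \<subseteq> sets A \<and> \<Union>C = space A \<and> (\<forall>a\<in>C. emeasure A a \<noteq> \<infinity>)"
    unfolding loc_fin_space[OF A] by (intro exI[of _ ?C] conjI countable_image countableI_type)
qed

lemma loc_fin_measurable_pair:
  assumes A: "loc_fin X A" and B: "loc_fin X B" and f: "f \<in> borel_measurable (borel \<Otimes>\<^sub>M borel)"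
  shows "f \<in> borel_measurable (A \<Otimes>\<^sub>M B)"
proof -
  have "(\<lambda>x. x) \<in> A \<rightarrow>\<^sub>M borel" "(\<lambda>x. x) \<in> B \<rightarrow>\<^sub>M borel"
    using A B by (auto simp: loc_fin_def measurable_restrict_space1 cong: measurable_cong_sets)
  then have [measurable]: "fst \<in> A \<Otimes>\<^sub>M B \<rightarrow>\<^sub>M borel" "snd \<in> A \<Otimes>\<^sub>M B \<rightarrow>\<^sub>M borel"
    using measurable_compose[OF measurable_fst] measurable_compose[OF measurable_snd] by blast+
  have "(\<lambda>p. (fst p, snd p)) \<in> A \<Otimes>\<^sub>M B \<rightarrow>\<^sub>M borel \<Otimes>\<^sub>M borel" by measurable
  from measurable_compose[OF this f] show ?thesis by simp
qed

text \<open>If the kernels \<open>k n x\<close> concentrate at \<open>x\<close>, then normalised by their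
  \<open>B\<close>-mass they converge to 1 on an open set when integrated over it against \<open>B\<close>; by Fatou
  and by exchanging the order of integration, \<open>A\<close> is bounded by \<open>B\<close>.\<close>

lemma kernel_comparison:
  fixes A B :: "'a::euclidean_space measure" and k :: "nat \<Rightarrow> 'a \<Rightarrow> 'a \<Rightarrow> ennreal"
  assumes A: "loc_fin X A" and B: "loc_fin X B"
    and km: "\<And>n. (\<lambda>p. k n (fst p) (snd p)) \<in> borel_measurable (borel \<Otimes>\<^sub>M borel)"
    and sym: "\<And>n x y. k n x y = k n y x"
    and conc: "\<And>x U. x \<in> X \<Longrightarrow> open U \<Longrightarrow> x \<in> U \<Longrightarrow>
        eventually (\<lambda>n. \<forall>y\<in>X. k n x y \<noteq> 0 \<longrightarrow> y \<in> U) sequentially"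
    and a: "\<And>n x. x \<in> X \<Longrightarrow> (\<integral>\<^sup>+y. k n x y \<partial>A) = a n"
    and b: "\<And>n x. x \<in> X \<Longrightarrow> (\<integral>\<^sup>+y. k n x y \<partial>B) = b n"
    and b0: "eventually (\<lambda>n. 0 < b n \<and> b n < \<infinity>) sequentially"
    and U: "open U"
  shows "emeasure A (U \<inter> X) \<le> liminf (\<lambda>n. a n / b n * emeasure B (U \<inter> X))"
proof -
  interpret A: sigma_finite_measure A by (rule loc_fin_sigma_finite[OF A])
  interpret B: sigma_finite_measure B by (rule loc_fin_sigma_finite[OF B])
  interpret BA: pair_sigma_finite B A ..
  have [measurable]: "U \<inter> X \<in> sets A" "U \<inter> X \<in> sets B"
    using loc_fin_sets_Int[OF A] loc_fin_sets_Int[OF B] U by auto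
  have [measurable]: "(\<lambda>p. k n (fst p) (snd p)) \<in> borel_measurable (A \<Otimes>\<^sub>M B)"
      "(\<lambda>p. k n (fst p) (snd p)) \<in> borel_measurable (B \<Otimes>\<^sub>M A)" for n
    using loc_fin_measurable_pair[OF A B km] loc_fin_measurable_pair[OF B A km] by auto
  define u where "u n x = (\<integral>\<^sup>+y. k n x y * indicator (U \<inter> X) y \<partial>B) / b n * indicator (U \<inter> X) x" for n x
  have kB [measurable]: "(\<lambda>x. \<integral>\<^sup>+y. k n x y * indicator (U \<inter> X) y \<partial>B) \<in> borel_measurable A" for n
  proof -
    have "(\<lambda>p. k n (fst p) (snd p) * indicator (U \<inter> X) (snd p)) \<in> borel_measurable (A \<Otimes>\<^sub>M B)"
      by measurable
    from B.borel_measurable_nn_integral_fst[OF this] show ?thesis by simp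
  qed
  have um [measurable]: "u n \<in> borel_measurable A" for n unfolding u_def by measurable
  have one: "1 \<le> liminf (\<lambda>n. u n x)" if x: "x \<in> U \<inter> X" for x
  proof -
    have "eventually (\<lambda>n. \<forall>y\<in>X. k n x y \<noteq> 0 \<longrightarrow> y \<in> U) sequentially"
      using x U by (intro conc) auto
    then have ev: "eventually (\<lambda>n. u n x = 1) sequentially"
      using b0
    proof eventually_elim
      case (elim n)
      have "(\<integral>\<^sup>+y. k n x y * indicator (U \<inter> X) y \<partial>B) = (\<integral>\<^sup>+y. k n x y \<partial>B)"
        using elim(1) by (intro nn_integral_cong) (auto simp: loc_fin_space[OF B] indicator_def)
      also have "\<dots> = b n" using b x by auto
      finally show ?case using x elim(2) by (auto simp: u_def ennreal_divide_self)
    qed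
    have "liminf (\<lambda>n. u n x) = liminf (\<lambda>n. 1)" by (rule Liminf_eq[OF ev])
    then show ?thesis by (simp add: Liminf_const)
  qed
  have "emeasure A (U \<inter> X) = (\<integral>\<^sup>+x. indicator (U \<inter> X) x \<partial>A)" by simp
  also have "\<dots> \<le> (\<integral>\<^sup>+x. liminf (\<lambda>n. u n x) \<partial>A)"
    using one by (intro nn_integral_mono) (auto simp: indicator_def)
  also have "\<dots> \<le> liminf (\<lambda>n. \<integral>\<^sup>+x. u n x \<partial>A)" by (rule nn_integral_liminf) measurable
  also have "\<dots> \<le> liminf (\<lambda>n. a n / b n * emeasure B (U \<inter> X))"
  proof (intro Liminf_mono always_eventually allI)
    fix n
    have "(\<integral>\<^sup>+x. u n x \<partial>A) \<le> (\<integral>\<^sup>+x. (\<integral>\<^sup>+y. k n x y * indicator (U \<inter> X) y \<partial>B) / b n \<partial>A)"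
      by (intro nn_integral_mono) (auto simp: u_def indicator_def)
    also have "\<dots> = (\<integral>\<^sup>+x. (\<integral>\<^sup>+y. k n x y * indicator (U \<inter> X) y \<partial>B) \<partial>A) / b n"
      by (rule nn_integral_divide) measurable
    also have "(\<integral>\<^sup>+x. (\<integral>\<^sup>+y. k n x y * indicator (U \<inter> X) y \<partial>B) \<partial>A)
        = (\<integral>\<^sup>+y. (\<integral>\<^sup>+x. k n y x * indicator (U \<inter> X) y \<partial>A) \<partial>B)"
    proof -
      have "(\<lambda>p. k n (fst p) (snd p) * indicator (U \<inter> X) (fst p)) \<in> borel_measurable (B \<Otimes>\<^sub>M A)"
        by measurable
      from BA.Fubini'[of "\<lambda>y x. k n y x * indicator (U \<inter> X) y"] this
      show ?thesis by (simp add: case_prod_beta' sym)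
    qed
    also have "\<dots> = (\<integral>\<^sup>+y. a n * indicator (U \<inter> X) y \<partial>B)"
    proof (intro nn_integral_cong)
      fix y assume "y \<in> space B"
      then have y: "y \<in> X" by (simp add: loc_fin_space[OF B])
      show "(\<integral>\<^sup>+x. k n y x * indicator (U \<inter> X) y \<partial>A) = a n * indicator (U \<inter> X) y"
        using a[OF y] by (cases "y \<in> U \<inter> X") auto
    qed
    also have "\<dots> = a n * emeasure B (U \<inter> X)" by (simp add: nn_integral_cmult_indicator)
    also have "a n * emeasure B (U \<inter> X) / b n = a n / b n * emeasure B (U \<inter> X)"
      by (simp add: divide_ennreal_def mult_ac)
    finally show "(\<integral>\<^sup>+x. u n x \<partial>A) \<le> a n / b n * emeasure B (U \<inter> X)" .
  qed
  finally show ?thesis .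
qed

lemma mult_less_of_quotient_bounds:
  fixes s t \<alpha> \<beta> \<beta>' p q :: real
  assumes "0 \<le> s" "0 \<le> t" "s < p / q * \<beta>" "t < q / p * \<beta>'" "0 < p" "0 < q"
  shows "s * t \<le> \<beta> * \<beta>'"
proof -
  have "s * t \<le> (p / q * \<beta>) * (q / p * \<beta>')" using assms by (intro mult_mono) auto
  also have "\<dots> = \<beta> * \<beta>'" using assms by simp
  finally show ?thesis .
qed

lemma ennreal_mult_le_of_less:
  fixes x y z :: ennreal
  assumes "x < \<infinity>" "y < \<infinity>" and le: "\<And>s t. 0 < s \<Longrightarrow> 0 < t \<Longrightarrow> ennreal s < x \<Longrightarrow> ennreal t < y \<Longrightarrow> ennreal (s * t) \<le> z"
  shows "x * y \<le> z"
proof (cases "x = 0 \<or> y = 0")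
  case False
  obtain p q where p: "x = ennreal p" "p \<ge> 0" and q: "y = ennreal q" "q \<ge> 0"
    using assms(1,2) by (metis ennreal_cases infinity_ennreal_def less_irrefl)
  have pq: "p > 0" "q > 0" using False p q by (auto simp: less_le)
  have lim: "((\<lambda>e. ennreal ((p * e) * (q * e))) \<longlongrightarrow> ennreal ((p * 1) * (q * 1))) (at_left 1)"
    by (intro tendsto_intros tendsto_ennrealI)
  have "ennreal ((p * 1) * (q * 1)) \<le> z"
  proof (rule tendsto_upperbound[OF lim])
    have "eventually (\<lambda>e::real. e \<in> {0<..<1}) (at_left 1)"
      by (rule eventually_at_left_real) simp
    then show "eventually (\<lambda>e. ennreal ((p * e) * (q * e)) \<le> z) (at_left 1)"
    proof eventually_elim
      case (elim e)
      then show ?case using pq by (intro le) (auto simp: p q ennreal_less_iff)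
    qed
  qed simp
  then show ?thesis using pq by (simp add: p q ennreal_mult)
qed auto

text \<open>In the product of the two comparison estimates the quotients of the kernel masses cancel, so no
  limit of these quotients has to exist.\<close>

lemma kernel_cross_inequality:
  fixes A B :: "'a::euclidean_space measure" and k :: "nat \<Rightarrow> 'a \<Rightarrow> 'a \<Rightarrow> ennreal"
  assumes A: "loc_fin X A" and B: "loc_fin X B"
    and km: "\<And>n. (\<lambda>p. k n (fst p) (snd p)) \<in> borel_measurable (borel \<Otimes>\<^sub>M borel)"
    and sym: "\<And>n x y. k n x y = k n y x"
    and conc: "\<And>x U. x \<in> X \<Longrightarrow> open U \<Longrightarrow> x \<in> U \<Longrightarrow>
        eventually (\<lambda>n. \<forall>y\<in>X. k n x y \<noteq> 0 \<longrightarrow> y \<in> U) sequentially"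
    and a: "\<And>n x. x \<in> X \<Longrightarrow> (\<integral>\<^sup>+y. k n x y \<partial>A) = a n" and a0: "\<And>n. a n < \<infinity>"
    and b: "\<And>n x. x \<in> X \<Longrightarrow> (\<integral>\<^sup>+y. k n x y \<partial>B) = b n" and b0: "\<And>n. b n < \<infinity>"
    and bpos: "\<And>n. 0 < b n"
    and U: "open U" "bounded U" and V: "open V" "bounded V"
  shows "emeasure A (U \<inter> X) * emeasure B (V \<inter> X) \<le> emeasure B (U \<inter> X) * emeasure A (V \<inter> X)"
proof (rule ennreal_mult_le_of_less)
  have fin: "emeasure A (W \<inter> X) < \<infinity>" "emeasure B (W \<inter> X) < \<infinity>" if "open W" "bounded W" for W
    using A B that by (auto simp: loc_fin_def)
  show "emeasure A (U \<inter> X) < \<infinity>" "emeasure B (V \<inter> X) < \<infinity>" using fin U V by auto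
  fix s t :: real assume st: "0 < s" "0 < t" "ennreal s < emeasure A (U \<inter> X)" "ennreal t < emeasure B (V \<inter> X)"
  define \<beta> where "\<beta> = enn2real (emeasure B (U \<inter> X))"
  define \<beta>' where "\<beta>' = enn2real (emeasure A (V \<inter> X))"
  have \<beta>: "emeasure B (U \<inter> X) = ennreal \<beta>" "\<beta> \<ge> 0" and \<beta>': "emeasure A (V \<inter> X) = ennreal \<beta>'" "\<beta>' \<ge> 0"
    using fin U V by (auto simp: \<beta>_def \<beta>'_def)
  define p where "p n = enn2real (a n)" for n
  define q where "q n = enn2real (b n)" for n
  have p: "a n = ennreal (p n)" "p n \<ge> 0" and q: "b n = ennreal (q n)" "q n > 0" for n
    using a0[of n] b0[of n] bpos[of n] by (auto simp: p_def q_def enn2real_positive_iff)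
  have "emeasure A (U \<inter> X) \<le> liminf (\<lambda>n. a n / b n * emeasure B (U \<inter> X))"
    using b0 bpos U by (intro kernel_comparison[where k = k] A B km sym conc a b) auto
  then have "eventually (\<lambda>n. ennreal s < a n / b n * emeasure B (U \<inter> X)) sequentially"
    using st(3) by (intro less_LiminfD) auto
  then have e1: "eventually (\<lambda>n. s < p n / q n * \<beta>) sequentially"
  proof eventually_elim
    case (elim n)
    then show ?case using st(1) p(2)[of n] q(2)[of n] \<beta>(2)
      by (simp add: p(1) q(1) \<beta>(1) divide_ennreal ennreal_mult'[symmetric] ennreal_less_iff)
  qed
  then have e1': "eventually (\<lambda>n. p n > 0) sequentially"
  proof eventually_elim
    case (elim n)
    then show ?case using st(1) p(2)[of n] by (cases "p n = 0") auto
  qed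
  have "emeasure B (V \<inter> X) \<le> liminf (\<lambda>n. b n / a n * emeasure A (V \<inter> X))"
  proof (intro kernel_comparison[where k = k] A B km sym conc a b V)
    show "eventually (\<lambda>n. 0 < a n \<and> a n < \<infinity>) sequentially"
      using e1' by eventually_elim (auto simp: p(1))
  qed auto
  then have "eventually (\<lambda>n. ennreal t < b n / a n * emeasure A (V \<inter> X)) sequentially"
    using st(4) by (intro less_LiminfD) auto
  with e1' have e2: "eventually (\<lambda>n. t < q n / p n * \<beta>') sequentially"
  proof eventually_elim
    case (elim n)
    then show ?case using st(2) p(2)[of n] q(2)[of n] \<beta>'(2)
      by (simp add: p(1) q(1) \<beta>'(1) divide_ennreal ennreal_mult'[symmetric] ennreal_less_iff)
  qed
  from e1 e1' e2 have "eventually (\<lambda>n::nat. s * t \<le> \<beta> * \<beta>') sequentially"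
    by eventually_elim (use st q in \<open>auto intro: mult_less_of_quotient_bounds\<close>)
  then have "s * t \<le> \<beta> * \<beta>'" by simp
  then show "ennreal (s * t) \<le> emeasure B (U \<inter> X) * emeasure A (V \<inter> X)"
    by (simp add: \<beta> \<beta>' ennreal_mult'[symmetric])
qed

lemma loc_fin_eqI:
  assumes A: "loc_fin X A" and B: "loc_fin X B"
    and eq: "\<And>U. open U \<Longrightarrow> bounded U \<Longrightarrow> emeasure A (U \<inter> X) = emeasure B (U \<inter> X)"
  shows "A = B"
proof -
  have idA [measurable]: "(\<lambda>x. x) \<in> A \<rightarrow>\<^sub>M borel" and idB [measurable]: "(\<lambda>x. x) \<in> B \<rightarrow>\<^sub>M borel"
    using A B by (auto simp: loc_fin_def measurable_restrict_space1 cong: measurable_cong_sets)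
  have emA: "emeasure (distr A borel (\<lambda>x. x)) T = emeasure A (T \<inter> X)"
    and emB: "emeasure (distr B borel (\<lambda>x. x)) T = emeasure B (T \<inter> X)" if "T \<in> sets borel" for T
    using that by (simp_all add: emeasure_distr loc_fin_space[OF A] loc_fin_space[OF B])
  have "distr A borel (\<lambda>x. x) = distr B borel (\<lambda>x. x)"
  proof (rule measure_eqI_generator_eq[where E = "range (\<lambda>(a, b). box a b::'a set)" and \<Omega> = UNIV
        and A = "\<lambda>n::nat. box (-(real n *\<^sub>R One)) (real n *\<^sub>R One)"])
    show "Int_stable (range (\<lambda>(a, b). box a b::'a set))" by (auto simp: Int_stable_def box_Int_box)
    show "sets (distr A borel (\<lambda>x. x)) = sigma_sets UNIV (range (\<lambda>(a, b). box a b::'a set))"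
      "sets (distr B borel (\<lambda>x. x)) = sigma_sets UNIV (range (\<lambda>(a, b). box a b::'a set))"
      by (simp_all add: borel_eq_box)
    show "emeasure (distr A borel (\<lambda>x. x)) T = emeasure (distr B borel (\<lambda>x. x)) T"
      if "T \<in> range (\<lambda>(a, b). box a b::'a set)" for T
      using that eq[OF open_box bounded_box] by (auto simp: emA emB)
    show "(\<Union>n::nat. box (-(real n *\<^sub>R One)) (real n *\<^sub>R One) :: 'a set) = UNIV" by (rule UN_box_eq_UNIV)
    show "emeasure (distr A borel (\<lambda>x. x)) (box (-(real n *\<^sub>R One)) (real n *\<^sub>R One)) \<noteq> \<infinity>" for n :: nat
      using A by (auto simp: emA loc_fin_def bounded_box less_top)
  qed auto
  then have "emeasure A (T \<inter> X) = emeasure B (T \<inter> X)" if "T \<in> sets borel" for T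
    using emA[OF that] emB[OF that] by simp
  then show ?thesis
    using A B by (intro measure_eqI) (auto simp: loc_fin_def sets_restrict_space Int_commute)
qed

text \<open>This is Christensen's argument for uniformly distributed measures, with kernels in place of
  balls. Integrals against a continuous kernel depend continuously on the centre, so for them
  uniformity at a dense set of centres is enough, which is how the theorem is used for random
  measures.\<close>

theorem uniformly_distributed_unique:
  fixes A B :: "'a::euclidean_space measure" and k :: "nat \<Rightarrow> 'a \<Rightarrow> 'a \<Rightarrow> ennreal"
  assumes A: "loc_fin X A" and B: "loc_fin X B" and X: "x0 \<in> X"
    and km: "\<And>n. (\<lambda>p. k n (fst p) (snd p)) \<in> borel_measurable (borel \<Otimes>\<^sub>M borel)"
    and sym: "\<And>n x y. k n x y = k n y x"
    and conc: "\<And>x U. x \<in> X \<Longrightarrow> open U \<Longrightarrow> x \<in> U \<Longrightarrow>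
        eventually (\<lambda>n. \<forall>y\<in>X. k n x y \<noteq> 0 \<longrightarrow> y \<in> U) sequentially"
    and a: "\<And>n x. x \<in> X \<Longrightarrow> (\<integral>\<^sup>+y. k n x y \<partial>A) = a n" and a0: "\<And>n. a n < \<infinity>"
    and b: "\<And>n x. x \<in> X \<Longrightarrow> (\<integral>\<^sup>+y. k n x y \<partial>B) = b n" and b0: "\<And>n. b n < \<infinity>"
    and bpos: "\<And>n. 0 < b n"
  obtains c where "c \<ge> 0" "A = scale_measure (ennreal c) B"
proof -
  have fin: "emeasure A (W \<inter> X) < \<infinity>" "emeasure B (W \<inter> X) < \<infinity>" if "open W" "bounded W" for W
    using A B that by (auto simp: loc_fin_def)
  obtain m :: nat where m: "emeasure B (ball 0 (real m) \<inter> X) \<noteq> 0"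
  proof (rule ccontr)
    assume "\<not> thesis"
    then have z: "\<And>m::nat. emeasure B (ball 0 (real m) \<inter> X) = 0" using that by blast
    have "ball 0 (real m) \<inter> X \<in> null_sets B" for m :: nat
      using z loc_fin_sets_Int[OF B] by (auto simp: null_sets_def)
    then have "(\<Union>m::nat. ball 0 (real m) \<inter> X) \<in> null_sets B" by (rule null_sets_UN)
    moreover have "space B \<subseteq> (\<Union>m::nat. ball 0 (real m) \<inter> X)"
    proof
      fix x assume "x \<in> space B"
      then have "x \<in> X" by (simp add: loc_fin_space[OF B])
      moreover obtain k :: nat where "norm x < real k" using reals_Archimedean2 by blast
      ultimately show "x \<in> (\<Union>m::nat. ball 0 (real m) \<inter> X)" by (auto simp: dist_norm)
    qed
    ultimately have "AE y in B. False" by (intro AE_I[where N = "\<Union>m::nat. ball 0 (real m) \<inter> X"]) auto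
    then have "(\<integral>\<^sup>+y. k 0 x0 y \<partial>B) = (\<integral>\<^sup>+y. 0 \<partial>B)" by (intro nn_integral_cong_AE) auto
    with b[OF X, of 0] bpos[of 0] show False by simp
  qed
  define V :: "'a set" where "V = ball 0 (real m)"
  have V: "open V" "bounded V" by (auto simp: V_def)
  define \<beta> where "\<beta> = enn2real (emeasure B (V \<inter> X))"
  define \<alpha> where "\<alpha> = enn2real (emeasure A (V \<inter> X))"
  have \<beta>: "emeasure B (V \<inter> X) = ennreal \<beta>" "\<beta> > 0"
    using fin(2)[OF V] m by (auto simp: \<beta>_def V_def enn2real_positive_iff less_top zero_less_iff_neq_zero)
  have \<alpha>: "emeasure A (V \<inter> X) = ennreal \<alpha>" "\<alpha> \<ge> 0" using fin(1)[OF V] by (auto simp: \<alpha>_def)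
  have "A = scale_measure (ennreal (\<alpha> / \<beta>)) B"
  proof (rule loc_fin_eqI[OF A])
    show "loc_fin X (scale_measure (ennreal (\<alpha> / \<beta>)) B)"
      using B by (auto simp: loc_fin_def ennreal_mult_less_top)
    fix U :: "'a set" assume U: "open U" "bounded U"
    have "emeasure A (U \<inter> X) * emeasure B (V \<inter> X) = emeasure B (U \<inter> X) * emeasure A (V \<inter> X)"
    proof (rule antisym)
      show "emeasure A (U \<inter> X) * emeasure B (V \<inter> X) \<le> emeasure B (U \<inter> X) * emeasure A (V \<inter> X)"
        by (rule kernel_cross_inequality[where k = k, OF A B km sym conc a a0 b b0 bpos U V])
      have "emeasure A (V \<inter> X) * emeasure B (U \<inter> X) \<le> emeasure B (V \<inter> X) * emeasure A (U \<inter> X)"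
        by (rule kernel_cross_inequality[where k = k, OF A B km sym conc a a0 b b0 bpos V U])
      then show "emeasure B (U \<inter> X) * emeasure A (V \<inter> X) \<le> emeasure A (U \<inter> X) * emeasure B (V \<inter> X)"
        by (simp add: mult.commute)
    qed
    moreover obtain u where u: "emeasure A (U \<inter> X) = ennreal u" "u \<ge> 0"
      using fin(1)[OF U] by (metis ennreal_cases infinity_ennreal_def less_irrefl)
    moreover obtain w where w: "emeasure B (U \<inter> X) = ennreal w" "w \<ge> 0"
      using fin(2)[OF U] by (metis ennreal_cases infinity_ennreal_def less_irrefl)
    ultimately have "u * \<beta> = w * \<alpha>"
      using \<alpha> \<beta> by (simp add: ennreal_mult'[symmetric] ennreal_inj)
    then have "u = \<alpha> / \<beta> * w" using \<beta>(2) by (simp add: field_simps)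
    then show "emeasure A (U \<inter> X) = emeasure (scale_measure (ennreal (\<alpha> / \<beta>)) B) (U \<inter> X)"
      using \<alpha> \<beta> u w by (simp add: ennreal_mult'[symmetric])
  qed
  with that[of "\<alpha> / \<beta>"] \<alpha> \<beta> show ?thesis by simp
qed

section \<open>The Lorentz form and the isometry group\<close>

definition spatial :: "real ^ ('n::finite option) \<Rightarrow> real ^ 'n" where
  "spatial x = (\<chi> i. x $ Some i)"

lemma spatial_nth [simp]: "spatial x $ i = x $ Some i"
  by (simp add: spatial_def)

lemma linear_spatial: "linear spatial"
  by (rule linearI) (auto simp: vec_eq_iff)

lemma sum_option_UNIV:
  fixes f :: "'n::finite option \<Rightarrow> 'b::comm_monoid_add"
  shows "sum f UNIV = f None + (\<Sum>i\<in>UNIV. f (Some i))"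
  by (simp add: UNIV_option_conv sum.reindex)

lemma lor_eq_inner: "lor x y = x $ None * y $ None - spatial x \<bullet> spatial y"
  by (simp add: lor_def inner_vec_def)

lemma norm_eq_lor: "(norm x)\<^sup>2 = 2 * (x $ None)\<^sup>2 - lor x x"
  unfolding power2_norm_eq_inner
  by (simp add: lor_def inner_vec_def sum_option_UNIV power2_eq_square)

lemma norm_spatial_eq_lor: "(norm (spatial x))\<^sup>2 = (x $ None)\<^sup>2 - lor x x"
  unfolding power2_norm_eq_inner by (simp add: lor_eq_inner power2_eq_square)

lemma lor_commute: "lor x y = lor y x"
  by (simp add: lor_eq_inner inner_commute)

lemma lor_add_left: "lor (x + y) z = lor x z + lor y z"
  by (simp add: lor_eq_inner linear_add[OF linear_spatial] algebra_simps inner_add_left)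

lemma lor_scaleR_left: "lor (c *\<^sub>R x) z = c * lor x z"
  by (simp add: lor_eq_inner linear_scale[OF linear_spatial] algebra_simps)

lemma lor_minus_left: "lor (- x) z = - lor x z"
  using lor_scaleR_left[of "-1" x z] by simp

lemma lor_diff_left: "lor (x - y) z = lor x z - lor y z"
  using lor_add_left[of x "-y" z] lor_minus_left[of y z] by simp

lemma lor_add_right: "lor z (x + y) = lor z x + lor z y"
  and lor_scaleR_right: "lor z (c *\<^sub>R x) = c * lor z x"
  and lor_diff_right: "lor z (x - y) = lor z x - lor z y"
  by (simp_all add: lor_commute[of z] lor_add_left lor_scaleR_left lor_diff_left)

lemmas lor_bilinear =
  lor_add_left lor_add_right lor_diff_left lor_diff_right lor_scaleR_left lor_scaleR_right

lemma base_nth [simp]: "base $ None = 1" "base $ Some i = 0"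
  by (simp_all add: base_def axis_def)

lemma spatial_base [simp]: "spatial base = 0"
  by (simp add: vec_eq_iff)

lemma lor_base [simp]: "lor x base = x $ None" "lor base x = x $ None"
  by (simp_all add: lor_eq_inner)

lemma base_in_hyp [simp]: "base \<in> hyp"
  by (simp add: hyp_def)

lemma hyp_norm_spatial: "x \<in> hyp \<Longrightarrow> (norm (spatial x))\<^sup>2 = (x $ None)\<^sup>2 - 1"
  by (simp add: norm_spatial_eq_lor hyp_def)

text \<open>The reverse Cauchy-Schwarz inequality. It keeps the argument of \<open>arcosh\<close> in the hyperbolic
  distance in the range where \<open>arcosh\<close> inverts \<open>cosh\<close>.\<close>

lemma lor_ge_1:
  assumes "x \<in> hyp" "y \<in> hyp"
  shows "lor x y \<ge> 1"
proof -
  define a b where "a = x $ None" and "b = y $ None"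
  have ab: "a > 0" "b > 0" using assms by (auto simp: hyp_def a_def b_def)
  have n: "(norm (spatial x))\<^sup>2 = a\<^sup>2 - 1" "(norm (spatial y))\<^sup>2 = b\<^sup>2 - 1"
    using assms by (auto simp: hyp_norm_spatial a_def b_def)
  have ge: "a\<^sup>2 \<ge> 1" "b\<^sup>2 \<ge> 1" using n zero_le_power2[of "norm (spatial x)"] zero_le_power2[of "norm (spatial y)"]
    by linarith+
  then have "a \<ge> 1" "b \<ge> 1" using ab
    by (smt (verit) one_power2 power2_le_imp_le)+
  then have "a * b \<ge> 1" by (metis mult_mono mult_1 zero_le_one order_trans)
  have "spatial x \<bullet> spatial y \<le> norm (spatial x) * norm (spatial y)"
    by (rule norm_cauchy_schwarz)
  also have "\<dots> \<le> a * b - 1"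
  proof (rule power2_le_imp_le)
    have "2 * a * b \<le> a\<^sup>2 + b\<^sup>2" by (simp add: sum_squares_bound)
    then have "(a\<^sup>2 - 1) * (b\<^sup>2 - 1) \<le> (a * b - 1)\<^sup>2"
      by (simp add: power2_eq_square algebra_simps)
    then show "(norm (spatial x) * norm (spatial y))\<^sup>2 \<le> (a * b - 1)\<^sup>2"
      by (simp add: power_mult_distrib n)
  qed (use \<open>a * b \<ge> 1\<close> in auto)
  finally show ?thesis by (simp add: lor_eq_inner a_def b_def)
qed

lemma hyp_nth_ge_1: "x \<in> hyp \<Longrightarrow> x $ None \<ge> 1"
  using lor_ge_1[of x base] by simp

lemma hyp_eq_base_iff: "x \<in> hyp \<Longrightarrow> x = base \<longleftrightarrow> x $ None = 1"
proof
  assume x: "x \<in> hyp" "x $ None = 1"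
  then have "spatial x = 0" using hyp_norm_spatial[of x] by simp
  then have "x $ i = base $ i" for i
    using x by (cases i) (auto simp: vec_eq_iff)
  then show "x = base" by (simp add: vec_eq_iff)
qed auto

text \<open>Timelike vectors with a common sign of the time coordinate pair positively, so the sheet of a
  unit timelike vector can be read off from its pairing with any one point of the hyperboloid.\<close>

lemma hypI_lor_pos:
  assumes "lor z z = 1" "x \<in> hyp" "lor z x > 0"
  shows "z \<in> hyp"
proof (rule ccontr)
  assume "z \<notin> hyp"
  moreover have "z $ None \<noteq> 0"
    using assms(1) norm_spatial_eq_lor[of z] zero_le_power2[of "norm (spatial z)"] by auto
  ultimately have "- z \<in> hyp"
    using assms(1) by (auto simp: hyp_def lor_eq_inner linear_neg[OF linear_spatial])
  from lor_ge_1[OF this assms(2)] assms(3) show False by (simp add: lor_minus_left)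
qed

lemma SO1_lor: "g \<in> SO1 \<Longrightarrow> lor (g *v x) (g *v y) = lor x y"
  and SO1_det: "g \<in> SO1 \<Longrightarrow> det g = 1"
  and SO1_hyp: "g \<in> SO1 \<Longrightarrow> x \<in> hyp \<Longrightarrow> g *v x \<in> hyp"
  by (auto simp: SO1_def)

text \<open>For a map that preserves the form, a single point that stays on the hyperboloid fixes the sheet of
  all others through its pairing with them.\<close>

lemma SO1I:
  assumes l: "\<And>x y. lor (g *v x) (g *v y) = lor x y" and "det g = 1"
    and b: "w \<in> hyp" "g *v w \<in> hyp"
  shows "g \<in> SO1"
proof -
  have "g *v x \<in> hyp" if "x \<in> hyp" for x
  proof (rule hypI_lor_pos[OF _ b(2)])
    show "lor (g *v x) (g *v x) = 1" using that l by (simp add: hyp_def)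
    show "0 < lor (g *v x) (g *v w)" using lor_ge_1[OF that b(1)] l by simp
  qed
  with assms show ?thesis by (auto simp: SO1_def)
qed

lemma SO1_mult: "g \<in> SO1 \<Longrightarrow> h \<in> SO1 \<Longrightarrow> g ** h \<in> SO1"
  by (auto simp: SO1_def det_mul matrix_vector_mul_assoc[symmetric])

lemma SO1_inverse:
  assumes g: "g \<in> SO1"
  obtains h where "h \<in> SO1" "\<And>x. h *v (g *v x) = x" "\<And>x. g *v (h *v x) = x"
proof -
  have "invertible g" using SO1_det[OF g] by (simp add: invertible_det_nz)
  then obtain h where h: "g ** h = mat 1" "h ** g = mat 1" by (auto simp: invertible_def)
  have i: "h *v (g *v x) = x" "g *v (h *v x) = x" for x
    by (simp_all add: matrix_vector_mul_assoc h)
  have "det g * det h = 1" by (metis h(1) det_mul det_I)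
  then have "det h = 1" using SO1_det[OF g] by simp
  moreover have "lor (h *v x) (h *v y) = lor x y" for x y
    using SO1_lor[OF g, of "h *v x" "h *v y"] i by simp
  ultimately have "h \<in> SO1"
    using i by (intro SO1I[of h "g *v base"]) (auto simp: SO1_hyp[OF g])
  with i that show ?thesis by blast
qed

text \<open>The Lorentz reflection in \<open>x - base\<close> swaps \<open>x\<close> and the base point.\<close>

lemma lorentz_reflection:
  assumes x: "(x :: real ^ ('n::finite option)) \<in> hyp"
  obtains f where "linear f" "\<And>y. f (f y) = y" "\<And>y z. lor (f y) (f z) = lor y z" "f base = x"
proof -
  define v where "v = x - base"
  define q where "q = lor v v"
  have q: "q = 2 - 2 * x $ None" unfolding q_def v_def using x
    by (simp add: lor_bilinear hyp_def)
  \<comment> \<open>For \<open>x = base\<close> both \<open>v\<close> and \<open>q\<close> vanish, and division by zero makes \<open>f\<close> the identity.\<close>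
  define f where "f y = y - (2 * lor v y / q) *\<^sub>R v" for y
  have fx: "f base = x" if "x \<noteq> base"
  proof -
    have "x $ None \<noteq> 1" using that hyp_eq_base_iff[OF x] by auto
    moreover have "lor v base = x $ None - 1" by (simp add: v_def lor_bilinear)
    ultimately have "2 * lor v base / q = -1" using q by (simp add: field_simps)
    then show ?thesis by (simp add: f_def v_def)
  qed
  have f0: "f = id" if "x = base" using that by (auto simp: f_def v_def fun_eq_iff)
  have fb: "f base = x" using fx f0 by (cases "x = base") auto
  have lf: "linear f"
    by (rule linearI)
      (simp_all add: f_def lor_bilinear algebra_simps add_divide_distrib scaleR_left_distrib)
  have lorf: "lor (f y) (f z) = lor y z" for y z
  proof -
    have "lor (f y) (f z) = lor y z - 2 * (2 * lor v y * lor v z / q)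
        + (2 * lor v y / q) * (2 * lor v z / q) * q"
      unfolding f_def by (simp add: lor_bilinear q_def lor_commute[of y v] lor_commute[of z v])
    then show ?thesis by (cases "q = 0") (simp_all)
  qed
  have ff: "f (f y) = y" for y
  proof -
    have "2 * lor v (f y) / q = - (2 * lor v y / q)"
      by (cases "q = 0") (simp_all add: f_def lor_diff_right lor_scaleR_right q_def[symmetric])
    then show ?thesis unfolding f_def[of "f y"] by (simp add: f_def)
  qed
  show ?thesis using that[of f] lf ff lorf fb by blast
qed

text \<open>Composing the reflection, if needed, with a coordinate reflection that fixes the base point
  makes the determinant 1.\<close>

lemma SO1_transitive:
  assumes x: "(x :: real ^ ('n::finite option)) \<in> hyp"
  obtains g where "g \<in> SO1" "g *v base = x"
proof -
  obtain f where lf: "linear f" and ff: "\<And>y. f (f y) = y"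
    and lorf: "\<And>y z. lor (f y) (f z) = lor y z" and fb: "f base = x"
    using lorentz_reflection[OF x] by blast
  define r where "r = matrix f"
  have rf: "r *v y = f y" for y by (simp add: r_def matrix_works lf)
  have "r ** r = mat 1"
    by (simp add: matrix_eq matrix_vector_mul_assoc[symmetric] rf ff)
  then have "(det r)\<^sup>2 = 1" by (metis det_mul det_I power2_eq_square)
  then consider "det r = 1" | "det r = -1" by (auto simp: power2_eq_1_iff)
  then show ?thesis
  proof cases
    case 1
    have "r \<in> SO1" by (rule SO1I[of _ base]) (auto simp: rf lorf 1 fb x)
    then show ?thesis using that fb rf by metis
  next
    case 2
    obtain a :: 'n where True by simp
    define d :: "'n option \<Rightarrow> real" where "d i = (if i = Some a then -1 else 1)" for i
    define s :: "real ^ ('n option) ^ ('n option)" where "s = (\<chi> i j. if i = j then d i else 0)"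
    have sv: "(s *v y) $ i = d i * y $ i" for y i
    proof -
      have "(s *v y) $ i = (\<Sum>j\<in>UNIV. if j = i then d j * y $ j else 0)"
        unfolding s_def matrix_vector_mult_def vec_lambda_beta by (rule sum.cong) auto
      then show ?thesis by simp
    qed
    have dd: "d i * d i = 1" for i by (simp add: d_def)
    have lors: "lor (s *v y) (s *v z) = lor y z" for y z
    proof -
      have "d i * y $ i * (d i * z $ i) = y $ i * z $ i" for i
        by (simp add: d_def)
      then show ?thesis unfolding lor_def sv by (simp only:)
    qed
    have "det s = (\<Prod>i\<in>UNIV. d i)"
      by (subst det_diagonal) (auto simp: s_def)
    also have "\<dots> = -1" by (simp add: d_def prod.If_cases)
    finally have ds: "det s = -1" .
    have sb: "s *v base = base"
      unfolding vec_eq_iff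
    proof
      fix i show "(s *v base) $ i = base $ i" by (cases i) (auto simp: sv d_def)
    qed
    have "r ** s \<in> SO1"
      by (rule SO1I[of _ base])
        (auto simp: rf lorf lors fb x det_mul 2 ds sb matrix_vector_mul_assoc[symmetric])
    moreover have "(r ** s) *v base = x" by (simp add: matrix_vector_mul_assoc[symmetric] sb rf fb)
    ultimately show ?thesis using that by blast
  qed
qed

lemma SO1_to_base:
  assumes "x \<in> hyp"
  obtains g where "g \<in> SO1" "g *v x = base"
  by (metis SO1_transitive[OF assms] SO1_inverse)

section \<open>Topology and measurability on the hyperboloid\<close>

lemma continuous_lor [continuous_intros]:
  assumes "continuous_on S f" "continuous_on S g"
  shows "continuous_on S (\<lambda>x. lor (f x) (g x))"
  unfolding lor_def using assms by (intro continuous_intros)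

lemma linear_borel_measurable:
  fixes f :: "'a::euclidean_space \<Rightarrow> 'b::euclidean_space"
  shows "linear f \<Longrightarrow> f \<in> borel_measurable borel"
  by (intro borel_measurable_continuous_onI linear_continuous_on) (simp add: linear_conv_bounded_linear)

lemma borel_measurable_lor [measurable (raw)]:
  assumes [measurable]: "f \<in> borel_measurable M" "g \<in> borel_measurable M"
  shows "(\<lambda>x. lor (f x) (g x)) \<in> borel_measurable M"
proof -
  have "continuous_on UNIV (\<lambda>p. lor (fst p) (snd p))" by (intro continuous_intros)
  then have [measurable]: "(\<lambda>p. lor (fst p) (snd p)) \<in> borel_measurable borel"
    by (rule borel_measurable_continuous_onI)
  have "(\<lambda>x. (\<lambda>p. lor (fst p) (snd p)) (f x, g x)) \<in> borel_measurable M" by measurable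
  then show ?thesis by simp
qed

lemma borel_measurable_vec_nth [measurable (raw)]:
  assumes [measurable]: "f \<in> borel_measurable M"
  shows "(\<lambda>x. f x $ i) \<in> borel_measurable M"
proof -
  have "continuous_on UNIV (\<lambda>p. p $ i)" by (intro continuous_intros)
  then have [measurable]: "(\<lambda>p. p $ i) \<in> borel_measurable borel"
    by (rule borel_measurable_continuous_onI)
  show ?thesis by measurable
qed

lemma borel_measurable_matrix_vector [measurable (raw)]:
  fixes g :: "real ^ 'n::finite ^ 'm::finite"
  assumes [measurable]: "f \<in> borel_measurable M"
  shows "(\<lambda>x. g *v f x) \<in> borel_measurable M"
  by (rule measurable_compose[OF assms linear_borel_measurable]) simp

lemma sets_hyp [measurable, simp]: "hyp \<in> sets borel"
proof -
  have "hyp = {x. lor x x = 1 \<and> x $ None > 0}" by (simp add: hyp_def)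
  also have "\<dots> \<in> sets borel" by measurable
  finally show ?thesis .
qed

lemma space_hborel [simp]: "space hborel = hyp"
  by (simp add: hborel_def space_restrict_space)

lemma sets_hborel_iff: "A \<in> sets hborel \<longleftrightarrow> A \<subseteq> hyp \<and> A \<in> sets borel"
  by (auto simp: hborel_def sets_restrict_space_iff)

lemma measurable_hborelI:
  assumes "f \<in> borel_measurable M" "\<And>x. x \<in> space M \<Longrightarrow> f x \<in> hyp"
  shows "f \<in> M \<rightarrow>\<^sub>M hborel"
  unfolding hborel_def using assms by (intro measurable_restrict_space2) auto

lemma borel_measurable_hborelI:
  "f \<in> borel_measurable borel \<Longrightarrow> f \<in> borel_measurable hborel"
  by (simp add: hborel_def measurable_restrict_space1)

lemma measurable_SO1_hborel [measurable]:
  "g \<in> SO1 \<Longrightarrow> (\<lambda>x. g *v x) \<in> hborel \<rightarrow>\<^sub>M hborel"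
  by (intro measurable_hborelI borel_measurable_hborelI) (auto simp: SO1_hyp)

lemma hlift_nth [simp]: "hlift y $ None = sqrt (1 + (norm y)\<^sup>2)" "hlift y $ Some j = y $ j"
  by (simp_all add: hlift_def)

lemma spatial_hlift [simp]: "spatial (hlift y) = y"
  by (simp add: vec_eq_iff)

lemma hlift_in_hyp [simp]: "hlift y \<in> hyp"
proof -
  have "1 + (norm y)\<^sup>2 > 0" by (smt (verit) zero_le_power2)
  then show ?thesis
    by (simp add: hyp_def lor_eq_inner power2_norm_eq_inner[symmetric] flip: power2_eq_square)
qed

lemma continuous_on_hlift: "continuous_on UNIV hlift"
  unfolding continuous_on_eq_continuous_within continuous_within
proof (intro ballI vec_tendstoI)
  fix y :: "real ^ 'n" and i :: "'n option"
  show "((\<lambda>x. hlift x $ i) \<longlongrightarrow> hlift y $ i) (at y within UNIV)"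
    by (cases i) (auto intro!: tendsto_intros)
qed

lemma measurable_hlift [measurable]: "hlift \<in> borel \<rightarrow>\<^sub>M hborel"
  by (intro measurable_hborelI borel_measurable_continuous_onI continuous_on_hlift) auto

lemma hdist_base: "hdist x base = arcosh (x $ None)"
  by (simp add: hdist_def)

lemma arcosh_less_iff:
  assumes "x \<ge> 1" "r \<ge> 0" shows "arcosh x < r \<longleftrightarrow> x < cosh (r::real)"
proof -
  have "cosh (arcosh x) = x" "arcosh x \<ge> 0" using assms
    by (auto simp: cosh_arcosh_real arcosh_nonneg_real)
  then show ?thesis using cosh_real_nonneg_less_iff[of "arcosh x" r] assms by auto
qed

lemma hball_nonneg: "R \<ge> 0 \<Longrightarrow> hball R = {x \<in> hyp. x $ None < cosh R}"
  by (auto simp: hball_def hdist_base hyp_nth_ge_1 arcosh_less_iff)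

lemma hball_nonpos: "R \<le> 0 \<Longrightarrow> hball R = {}"
  using arcosh_nonneg_real[OF hyp_nth_ge_1] by (force simp: hball_def hdist_base)

lemma hball_subset_hyp: "hball R \<subseteq> hyp"
  by (auto simp: hball_def)

lemma sets_hball [measurable, simp]: "hball R \<in> sets hborel"
proof (cases "R \<ge> 0")
  case True
  have "hball R = hyp \<inter> {x. x $ None < cosh R}" using True by (auto simp: hball_nonneg)
  moreover have "{x::real^('a option). x $ None < cosh R} \<in> sets borel" by measurable
  ultimately show ?thesis by (auto simp: sets_hborel_iff)
qed (simp add: hball_nonpos)

lemma hbounded_hball [simp]: "hbounded (hball R)"
  by (auto simp: hbounded_def)

lemma hbounded_subset: "hbounded B \<Longrightarrow> A \<subseteq> B \<Longrightarrow> hbounded A"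
  by (auto simp: hbounded_def)

text \<open>On the hyperboloid the Euclidean norm is controlled by the time coordinate, so hyperbolic and
  Euclidean boundedness agree; in particular isometries, being linear, preserve boundedness.\<close>

lemma hbounded_iff_bounded:
  assumes "B \<subseteq> hyp" shows "hbounded B \<longleftrightarrow> bounded B"
proof
  assume "hbounded B"
  then obtain R where R: "B \<subseteq> hball R" by (auto simp: hbounded_def)
  show "bounded B" unfolding bounded_iff
  proof (intro exI ballI)
    fix x assume "x \<in> B"
    then have x: "x \<in> hyp" "x \<in> hball R" using R assms by auto
    then have "R \<ge> 0" using hball_nonpos[of R] by (cases "R \<ge> 0") auto
    with x have "x $ None < cosh R" by (auto simp: hball_nonneg)
    moreover have "0 < x $ None" using x by (simp add: hyp_def)
    ultimately have "(x $ None)\<^sup>2 \<le> (cosh R)\<^sup>2" by (intro power_mono) auto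
    moreover have "(norm x)\<^sup>2 = 2 * (x $ None)\<^sup>2 - 1" using x by (simp add: norm_eq_lor hyp_def)
    ultimately have "(norm x)\<^sup>2 \<le> 4 * (cosh R)\<^sup>2"
      using zero_le_power2[of "cosh R"] by linarith
    then have "(norm x)\<^sup>2 \<le> (2 * cosh R)\<^sup>2" by (simp add: power_mult_distrib)
    then show "norm x \<le> 2 * cosh R" by (rule power2_le_imp_le) simp
  qed
next
  assume "bounded B"
  then obtain C where C: "\<And>x. x \<in> B \<Longrightarrow> norm x \<le> C" by (auto simp: bounded_iff)
  define D where "D = max C 0 + 1"
  have D: "D \<ge> 1" by (simp add: D_def)
  have "x \<in> hball (arcosh D)" if "x \<in> B" for x
  proof -
    have "x $ None \<le> norm x" using component_le_norm_cart[of x None] by simp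
    also have "\<dots> \<le> C" by (rule C[OF that])
    also have "\<dots> < D" by (simp add: D_def)
    finally show ?thesis using that assms D
      by (auto simp: hball_nonneg arcosh_nonneg_real cosh_arcosh_real)
  qed
  then show "hbounded B" by (auto simp: hbounded_def)
qed

section \<open>Invariance of the hyperbolic volume\<close>

lemma emeasure_hvol:
  assumes [measurable]: "A \<in> sets hborel"
  shows "emeasure hvol A =
    (\<integral>\<^sup>+y. ennreal (1 / sqrt (1 + (norm y)\<^sup>2)) * indicator A (hlift y) \<partial>lborel)"
  unfolding hvol_def
  by (subst nn_integral_indicator[symmetric], simp, subst nn_integral_distr, simp, simp,
      subst nn_integral_density, simp_all)

lemma sets_hvol [simp, measurable_cong]: "sets hvol = sets hborel"
  by (simp add: hvol_def)

lemma space_hvol [simp]: "space hvol = hyp"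
  by (simp add: hvol_def)

definition opt_vec :: "real \<Rightarrow> real ^ 'n::finite \<Rightarrow> real ^ ('n option)" where
  "opt_vec t y = (\<chi> i. case i of None \<Rightarrow> t | Some j \<Rightarrow> y $ j)"

lemma opt_vec_nth [simp]: "opt_vec t y $ None = t" "opt_vec t y $ Some j = y $ j"
  by (simp_all add: opt_vec_def)

lemma spatial_opt_vec [simp]: "spatial (opt_vec t y) = y"
  by (simp add: vec_eq_iff)

lemma lor_opt_vec [simp]: "lor (opt_vec t y) (opt_vec t y) = t\<^sup>2 - (norm y)\<^sup>2"
  by (simp add: lor_eq_inner power2_norm_eq_inner power2_eq_square[of t])

lemma continuous_on_opt_vec: "continuous_on UNIV (\<lambda>p. opt_vec (fst p) (snd p))"
  unfolding continuous_on_eq_continuous_within continuous_within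
proof (intro ballI vec_tendstoI)
  fix p :: "real \<times> (real ^ 'n)" and i :: "'n option"
  show "((\<lambda>x. opt_vec (fst x) (snd x) $ i) \<longlongrightarrow> opt_vec (fst p) (snd p) $ i) (at p within UNIV)"
    by (cases i) (auto intro!: tendsto_intros)
qed

lemma measurable_opt_vec [measurable]:
  "(\<lambda>p. opt_vec (fst p) (snd p)) \<in> borel \<Otimes>\<^sub>M borel \<rightarrow>\<^sub>M borel"
  using borel_measurable_continuous_onI[OF continuous_on_opt_vec] by (simp add: borel_prod)

lemma prod_Basis_cart:
  fixes x :: "real ^ 'n::finite"
  shows "(\<Prod>b\<in>Basis. x \<bullet> b) = (\<Prod>i\<in>UNIV. x $ i)"
proof -
  have B: "(Basis :: (real ^ 'n) set) = range (\<lambda>i. axis i 1)" by (auto simp: Basis_vec_def)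
  have "inj (\<lambda>i::'n. axis i (1::real))" by (auto simp: inj_def axis_eq_axis)
  then show ?thesis unfolding B by (subst prod.reindex) (simp_all add: inner_axis)
qed

lemma mem_box_option:
  fixes l u :: "real ^ ('n::finite option)"
  shows "x \<in> box l u \<longleftrightarrow> l $ None < x $ None \<and> x $ None < u $ None \<and> spatial x \<in> box (spatial l) (spatial u)"
  by (auto simp: mem_box_cart split_option_all)

text \<open>This lets Fubini's theorem separate the time coordinate from the spatial ones.\<close>

lemma lborel_opt_vec:
  "(lborel :: (real ^ ('n::finite option)) measure) =
     distr (lborel \<Otimes>\<^sub>M lborel) borel (\<lambda>p. opt_vec (fst p) (snd p))"
proof (rule lborel_eqI)
  fix l u :: "real ^ ('n option)"
  assume lu: "\<And>b. b \<in> Basis \<Longrightarrow> l \<bullet> b \<le> u \<bullet> b"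
  have le: "l $ i \<le> u $ i" for i
    using lu[of "axis i 1"] by (auto simp: inner_axis Basis_vec_def)
  have le': "spatial l \<bullet> b \<le> spatial u \<bullet> b" if "b \<in> Basis" for b :: "real ^ 'n"
    using that le by (auto simp: Basis_vec_def inner_axis)
  have "emeasure (distr (lborel \<Otimes>\<^sub>M lborel) borel (\<lambda>p. opt_vec (fst p) (snd p))) (box l u)
      = emeasure (lborel \<Otimes>\<^sub>M lborel) ({l $ None <..< u $ None} \<times> box (spatial l) (spatial u))"
    by (subst emeasure_distr)
      (auto intro!: arg_cong2[where f = emeasure] simp: mem_box_option space_pair_measure)
  also have "\<dots> = ennreal (u $ None - l $ None) * ennreal (\<Prod>b\<in>Basis. (spatial u - spatial l) \<bullet> b)"
    using le le' by (subst lborel.emeasure_pair_measure_Times)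
      (auto simp: emeasure_lborel_box_eq)
  also have "\<dots> = ennreal ((u $ None - l $ None) * (\<Prod>b\<in>Basis. (spatial u - spatial l) \<bullet> b))"
    using le le' by (intro ennreal_mult[symmetric] prod_nonneg) (auto simp: inner_diff_left)
  also have "(u $ None - l $ None) * (\<Prod>b\<in>Basis. (spatial u - spatial l) \<bullet> b) = (\<Prod>b\<in>Basis. (u - l) \<bullet> b)"
    by (simp add: prod_Basis_cart UNIV_option_conv prod.reindex)
  finally show "emeasure (distr (lborel \<Otimes>\<^sub>M lborel) borel (\<lambda>p. opt_vec (fst p) (snd p))) (box l u)
      = ennreal (\<Prod>b\<in>Basis. (u - l) \<bullet> b)" .
qed simp

text \<open>The image of Lebesgue measure under a linear map is translation invariant, hence a multiple
  of Lebesgue measure; for an involution the factor squares to 1.\<close>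

lemma lborel_distr_involution:
  fixes f :: "'a::euclidean_space \<Rightarrow> 'a"
  assumes f: "linear f" and ff: "\<And>x. f (f x) = x"
  shows "distr lborel borel f = lborel"
proof -
  define k :: "nat \<Rightarrow> 'a \<Rightarrow> 'a \<Rightarrow> ennreal" where
    "k n x y = indicator {p. dist (fst p) (snd p) < 1 / real (Suc n)} (x, y)" for n x y
  have k: "k n x = indicator (ball x (1 / real (Suc n)))" for n x
    by (auto simp: k_def fun_eq_iff indicator_def)
  have bf: "bounded_linear f" using f by (simp add: linear_conv_bounded_linear)
  have fm [measurable]: "f \<in> borel_measurable borel" using f by (rule linear_borel_measurable)
  have vim: "f -` U = f ` U" for U
  proof safe
    fix x assume "f x \<in> U"
    then show "x \<in> f ` U" using ff[of x] by (intro image_eqI[of _ _ "f x"]) auto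
  qed (simp add: ff)
  have fin: "emeasure (distr lborel borel f) U < \<infinity>" if "open U" "bounded U" for U
  proof -
    have "bounded (f -` U)" unfolding vim by (rule bounded_linear_image[OF that(2) bf])
    from emeasure_bounded_finite[OF this] show ?thesis using that(1) by (simp add: emeasure_distr)
  qed
  have A: "loc_fin UNIV (distr lborel borel f)" using fin by (auto simp: loc_fin_def)
  have B: "loc_fin UNIV (lborel :: 'a measure)"
    using emeasure_bounded_finite by (auto simp: loc_fin_def)
  have ball: "emeasure (distr lborel borel f) (ball x r) = emeasure (distr lborel borel f) (ball 0 r)" for x r
  proof -
    have lin: "f (y + f x) - x = f y" for y using linear_add[OF f, of y "f x"] by (simp add: ff)
    have "emeasure (distr lborel borel f) (ball x r) = emeasure lborel (f -` ball x r)"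
      by (simp add: emeasure_distr)
    also have "\<dots> = emeasure (distr lborel borel ((+) (f x))) (f -` ball x r)"
      by (simp add: lborel_distr_plus)
    also have "\<dots> = emeasure lborel ((+) (f x) -` (f -` ball x r))"
      using measurable_sets[OF fm, of "ball x r"] by (subst emeasure_distr) auto
    also have "(+) (f x) -` (f -` ball x r) = f -` ball 0 r"
    proof (rule set_eqI)
      fix y
      have "dist x (f (f x + y)) = norm (f (y + f x) - x)"
        by (simp add: dist_norm norm_minus_commute add.commute)
      then show "y \<in> (+) (f x) -` (f -` ball x r) \<longleftrightarrow> y \<in> f -` ball 0 r"
        by (simp add: lin)
    qed
    also have "emeasure lborel (f -` ball 0 r) = emeasure (distr lborel borel f) (ball 0 r)"
      by (simp add: emeasure_distr)
    finally show ?thesis .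
  qed
  obtain c where c: "c \<ge> 0" "distr lborel borel f = scale_measure (ennreal c) lborel"
  proof (rule uniformly_distributed_unique[OF A B, of 0 k
        "\<lambda>n. emeasure (distr lborel borel f) (ball 0 (1 / real (Suc n)))"
        "\<lambda>n. emeasure lborel (ball (0::'a) (1 / real (Suc n)))"])
    show "(\<lambda>p. k n (fst p) (snd p)) \<in> borel_measurable (borel \<Otimes>\<^sub>M borel)" for n
      unfolding k_def by measurable
    show "k n x y = k n y x" for n x y by (simp add: k_def dist_commute indicator_def)
    show "eventually (\<lambda>n. \<forall>y\<in>UNIV. k n x y \<noteq> 0 \<longrightarrow> y \<in> U) sequentially"
      if U: "open U" "x \<in> U" for x U
    proof -
      obtain e where e: "e > 0" "ball x e \<subseteq> U" using U by (meson openE)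
      obtain N where N: "1 / real (Suc N) < e" using e(1) nat_approx_posE by metis
      show ?thesis
      proof (rule eventually_sequentiallyI[of N], safe)
        fix n y assume "N \<le> n" "k n x y \<noteq> 0"
        then have "dist x y < 1 / real (Suc n)" by (auto simp: k indicator_def split: if_splits)
        also have "\<dots> \<le> 1 / real (Suc N)" using \<open>N \<le> n\<close> by (intro divide_left_mono) auto
        finally show "y \<in> U" using e N by auto
      qed
    qed
    show "(\<integral>\<^sup>+y. k n x y \<partial>distr lborel borel f) = emeasure (distr lborel borel f) (ball 0 (1 / real (Suc n)))" for n x
      unfolding k using ball[of x] by (subst nn_integral_indicator) auto
    show "(\<integral>\<^sup>+y. k n x y \<partial>lborel) = emeasure lborel (ball (0::'a) (1 / real (Suc n)))" for n x
      by (simp add: k emeasure_ball)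
    show "emeasure (distr lborel borel f) (ball 0 (1 / real (Suc n))) < \<infinity>" for n
      by (intro fin) auto
    show "emeasure lborel (ball (0::'a) (1 / real (Suc n))) < \<infinity>"
        "0 < emeasure lborel (ball (0::'a) (1 / real (Suc n)))" for n
      by (simp_all add: emeasure_ball)
  qed auto
  have ball1: "0 < emeasure lborel (ball (0::'a) 1)" "emeasure lborel (ball (0::'a) 1) < \<infinity>"
    by (simp_all add: emeasure_ball)
  have "lborel = distr lborel borel (\<lambda>x::'a. f (f x))" by (simp add: ff distr_id2)
  also have "\<dots> = distr (distr lborel borel f) borel f" by (simp add: distr_distr o_def)
  finally have "emeasure lborel (ball (0::'a) 1) = emeasure (distr (distr lborel borel f) borel f) (ball 0 1)" by simp
  also have "\<dots> = emeasure (distr lborel borel f) (f -` ball 0 1)" by (simp add: emeasure_distr)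
  also have "\<dots> = ennreal c * emeasure lborel (f -` ball 0 1)" by (simp only: c(2) emeasure_scale_measure)
  also have "emeasure lborel (f -` ball 0 1) = emeasure (distr lborel borel f) (ball 0 1)"
    by (simp add: emeasure_distr)
  also have "\<dots> = ennreal c * emeasure lborel (ball (0::'a) 1)" by (simp only: c(2) emeasure_scale_measure)
  finally have "emeasure lborel (ball (0::'a) 1) = ennreal (c * c) * emeasure lborel (ball (0::'a) 1)"
    using c(1) by (simp add: ennreal_mult mult.assoc)
  moreover obtain w where "emeasure lborel (ball (0::'a) 1) = ennreal w" "w > 0"
    using ball1 by (metis ennreal_cases ennreal_less_zero_iff infinity_ennreal_def less_irrefl)
  ultimately have "w = c * c * w" using c(1) by (simp add: ennreal_mult'[symmetric] ennreal_inj)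
  then have "c * c = 1" using \<open>w > 0\<close> by simp
  then have "c = 1" using c(1) by (metis abs_of_nonneg real_sqrt_abs2 real_sqrt_one)
  then show ?thesis using c(2) by simp
qed

text \<open>The part of the forward light cone between two concentric hyperboloids. Integrating over it
  along rays expresses the hyperbolic volume through Lebesgue measure, on which invariance is
  visible.\<close>

definition cone_shell :: "(real ^ ('n::finite option)) set" where
  "cone_shell = {z. z $ None > 0 \<and> 1 \<le> lor z z \<and> lor z z \<le> 2}"

definition ray :: "real ^ ('n::finite option) \<Rightarrow> real ^ ('n option)" where
  "ray z = (1 / sqrt (lor z z)) *\<^sub>R z"

lemma ray_in_hyp: "z \<in> cone_shell \<Longrightarrow> ray z \<in> hyp"
  by (auto simp: ray_def cone_shell_def hyp_def lor_bilinear)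

lemma measurable_cone_shell [measurable]: "cone_shell \<in> sets borel"
proof -
  have "{z. z $ None > 0 \<and> 1 \<le> lor z z \<and> lor z z \<le> 2} \<in> sets borel" by measurable
  then show ?thesis unfolding cone_shell_def .
qed

lemma measurable_ray [measurable]: "ray \<in> borel_measurable borel"
  unfolding ray_def by measurable

lemma ray_opt_vec:
  assumes t: "t > 0" and q: "0 < t\<^sup>2 - (norm y)\<^sup>2"
  shows "ray (opt_vec t y) = hlift ((1 / sqrt (t\<^sup>2 - (norm y)\<^sup>2)) *\<^sub>R y)"
proof -
  define s where "s = t\<^sup>2 - (norm y)\<^sup>2"
  have s: "s > 0" using q by (simp add: s_def)
  have "sqrt (1 + (norm y)\<^sup>2 / s) = sqrt (t\<^sup>2 / s)" using s by (simp add: s_def field_simps)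
  also have "\<dots> = t / sqrt s" using t by (simp add: real_sqrt_divide)
  finally have "sqrt (1 + (norm y)\<^sup>2 / s) = t / sqrt s" .
  moreover have "(norm y)\<^sup>2 / s = (norm ((1 / sqrt s) *\<^sub>R y))\<^sup>2"
    using s by (simp add: power_mult_distrib power_divide)
  ultimately have *: "sqrt (1 + (norm ((1 / sqrt s) *\<^sub>R y))\<^sup>2) = t / sqrt s" by simp
  show ?thesis unfolding vec_eq_iff
  proof
    fix i show "ray (opt_vec t y) $ i = hlift ((1 / sqrt (t\<^sup>2 - (norm y)\<^sup>2)) *\<^sub>R y) $ i"
      using * by (cases i) (auto simp: ray_def s_def)
  qed
qed

text \<open>On each vertical line substitute \<open>q = lor z z\<close> for the time coordinate.\<close>

lemma nn_integral_vertical_line: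
  fixes y :: "real ^ 'n::finite"
  assumes A [measurable]: "A \<in> sets hborel"
  shows "(\<integral>\<^sup>+t. indicator {z \<in> cone_shell. ray z \<in> A} (opt_vec t y) \<partial>lborel) =
    (\<integral>\<^sup>+q. ennreal (indicator A (hlift ((1 / sqrt q) *\<^sub>R y)) / (2 * sqrt (q + (norm y)\<^sup>2)) * indicator {1..2} q) \<partial>lborel)"
proof -
  define w where "w = (norm y)\<^sup>2"
  have w: "w \<ge> 0" by (simp add: w_def)
  define a b where "a = sqrt (1 + w)" and "b = sqrt (2 + w)"
  have ab: "0 < a" "a \<le> b" "a\<^sup>2 = 1 + w" "b\<^sup>2 = 2 + w" using w by (auto simp: a_def b_def)
  define f :: "real \<Rightarrow> real" where "f q = indicator A (hlift ((1 / sqrt q) *\<^sub>R y)) / (2 * sqrt (q + w))" for q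
  have [measurable]: "f \<in> borel_measurable borel" unfolding f_def by measurable
  have "(\<integral>\<^sup>+q. ennreal (f q * indicator {a\<^sup>2 - w..b\<^sup>2 - w} q) \<partial>lborel)
      = (\<integral>\<^sup>+t. ennreal (f (t\<^sup>2 - w) * (2 * t) * indicator {a..b} t) \<partial>lborel)"
  proof (rule nn_integral_substitution)
    show "set_borel_measurable borel {a\<^sup>2 - w..b\<^sup>2 - w} f" unfolding set_borel_measurable_def by measurable
    show "((\<lambda>t. t\<^sup>2 - w) has_real_derivative 2 * t) (at t)" for t
      by (auto intro!: derivative_eq_intros)
    show "continuous_on {a..b} (\<lambda>t. 2 * t)" by (intro continuous_intros)
  qed (use ab in auto)
  also have "\<dots> = (\<integral>\<^sup>+t. indicator {z \<in> cone_shell. ray z \<in> A} (opt_vec t y) \<partial>lborel)"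
  proof (intro nn_integral_cong)
    fix t :: real
    have sh: "opt_vec t y \<in> cone_shell \<longleftrightarrow> t \<in> {a..b}"
    proof -
      have "t \<in> {a..b} \<longleftrightarrow> t > 0 \<and> a\<^sup>2 \<le> t\<^sup>2 \<and> t\<^sup>2 \<le> b\<^sup>2"
        using ab(1,2) by (auto simp: abs_le_square_iff[symmetric])
      then show ?thesis by (auto simp: cone_shell_def w_def[symmetric] ab)
    qed
    show "ennreal (f (t\<^sup>2 - w) * (2 * t) * indicator {a..b} t) = indicator {z \<in> cone_shell. ray z \<in> A} (opt_vec t y)"
    proof (cases "t \<in> {a..b}")
      case True
      then have "t > 0" "opt_vec t y \<in> cone_shell" using ab sh by auto
      then have r: "ray (opt_vec t y) = hlift ((1 / sqrt (t\<^sup>2 - w)) *\<^sub>R y)"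
        unfolding w_def by (intro ray_opt_vec) (auto simp: cone_shell_def)
      show ?thesis using \<open>t > 0\<close> \<open>opt_vec t y \<in> cone_shell\<close> True
        by (simp add: f_def indicator_def r)
    next
      case False
      then show ?thesis by (simp only: indicator_simps sh mem_Collect_eq simp_thms mult_zero_right ennreal_0)
    qed
  qed
  finally show ?thesis by (simp add: f_def w_def ab(3)[unfolded w_def] ab(4)[unfolded w_def])
qed

text \<open>Scaling by \<open>sqrt q\<close> carries the unit hyperboloid to the one of squared radius \<open>q\<close>, and the density of
  the hyperbolic volume to a multiple of the weight \<open>1 / sqrt (q + norm y ^ 2)\<close>.\<close>

lemma nn_integral_scaled_hvol:
  fixes A :: "(real ^ ('n::finite option)) set"
  assumes A [measurable]: "A \<in> sets hborel" and q: "q > 0"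
  shows "(\<integral>\<^sup>+y. ennreal (indicator A (hlift ((1 / sqrt q) *\<^sub>R y)) / (2 * sqrt (q + (norm y)\<^sup>2))) \<partial>lborel)
    = ennreal (sqrt q ^ CARD('n) / (2 * sqrt q)) * emeasure hvol A"
proof -
  define c where "c = sqrt q"
  have c: "c > 0" "c\<^sup>2 = q" using q by (auto simp: c_def)
  have "(\<integral>\<^sup>+y. ennreal (indicator A (hlift ((1 / c) *\<^sub>R y)) / (2 * sqrt (q + (norm y)\<^sup>2))) \<partial>lborel)
      = (\<integral>\<^sup>+v. ennreal (c ^ CARD('n)) * ennreal (indicator A (hlift v) / (2 * sqrt (q + (norm (c *\<^sub>R v))\<^sup>2))) \<partial>lborel)"
    using c by (subst lborel_affine[of c 0]) (simp_all add: nn_integral_density nn_integral_distr)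
  also have "\<dots> = (\<integral>\<^sup>+v. ennreal (c ^ CARD('n) / (2 * c)) *
      (ennreal (1 / sqrt (1 + (norm v)\<^sup>2)) * indicator A (hlift v)) \<partial>lborel)"
  proof (intro nn_integral_cong)
    fix v :: "real ^ 'n"
    have "q + (norm (c *\<^sub>R v))\<^sup>2 = c\<^sup>2 * (1 + (norm v)\<^sup>2)"
      using c by (simp add: power_mult_distrib algebra_simps)
    then have "sqrt (q + (norm (c *\<^sub>R v))\<^sup>2) = c * sqrt (1 + (norm v)\<^sup>2)"
      using c(1) by (simp add: real_sqrt_mult)
    then show "ennreal (c ^ CARD('n)) * ennreal (indicator A (hlift v) / (2 * sqrt (q + (norm (c *\<^sub>R v))\<^sup>2)))
      = ennreal (c ^ CARD('n) / (2 * c)) * (ennreal (1 / sqrt (1 + (norm v)\<^sup>2)) * indicator A (hlift v))"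
      using c by (simp add: indicator_def ennreal_mult'[symmetric])
  qed
  also have "\<dots> = ennreal (c ^ CARD('n) / (2 * c)) * emeasure hvol A"
    by (subst nn_integral_cmult) (simp_all add: emeasure_hvol)
  finally show ?thesis by (simp add: c_def)
qed

definition shell_const :: "nat \<Rightarrow> ennreal" where
  "shell_const n = (\<integral>\<^sup>+q. ennreal (sqrt q ^ n / (2 * sqrt q)) * indicator {1..2} q \<partial>lborel)"

lemma shell_const_pos: "shell_const n \<noteq> 0"
proof -
  have "ennreal (1 / 4) = (\<integral>\<^sup>+q. ennreal (1 / 4) * indicator {1..2::real} q \<partial>lborel)"
    by (subst nn_integral_cmult_indicator) auto
  also have "\<dots> \<le> shell_const n" unfolding shell_const_def
  proof (intro nn_integral_mono)
    fix q :: real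
    have "1 / 4 \<le> sqrt q ^ n / (2 * sqrt q)" if "1 \<le> q" "q \<le> 2"
    proof -
      have "1 \<le> sqrt q" "sqrt q \<le> 2" using that by (auto intro!: real_le_lsqrt)
      then have "1 \<le> sqrt q ^ n" by simp
      then have "sqrt q \<le> 2 * sqrt q ^ n" using \<open>sqrt q \<le> 2\<close> by linarith
      then show ?thesis using \<open>1 \<le> sqrt q\<close> by (simp add: field_simps)
    qed
    then show "ennreal (1 / 4) * indicator {1..2} q \<le> ennreal (sqrt q ^ n / (2 * sqrt q)) * indicator {1..2} q"
      by (auto simp: indicator_def intro!: ennreal_leI)
  qed
  finally show ?thesis by auto
qed

lemma shell_const_finite: "shell_const n \<noteq> \<infinity>"
proof -
  have "shell_const n \<le> (\<integral>\<^sup>+q. ennreal (2 ^ n) * indicator {1..2::real} q \<partial>lborel)" unfolding shell_const_def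
  proof (intro nn_integral_mono)
    fix q :: real
    have "sqrt q ^ n / (2 * sqrt q) \<le> 2 ^ n" if "1 \<le> q" "q \<le> 2"
    proof -
      have *: "1 \<le> sqrt q" "sqrt q \<le> 2" using that by (auto intro!: real_le_lsqrt)
      then have "sqrt q ^ n \<le> 2 ^ n" by (intro power_mono) auto
      moreover have "sqrt q ^ n / (2 * sqrt q) \<le> sqrt q ^ n / 1" using *
        by (intro divide_left_mono) (linarith | simp)+
      ultimately show ?thesis by simp
    qed
    then show "ennreal (sqrt q ^ n / (2 * sqrt q)) * indicator {1..2} q \<le> ennreal (2 ^ n) * indicator {1..2} q"
      by (auto simp: indicator_def intro!: ennreal_leI simp del: ennreal_power)
  qed
  also have "\<dots> < \<infinity>" by (subst nn_integral_cmult_indicator) (auto simp: ennreal_mult_less_top)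
  finally show ?thesis by simp
qed

lemma emeasure_cone_over:
  fixes A :: "(real ^ ('n::finite option)) set"
  assumes A [measurable]: "A \<in> sets hborel"
  shows "emeasure lborel {z \<in> cone_shell. ray z \<in> A} = shell_const CARD('n) * emeasure hvol A"
proof -
  define T where "T = {z \<in> cone_shell. ray z \<in> A}"
  have [measurable]: "A \<in> sets borel" using A by (simp add: sets_hborel_iff)
  have "{z. z \<in> cone_shell \<and> ray z \<in> A} \<in> sets borel" by measurable
  then have [measurable]: "T \<in> sets borel" by (simp add: T_def)
  have "emeasure lborel T = (\<integral>\<^sup>+z. indicator T z \<partial>lborel)" by simp
  also have "\<dots> = (\<integral>\<^sup>+p. indicator T (opt_vec (fst p) (snd p)) \<partial>(lborel \<Otimes>\<^sub>M lborel))"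
    by (subst lborel_opt_vec, subst nn_integral_distr) simp_all
  also have "\<dots> = (\<integral>\<^sup>+y. \<integral>\<^sup>+t. indicator T (opt_vec t y) \<partial>lborel \<partial>lborel)"
  proof -
    have "(\<lambda>p. indicator T (opt_vec (fst p) (snd p)) :: ennreal) \<in> borel_measurable (lborel \<Otimes>\<^sub>M lborel)"
      by measurable
    from lborel_pair.nn_integral_snd[OF this] show ?thesis by simp
  qed
  also have "\<dots> = (\<integral>\<^sup>+y. \<integral>\<^sup>+q. ennreal (indicator A (hlift ((1 / sqrt q) *\<^sub>R y)) / (2 * sqrt (q + (norm y)\<^sup>2)) * indicator {1..2} q) \<partial>lborel \<partial>lborel)"
    unfolding T_def by (simp only: nn_integral_vertical_line[OF A])
  also have "\<dots> = (\<integral>\<^sup>+q. \<integral>\<^sup>+y. ennreal (indicator A (hlift ((1 / sqrt q) *\<^sub>R y)) / (2 * sqrt (q + (norm y)\<^sup>2)) * indicator {1..2} q) \<partial>lborel \<partial>lborel)"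
    by (rule lborel_pair.Fubini') measurable
  also have "\<dots> = (\<integral>\<^sup>+q. ennreal (sqrt q ^ CARD('n) / (2 * sqrt q)) * indicator {1..2} q * emeasure hvol A \<partial>lborel)"
  proof (intro nn_integral_cong)
    fix q :: real
    show "(\<integral>\<^sup>+y. ennreal (indicator A (hlift ((1 / sqrt q) *\<^sub>R y)) / (2 * sqrt (q + (norm y)\<^sup>2)) * indicator {1..2} q) \<partial>lborel)
      = ennreal (sqrt q ^ CARD('n) / (2 * sqrt q)) * indicator {1..2} q * emeasure hvol A"
      using nn_integral_scaled_hvol[OF A, of q] by (cases "q \<in> {1..2}") auto
  qed
  also have "\<dots> = shell_const CARD('n) * emeasure hvol A"
    unfolding shell_const_def by (rule nn_integral_multc) measurable
  finally show ?thesis by (simp add: T_def)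
qed

text \<open>A Lorentz involution preserves the shell and maps rays to rays, so it acts on the cone over a set
  as it acts on the set, and it preserves Lebesgue measure.\<close>

lemma hvol_distr_involution:
  fixes f :: "real ^ ('n::finite option) \<Rightarrow> real ^ ('n option)"
  assumes f: "linear f" and ff: "\<And>x. f (f x) = x" and lf: "\<And>x y. lor (f x) (f y) = lor x y"
    and fh: "\<And>x. x \<in> hyp \<Longrightarrow> f x \<in> hyp"
  shows "distr hvol hborel f = hvol"
proof (rule measure_eqI)
  have fm [measurable]: "f \<in> borel_measurable borel" using f by (rule linear_borel_measurable)
  have fh' [measurable]: "f \<in> hborel \<rightarrow>\<^sub>M hborel"
    by (intro measurable_hborelI borel_measurable_hborelI fm) (auto simp: fh)
  fix A assume "A \<in> sets (distr hvol hborel f)"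
  then have A [measurable]: "A \<in> sets hborel" by simp
  have B [measurable]: "f -` A \<inter> hyp \<in> sets hborel" using measurable_sets[OF fh' A] by simp
  have rayf: "ray (f z) = f (ray z)" for z by (simp add: ray_def lf linear_scale[OF f])
  have sh: "f z \<in> cone_shell" if z: "z \<in> cone_shell" for z
  proof -
    have "z = sqrt (lor z z) *\<^sub>R ray z" using z by (auto simp: ray_def cone_shell_def)
    then have "f z = sqrt (lor z z) *\<^sub>R f (ray z)" by (metis linear_scale[OF f])
    moreover have "f (ray z) $ None > 0" using fh[OF ray_in_hyp[OF z]] by (simp add: hyp_def)
    moreover have "sqrt (lor z z) > 0" using z by (auto simp: cone_shell_def)
    ultimately have "f z $ None > 0" 
      by (simp only: vector_scaleR_component real_scaleR_def mult_pos_pos)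
    then show ?thesis using z by (auto simp: cone_shell_def lf)
  qed
  have sh': "f z \<in> cone_shell \<longleftrightarrow> z \<in> cone_shell" for z using sh[of z] sh[of "f z"] ff by auto
  have [measurable]: "A \<in> sets borel" using A by (simp add: sets_hborel_iff)
  have "{z. z \<in> cone_shell \<and> ray z \<in> A} \<in> sets borel" by measurable
  then have T [measurable]: "{z \<in> cone_shell. ray z \<in> A} \<in> sets borel" by simp
  have "shell_const CARD('n) * emeasure hvol (f -` A \<inter> hyp) = emeasure lborel {z \<in> cone_shell. ray z \<in> f -` A \<inter> hyp}"
    by (rule emeasure_cone_over[symmetric]) measurable
  also have "{z \<in> cone_shell. ray z \<in> f -` A \<inter> hyp} = f -` {z \<in> cone_shell. ray z \<in> A}"
    using ray_in_hyp by (auto simp: sh' rayf)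
  also have "emeasure lborel \<dots> = emeasure (distr lborel borel f) {z \<in> cone_shell. ray z \<in> A}"
    by (simp add: emeasure_distr)
  also have "\<dots> = shell_const CARD('n) * emeasure hvol A"
    by (simp add: lborel_distr_involution[OF f ff] emeasure_cone_over)
  finally have "emeasure hvol (f -` A \<inter> hyp) = emeasure hvol A"
    using shell_const_pos[of "CARD('n)"] shell_const_finite[of "CARD('n)"]
    by (simp add: ennreal_mult_cancel_left)
  then show "emeasure (distr hvol hborel f) A = emeasure hvol A"
    by (simp add: emeasure_distr)
qed simp

text \<open>The reflection that moves \<open>base\<close> to \<open>x\<close> preserves the volume.\<close>

lemma nn_integral_hvol_lor:
  fixes x :: "real ^ ('n::finite option)"
  assumes x: "x \<in> hyp" and [measurable]: "\<psi> \<in> borel_measurable borel"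
  shows "(\<integral>\<^sup>+y. \<psi> (lor x y) \<partial>hvol) = (\<integral>\<^sup>+(y :: real ^ ('n option)). \<psi> (lor base y) \<partial>hvol)"
proof -
  obtain f where f: "linear f" "\<And>y. f (f y) = y" "\<And>y z. lor (f y) (f z) = lor y z" "f base = x"
    using lorentz_reflection[OF x] by blast
  have fh: "f y \<in> hyp" if "y \<in> hyp" for y
  proof (rule hypI_lor_pos[OF _ x])
    show "lor (f y) (f y) = 1" using that f(3) by (simp add: hyp_def)
    show "0 < lor (f y) x" using lor_ge_1[OF that base_in_hyp] f(3,4) by (metis less_le_trans zero_less_one)
  qed
  have fm [measurable]: "f \<in> borel_measurable borel" using f(1) by (rule linear_borel_measurable)
  have fh' [measurable]: "f \<in> hborel \<rightarrow>\<^sub>M hborel"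
    by (intro measurable_hborelI borel_measurable_hborelI fm) (auto simp: fh)
  have "(\<lambda>y. \<psi> (lor x y)) \<in> borel_measurable hborel" by (intro borel_measurable_hborelI) measurable
  then have "(\<integral>\<^sup>+y. \<psi> (lor x y) \<partial>distr hvol hborel f) = (\<integral>\<^sup>+y. \<psi> (lor x (f y)) \<partial>hvol)"
    by (intro nn_integral_distr) simp_all
  also have "\<dots> = (\<integral>\<^sup>+(y :: real ^ ('n option)). \<psi> (lor base y) \<partial>hvol)"
  proof -
    have "lor x (f y) = lor base y" for y using f(3)[of base y] f(4) by simp
    then show ?thesis by simp
  qed
  finally show ?thesis by (simp add: hvol_distr_involution[OF f(1-3) fh])
qed

section \<open>Polar coordinates\<close>

lemma borel_measurable_sinh_cosh [measurable]:
  "(sinh :: real \<Rightarrow> real) \<in> borel_measurable borel" "(cosh :: real \<Rightarrow> real) \<in> borel_measurable borel"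
  by (intro borel_measurable_continuous_onI continuous_intros)+

lemma sqrt_one_plus_sinh_squared: "sqrt (1 + (sinh r)\<^sup>2) = cosh (r::real)"
  by (rule real_sqrt_unique) (auto simp: cosh_square_eq cosh_real_nonneg)

lemma measure_eqI_lessThan_real:
  fixes M N :: "real measure"
  assumes "sets M = sets borel" "sets N = sets borel"
    and "\<And>x. emeasure M {..<x} < \<infinity>"
    and "\<And>x. emeasure M {..<x} = emeasure N {..<x}"
  shows "M = N"
proof (rule measure_eqI_generator_eq[where E = "range lessThan" and \<Omega> = UNIV and A = "\<lambda>n::nat. {..<real n}"])
  show "Int_stable (range (lessThan :: real \<Rightarrow> real set))"
  proof -
    have "{..<a} \<inter> {..<b} = {..<min a b}" for a b :: real by auto
    then show ?thesis unfolding Int_stable_def by blast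
  qed
  show "sets M = sigma_sets UNIV (range lessThan)" "sets N = sigma_sets UNIV (range lessThan)"
    using assms by (simp_all add: borel_Iio)
  show "(\<Union>n::nat. {..<real n}) = UNIV" using reals_Archimedean2 by auto
  show "emeasure M {..<real n} \<noteq> \<infinity>" for n using assms(3)[of "real n"] by auto
qed (use assms in auto)

definition sphere_area :: "nat \<Rightarrow> real" where
  "sphere_area n = real n * unit_ball_vol (real n)"

lemma sphere_area_pos: "n > 0 \<Longrightarrow> sphere_area n > 0"
  by (simp add: sphere_area_def)

lemma distr_norm_lborel:
  "distr (lborel :: (real ^ 'n::finite) measure) borel norm =
    density lborel (\<lambda>t. ennreal (sphere_area CARD('n) * t ^ (CARD('n) - 1) * indicator {0..} t))"
    (is "?M = ?N")
proof (rule measure_eqI_lessThan_real)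
  let ?n = "CARD('n)"
  have ball: "norm -` {..<r} = ball (0 :: real ^ 'n) r" for r by auto
  have M: "emeasure ?M {..<r} = (if r \<ge> 0 then ennreal (unit_ball_vol (real ?n) * r ^ ?n) else 0)" for r
  proof -
    have "emeasure ?M {..<r} = emeasure lborel (ball (0 :: real ^ 'n) r)"
      by (subst emeasure_distr) (auto simp: ball)
    then show ?thesis by (auto simp: emeasure_ball ball_empty)
  qed
  then show "emeasure ?M {..<r} < \<infinity>" for r by simp
  show "emeasure ?M {..<r} = emeasure ?N {..<r}" for r
  proof (cases "r \<ge> 0")
    case True
    have "emeasure ?N {..<r} = (\<integral>\<^sup>+t. ennreal (sphere_area ?n * t ^ (?n - 1) * indicator {0..} t) * indicator {..<r} t \<partial>lborel)"
      by (subst emeasure_density) auto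
    also have "\<dots> = (\<integral>\<^sup>+t. ennreal (sphere_area ?n * t ^ (?n - 1)) * indicator {0..r} t \<partial>lborel)"
      using AE_lborel_singleton[of r]
      by (intro nn_integral_cong_AE) (auto elim!: eventually_mono simp: indicator_def)
    also have "\<dots> = ennreal (unit_ball_vol (real ?n) * r ^ ?n - unit_ball_vol (real ?n) * 0 ^ ?n)"
    proof (rule nn_integral_FTC_Icc)
      show "((\<lambda>r. unit_ball_vol (real ?n) * r ^ ?n) has_real_derivative sphere_area ?n * t ^ (?n - 1)) (at t)" for t
        by (auto intro!: derivative_eq_intros simp: sphere_area_def)
    qed (use True in \<open>auto simp: sphere_area_def\<close>)
    finally show ?thesis using True by (simp add: M zero_power)
  next
    case False
    have "emeasure ?N {..<r} = 0"
      using False by (subst emeasure_density, simp, simp, subst nn_integral_0_iff_AE) (auto simp: indicator_def)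
    then show ?thesis using False by (simp add: M)
  qed
qed auto

text \<open>After polar coordinates in the chart, \<open>t = sinh u\<close> makes \<open>u\<close> the hyperbolic distance and cancels
  the density \<open>1 / sqrt (1 + t ^ 2)\<close>.\<close>

lemma emeasure_hvol_hball:
  assumes r: "r \<ge> 0"
  shows "emeasure hvol (hball r :: (real ^ ('n::finite option)) set) =
    (\<integral>\<^sup>+u. ennreal (sphere_area CARD('n) * sinh u ^ (CARD('n) - 1)) * indicator {0..r} u \<partial>lborel)"
proof -
  let ?n = "CARD('n)" and ?B = "hball r :: (real ^ ('n option)) set"
  have cs: "cosh r = sqrt (1 + (sinh r)\<^sup>2)" by (simp add: sqrt_one_plus_sinh_squared)
  have "emeasure hvol ?B = (\<integral>\<^sup>+y. ennreal (1 / sqrt (1 + (norm y)\<^sup>2)) * indicator ?B (hlift y) \<partial>lborel)"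
    by (simp add: emeasure_hvol)
  also have "\<dots> = (\<integral>\<^sup>+(y::real^'n). ennreal (1 / sqrt (1 + (norm y)\<^sup>2)) * indicator {..<sinh r} (norm y) \<partial>lborel)"
  proof (intro nn_integral_cong)
    fix y :: "real ^ 'n"
    have "hlift y \<in> ?B \<longleftrightarrow> (norm y)\<^sup>2 < (sinh r)\<^sup>2" by (simp add: hball_nonneg r cs)
    also have "\<dots> \<longleftrightarrow> norm y < sinh r" using r
      by (auto intro: power_strict_mono power2_less_imp_less)
    finally show "ennreal (1 / sqrt (1 + (norm y)\<^sup>2)) * indicator ?B (hlift y) =
        ennreal (1 / sqrt (1 + (norm y)\<^sup>2)) * indicator {..<sinh r} (norm y)"
      by (simp add: indicator_def)
  qed
  also have "\<dots> = (\<integral>\<^sup>+t. ennreal (1 / sqrt (1 + t\<^sup>2)) * indicator {..<sinh r} t \<partial>distr (lborel :: (real ^ 'n) measure) borel norm)"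
    by (subst nn_integral_distr) auto
  also have "\<dots> = (\<integral>\<^sup>+t. ennreal (sphere_area ?n * t ^ (?n - 1) * indicator {0..} t) * (ennreal (1 / sqrt (1 + t\<^sup>2)) * indicator {..<sinh r} t) \<partial>lborel)"
    unfolding distr_norm_lborel by (subst nn_integral_density) auto
  also have "\<dots> = (\<integral>\<^sup>+t. ennreal (sphere_area ?n * t ^ (?n - 1) / sqrt (1 + t\<^sup>2) * indicator {sinh 0..sinh r} t) \<partial>lborel)"
  proof (intro nn_integral_cong_AE, use AE_lborel_singleton[of "sinh r"] in eventually_elim)
    case (elim t)
    show ?case
    proof (cases "0 \<le> t \<and> t < sinh r")
      case True
      then show ?thesis by (simp add: sphere_area_def ennreal_mult'[symmetric])
    next
      case False
      with elim show ?thesis by (auto simp: indicator_def)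
    qed
  qed
  also have "\<dots> = (\<integral>\<^sup>+u. ennreal (sphere_area ?n * sinh u ^ (?n - 1) / sqrt (1 + (sinh u)\<^sup>2) * cosh u * indicator {0..r} u) \<partial>lborel)"
  proof (rule nn_integral_substitution)
    show "set_borel_measurable borel {sinh 0..sinh r} (\<lambda>t. sphere_area ?n * t ^ (?n - 1) / sqrt (1 + t\<^sup>2))"
      unfolding set_borel_measurable_def by measurable
    show "(sinh has_real_derivative cosh u) (at u)" for u :: real
      by (auto intro!: derivative_eq_intros)
    show "continuous_on {0..r} cosh" by (intro continuous_intros)
  qed (use r in \<open>auto simp: cosh_real_nonneg\<close>)
  also have "\<dots> = (\<integral>\<^sup>+u. ennreal (sphere_area ?n * sinh u ^ (?n - 1)) * indicator {0..r} u \<partial>lborel)"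
  proof (intro nn_integral_cong)
    fix u :: real
    have "sqrt (1 + (sinh u)\<^sup>2) = cosh u" by (rule sqrt_one_plus_sinh_squared)
    moreover have "cosh u \<noteq> 0" using cosh_real_pos[of u] by simp
    ultimately show "ennreal (sphere_area ?n * sinh u ^ (?n - 1) / sqrt (1 + (sinh u)\<^sup>2) * cosh u * indicator {0..r} u)
      = ennreal (sphere_area ?n * sinh u ^ (?n - 1)) * indicator {0..r} u"
      by (simp add: indicator_def)
  qed
  finally show ?thesis .
qed

lemma emeasure_hvol_hball_le:
  assumes r: "r \<ge> 0" and n: "CARD('n::finite) \<ge> 2"
  shows "emeasure hvol (hball r :: (real ^ ('n option)) set)
    \<le> ennreal (sphere_area CARD('n) * exp ((real CARD('n) - 1) * r))"
proof -
  let ?n = "CARD('n)"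
  define m where "m = real ?n - 1"
  have m: "m \<ge> 1" using n by (simp add: m_def)
  have S: "sphere_area ?n > 0" by (simp add: sphere_area_pos)
  have "emeasure hvol (hball r :: (real ^ ('n option)) set)
      \<le> (\<integral>\<^sup>+u. ennreal (sphere_area ?n * exp (m * u)) * indicator {0..r} u \<partial>lborel)"
    unfolding emeasure_hvol_hball[OF r]
  proof (intro nn_integral_mono)
    fix u :: real
    have "sinh u ^ (?n - 1) \<le> exp (m * u)" if "u \<ge> 0"
    proof -
      have "sinh u \<le> exp u" using sinh_plus_cosh[of u] cosh_real_nonneg[of u] by linarith
      then have "sinh u ^ (?n - 1) \<le> exp u ^ (?n - 1)" using that by (intro power_mono) auto
      also have "\<dots> = exp (m * u)" using n by (simp add: m_def exp_of_nat_mult[symmetric] of_nat_diff)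
      finally show ?thesis .
    qed
    then show "ennreal (sphere_area ?n * sinh u ^ (?n - 1)) * indicator {0..r} u
      \<le> ennreal (sphere_area ?n * exp (m * u)) * indicator {0..r} u"
      using S by (auto simp: indicator_def intro!: ennreal_leI)
  qed
  also have "\<dots> = ennreal (sphere_area ?n * exp (m * r) / m - sphere_area ?n * exp (m * 0) / m)"
  proof (rule nn_integral_FTC_Icc)
    show "((\<lambda>u. sphere_area ?n * exp (m * u) / m) has_real_derivative sphere_area ?n * exp (m * u)) (at u)" for u
      using m by (auto intro!: derivative_eq_intros)
  qed (use r S in auto)
  also have "\<dots> \<le> ennreal (sphere_area ?n * exp (m * r))"
  proof (rule ennreal_leI)
    have "sphere_area ?n * exp (m * r) / m \<le> sphere_area ?n * exp (m * r) / 1"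
      using m S by (intro divide_left_mono) auto
    moreover have "sphere_area ?n * exp (m * 0) / m \<ge> 0" using m S by simp
    ultimately show "sphere_area ?n * exp (m * r) / m - sphere_area ?n * exp (m * 0) / m \<le> sphere_area ?n * exp (m * r)"
      by simp
  qed
  finally show ?thesis by (simp add: m_def)
qed

lemma emeasure_hvol_hball_finite: "emeasure hvol (hball r :: (real ^ ('n::finite option)) set) < \<infinity>"
proof (cases "r \<ge> 0")
  case True
  have "emeasure hvol (hball r :: (real ^ ('n option)) set)
      \<le> (\<integral>\<^sup>+u. ennreal (sphere_area CARD('n) * sinh r ^ (CARD('n) - 1)) * indicator {0..r} u \<partial>lborel)"
    unfolding emeasure_hvol_hball[OF True]
  proof (intro nn_integral_mono)
    fix u :: real
    show "ennreal (sphere_area CARD('n) * sinh u ^ (CARD('n) - 1)) * indicator {0..r} u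
      \<le> ennreal (sphere_area CARD('n) * sinh r ^ (CARD('n) - 1)) * indicator {0..r} u"
      using sphere_area_pos[of "CARD('n)"]
      by (auto simp: indicator_def intro!: ennreal_leI mult_left_mono power_mono)
  qed
  also have "\<dots> < \<infinity>" by (subst nn_integral_cmult_indicator) (auto simp: True ennreal_mult_less_top)
  finally show ?thesis .
qed (simp add: hball_nonpos)

lemma emeasure_hvol_hball_pos:
  assumes "r > 0" shows "emeasure hvol (hball r :: (real ^ ('n::finite option)) set) > 0"
proof (rule ccontr)
  assume "\<not> ?thesis"
  then have "(\<integral>\<^sup>+u. ennreal (sphere_area CARD('n) * sinh u ^ (CARD('n) - 1)) * indicator {0..r} u \<partial>lborel) = 0"
    using assms by (simp add: emeasure_hvol_hball)
  then have "AE u in lborel. ennreal (sphere_area CARD('n) * sinh u ^ (CARD('n) - 1)) * indicator {0..r} u = 0"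
    by (subst (asm) nn_integral_0_iff_AE) auto
  then have "AE u in lborel. u \<notin> {0<..<r}"
  proof eventually_elim
    case (elim u)
    have "sphere_area CARD('n) * sinh u ^ (CARD('n) - 1) > 0" if "u > 0"
      using that sphere_area_pos[of "CARD('n)"] by simp
    with elim show ?case by (auto simp: indicator_def)
  qed
  then have "emeasure lborel {u. 0 < u \<and> u < r} = 0" by (subst (asm) AE_iff_measurable[OF _ refl]) auto
  moreover have "{u. 0 < u \<and> u < r} = {0<..<r}" by auto
  ultimately show False using assms by simp
qed

lemma borel_measurable_hdist_base [measurable]:
  "(\<lambda>x :: real ^ ('n::finite option). hdist x base) \<in> borel_measurable hborel"
proof (rule borel_measurableI_less)
  fix r :: real
  have "{x \<in> space hborel. hdist x base < r} = (hball r :: (real ^ ('n option)) set)" by (simp add: hball_def)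
  then show "{x::real ^ ('n option) \<in> space hborel. hdist x base < r} \<in> sets hborel" by simp
qed

lemma distr_hvol_hdist:
  "distr (hvol :: (real ^ ('n::finite option)) measure) borel (\<lambda>x. hdist x base) =
    density lborel (\<lambda>u. ennreal (sphere_area CARD('n) * sinh u ^ (CARD('n) - 1) * indicator {0..} u))"
    (is "?M = ?N")
proof (rule measure_eqI_lessThan_real)
  have M: "emeasure ?M {..<r} = emeasure hvol (hball r :: (real ^ ('n option)) set)" for r
    by (subst emeasure_distr) (auto intro!: arg_cong2[where f = emeasure] simp: hball_def)
  show "emeasure ?M {..<r} < \<infinity>" for r by (simp only: M emeasure_hvol_hball_finite)
  show "emeasure ?M {..<r} = emeasure ?N {..<r}" for r
  proof (cases "r \<ge> 0")
    case True
    have "emeasure ?N {..<r} = (\<integral>\<^sup>+u. ennreal (sphere_area CARD('n) * sinh u ^ (CARD('n) - 1) * indicator {0..} u) * indicator {..<r} u \<partial>lborel)"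
      by (subst emeasure_density) auto
    also have "\<dots> = (\<integral>\<^sup>+u. ennreal (sphere_area CARD('n) * sinh u ^ (CARD('n) - 1)) * indicator {0..r} u \<partial>lborel)"
      using AE_lborel_singleton[of r]
      by (intro nn_integral_cong_AE) (auto elim!: eventually_mono simp: indicator_def)
    finally show ?thesis by (simp add: M emeasure_hvol_hball True)
  next
    case False
    have "emeasure ?N {..<r} = 0"
      using False by (subst emeasure_density, simp, simp, subst nn_integral_0_iff_AE) (auto simp: indicator_def)
    then show ?thesis using False by (simp add: M hball_nonpos)
  qed
qed auto

lemma integral_hvol_radial:
  fixes h :: "real \<Rightarrow> complex"
  assumes [measurable]: "h \<in> borel_measurable borel"
  shows "(LINT x|(hvol :: (real ^ ('n::finite option)) measure). h (hdist x base)) =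
    (LINT u|lborel. (sphere_area CARD('n) * sinh u ^ (CARD('n) - 1) * indicator {0..} u) *\<^sub>R h u)"
proof -
  have "(LINT x|(hvol :: (real ^ ('n option)) measure). h (hdist x base)) =
      (LINT u|distr (hvol :: (real ^ ('n option)) measure) borel (\<lambda>x. hdist x base). h u)"
    by (subst integral_distr) auto
  also have "\<dots> = (LINT u|lborel. (sphere_area CARD('n) * sinh u ^ (CARD('n) - 1) * indicator {0..} u) *\<^sub>R h u)"
    unfolding distr_hvol_hdist using sphere_area_pos[of "CARD('n)"]
    by (subst integral_density) (auto simp: indicator_def)
  finally show ?thesis .
qed

section \<open>Invariant measures on the hyperboloid\<close>

text \<open>A continuous tent over the ball of radius \<open>arcosh (1 + r)\<close> about \<open>x\<close>. Expressed through \<open>lor\<close>, it is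
  visibly preserved when an isometry moves both arguments.\<close>

definition hker :: "real \<Rightarrow> real ^ ('n::finite option) \<Rightarrow> real ^ ('n option) \<Rightarrow> real" where
  "hker r x y = max 0 (r - (lor x y - 1))"

lemma hker_nonneg [simp]: "hker r x y \<ge> 0"
  by (simp add: hker_def)

lemma measurable_hker [measurable (raw)]:
  assumes [measurable]: "f \<in> borel_measurable M" "g \<in> borel_measurable M"
  shows "(\<lambda>x. hker r (f x) (g x)) \<in> borel_measurable M"
  unfolding hker_def by measurable

lemma hker_le:
  assumes "x \<in> hyp" "y \<in> hyp" "r \<ge> 0" shows "hker r x y \<le> r"
  using lor_ge_1[OF assms(1,2)] assms(3) by (simp add: hker_def)

text \<open>A reflection moves \<open>x\<close> to the base point, and there the Euclidean distance to \<open>base\<close> is a function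
  of the time coordinate.\<close>

lemma hker_concentrates:
  fixes x :: "real ^ ('n::finite option)"
  assumes x: "x \<in> hyp" and U: "open U" "x \<in> U"
  shows "eventually (\<lambda>n. \<forall>y\<in>hyp. hker (1 / real (Suc n)) x y \<noteq> 0 \<longrightarrow> y \<in> U) sequentially"
proof -
  obtain f where f: "linear f" "\<And>y. f (f y) = y" "\<And>y z. lor (f y) (f z) = lor y z" "f base = x"
    using lorentz_reflection[OF x] by blast
  obtain e where e: "e > 0" "ball x e \<subseteq> U" using U by (meson openE)
  obtain K where K: "\<And>v. norm (f v) \<le> norm v * K" "K > 0"
    using bounded_linear.pos_bounded[of f] f(1) by (auto simp: linear_conv_bounded_linear)
  have "(\<lambda>n. sqrt (4 * (1 / real (Suc n))) * K) \<longlonglongrightarrow> sqrt (4 * 0) * K"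
    by (intro tendsto_intros LIMSEQ_inverse_real_of_nat[unfolded inverse_eq_divide])
  then have "(\<lambda>n. sqrt (4 * (1 / real (Suc n))) * K) \<longlonglongrightarrow> 0" by simp
  then have "eventually (\<lambda>n. sqrt (4 * (1 / real (Suc n))) * K < e) sequentially"
    using e(1) by (rule order_tendstoD)
  then show ?thesis
  proof eventually_elim
    case (elim n)
    define r where "r = 1 / real (Suc n)"
    have r: "0 < r" "r \<le> 1" by (auto simp: r_def)
    show ?case
    proof safe
      fix y assume y: "y \<in> hyp" "hker (1 / real (Suc n)) x y \<noteq> 0"
      define t where "t = f y $ None"
      have t: "t = lor x y" using f(3)[of base "f y"] f(2)[of y] by (simp add: t_def f(4))
      have t1: "1 \<le> t" "t < 1 + r" using y lor_ge_1[OF x y(1)]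
        by (auto simp: t hker_def r_def max_def split: if_splits)
      have "lor (f y) (f y) = 1" using f(3) y by (simp add: hyp_def)
      then have "(norm (f y - base))\<^sup>2 = 2 * (t - 1)\<^sup>2 - (1 - t - (t - 1))"
        by (simp add: norm_eq_lor lor_bilinear t_def)
      also have "\<dots> = 2 * t * (t - 1)" by (simp add: power2_eq_square algebra_simps)
      also have "\<dots> \<le> 2 * 2 * r" using t1 r by (intro mult_mono) auto
      finally have "norm (f y - base) \<le> sqrt (4 * r)" by (simp add: real_le_rsqrt)
      have "dist x y = norm (f (f y - base))" by (simp add: dist_norm norm_minus_commute linear_diff[OF f(1)] f(2,4))
      also have "\<dots> \<le> norm (f y - base) * K" by (rule K)
      also have "\<dots> \<le> sqrt (4 * r) * K" using \<open>norm (f y - base) \<le> sqrt (4 * r)\<close> K(2) by simp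
      also have "\<dots> < e" using elim by (simp add: r_def)
      finally show "y \<in> U" using e by auto
    qed
  qed
qed

lemma loc_fin_hypI:
  fixes A :: "(real ^ ('n::finite option)) measure"
  assumes "sets A = sets hborel" "\<And>B. B \<in> sets hborel \<Longrightarrow> hbounded B \<Longrightarrow> emeasure A B < \<infinity>"
  shows "loc_fin hyp A"
  unfolding loc_fin_def
proof safe
  fix U :: "(real ^ ('n option)) set" assume "open U" "bounded U"
  then show "emeasure A (U \<inter> hyp) < \<infinity>"
    by (intro assms(2)) (auto simp: sets_hborel_iff hbounded_iff_bounded bounded_Int)
qed (use assms in \<open>auto simp: hborel_def\<close>)

text \<open>A multiplicative form of the triangle inequality for the distances between \<open>base\<close>, \<open>x\<close> and \<open>y\<close>,
  whose hyperbolic cosines are the three quantities involved.\<close>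

lemma hyp_nth_le:
  assumes x: "x \<in> hyp" and y: "y \<in> hyp"
  shows "y $ None \<le> 2 * x $ None * lor x y"
proof -
  define a b where "a = norm (spatial x)" and "b = norm (spatial y)"
  have a: "a\<^sup>2 = (x $ None)\<^sup>2 - 1" and b: "b\<^sup>2 = (y $ None)\<^sup>2 - 1"
    using x y by (simp_all add: a_def b_def hyp_norm_spatial)
  have x0: "x $ None \<ge> 1" and y0: "y $ None \<ge> 1" using hyp_nth_ge_1 x y by auto
  have ab: "0 \<le> a" "0 \<le> b" by (auto simp: a_def b_def)
  have "b \<le> y $ None" by (rule power2_le_imp_le) (use b y0 in auto)
  have ax: "a \<le> x $ None" by (rule power2_le_imp_le) (use a x0 in auto)
  have "spatial x \<bullet> spatial y \<le> a * b" unfolding a_def b_def by (rule norm_cauchy_schwarz)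
  also have "\<dots> \<le> a * y $ None" using \<open>b \<le> y $ None\<close> ab by (intro mult_left_mono) auto
  finally have l: "(x $ None - a) * y $ None \<le> lor x y" by (simp add: lor_eq_inner algebra_simps)
  have "(x $ None + a) * (x $ None - a) = 1"
    using a by (simp add: power2_eq_square algebra_simps)
  then have "y $ None = (x $ None + a) * ((x $ None - a) * y $ None)"
    by (simp add: mult.assoc[symmetric])
  also have "\<dots> \<le> (x $ None + a) * lor x y" using l x0 ab by (intro mult_left_mono) auto
  also have "\<dots> \<le> (2 * x $ None) * lor x y" using ax lor_ge_1[OF x y] by (intro mult_right_mono) auto
  finally show ?thesis .
qed

lemma hker_nonzero_in_hball:
  assumes "x \<in> hyp" "y \<in> hyp" "hker r x y \<noteq> 0" "x $ None \<le> M" "r \<ge> 0"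
  shows "y \<in> hball (arcosh (2 * M * (1 + r) + 1))"
proof -
  have M: "M \<ge> 1" using hyp_nth_ge_1[OF assms(1)] assms(4) by simp
  have l: "lor x y < 1 + r" using assms(3) by (auto simp: hker_def max_def split: if_splits)
  have "y $ None \<le> 2 * x $ None * lor x y" by (rule hyp_nth_le[OF assms(1,2)])
  also have "\<dots> \<le> 2 * M * (1 + r)"
    using assms(4) l hyp_nth_ge_1[OF assms(1)] lor_ge_1[OF assms(1,2)] by (intro mult_mono) auto
  finally have "y $ None < 2 * M * (1 + r) + 1" by simp
  moreover have "0 \<le> 2 * M * (1 + r)" using M assms(5) by simp
  then have "cosh (arcosh (2 * M * (1 + r) + 1)) = 2 * M * (1 + r) + 1" "arcosh (2 * M * (1 + r) + 1) \<ge> 0"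
    by (auto intro!: cosh_arcosh_real arcosh_nonneg_real)
  ultimately show ?thesis using assms(2) by (simp add: hball_nonneg)
qed

lemma nn_integral_hker_finite:
  fixes x :: "real ^ ('n::finite option)"
  assumes A: "loc_fin hyp A" and x: "x \<in> hyp" and r: "0 \<le> r"
  shows "(\<integral>\<^sup>+y. ennreal (hker r x y) \<partial>A) < \<infinity>"
proof -
  define B where "B = (hball (arcosh (2 * x $ None * (1 + r) + 1)) :: (real ^ ('n option)) set)"
  have "bounded B" using hbounded_iff_bounded[OF hball_subset_hyp] hbounded_hball unfolding B_def by blast
  then obtain K where K: "B \<subseteq> ball 0 K" using bounded_subset_ballD by blast
  have U [measurable]: "ball 0 K \<inter> hyp \<in> sets A" by (intro loc_fin_sets_Int[OF A]) auto
  have "(\<integral>\<^sup>+y. ennreal (hker r x y) \<partial>A) \<le> (\<integral>\<^sup>+y. ennreal r * indicator (ball 0 K \<inter> hyp) y \<partial>A)"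
  proof (intro nn_integral_mono)
    fix y assume "y \<in> space A"
    then have y: "y \<in> hyp" by (simp add: loc_fin_space[OF A])
    show "ennreal (hker r x y) \<le> ennreal r * indicator (ball 0 K \<inter> hyp) y"
    proof (cases "hker r x y = 0")
      case False
      then have "y \<in> B" unfolding B_def by (rule hker_nonzero_in_hball[OF x y _ order_refl r])
      then show ?thesis using K y hker_le[OF x y r] by (auto simp: indicator_def intro!: ennreal_leI)
    qed simp
  qed
  also have "\<dots> = ennreal r * emeasure A (ball 0 K \<inter> hyp)" by (simp add: nn_integral_cmult_indicator)
  also have "\<dots> < \<infinity>" using A by (auto simp: loc_fin_def ennreal_mult_less_top)
  finally show ?thesis .
qed

lemma loc_fin_hvol: "loc_fin hyp (hvol :: (real ^ ('n::finite option)) measure)"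
proof (rule loc_fin_hypI)
  fix B :: "(real ^ ('n option)) set" assume B: "B \<in> sets hborel" "hbounded B"
  then obtain R where "B \<subseteq> hball R" by (auto simp: hbounded_def)
  then have "emeasure hvol B \<le> emeasure hvol (hball R :: (real ^ ('n option)) set)" by (intro emeasure_mono) auto
  then show "emeasure hvol B < \<infinity>" using emeasure_hvol_hball_finite by (rule le_less_trans)
qed simp

lemma nn_integral_hvol_hker_pos:
  assumes "r > 0"
  shows "0 < (\<integral>\<^sup>+(y :: real ^ ('n::finite option)). ennreal (hker r base y) \<partial>hvol)"
proof (rule ccontr)
  let ?B = "hball (arcosh (1 + r)) :: (real ^ ('n option)) set"
  have ar: "arcosh (1 + r) > 0" using assms by simp
  have [measurable]: "(\<lambda>y :: real ^ ('n option). hker r base y) \<in> borel_measurable hborel"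
    by (intro borel_measurable_hborelI) measurable
  assume "\<not> ?thesis"
  then have "(\<integral>\<^sup>+(y :: real ^ ('n option)). ennreal (hker r base y) \<partial>hvol) = 0" by simp
  then have "AE y :: real ^ ('n option) in hvol. ennreal (hker r base y) = 0"
    by (subst (asm) nn_integral_0_iff_AE) simp_all
  then have "AE y in hvol. y \<notin> ?B"
  proof eventually_elim
    case (elim y)
    then show ?case using assms ar
      by (auto simp: hball_nonneg cosh_arcosh_real hker_def ennreal_eq_0_iff)
  qed
  then have "emeasure hvol ?B = 0"
    by (subst (asm) AE_iff_measurable[of ?B]) (auto dest: subsetD[OF hball_subset_hyp])
  with emeasure_hvol_hball_pos[OF ar, where 'n = 'n] show False by simp
qed

text \<open>The hyperbolic volume itself gives all tents of the same size the same positive mass, so it can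
  serve as the reference measure in the proportionality theorem.\<close>

theorem invariant_measure_unique:
  fixes A :: "(real ^ ('n::finite option)) measure"
  assumes A: "loc_fin hyp A"
    and a: "\<And>n x. x \<in> hyp \<Longrightarrow> (\<integral>\<^sup>+y. ennreal (hker (1 / real (Suc n)) x y) \<partial>A) = a n"
  obtains c where "c \<ge> 0" "A = scale_measure (ennreal c) hvol"
proof (rule uniformly_distributed_unique[OF A loc_fin_hvol base_in_hyp,
      where k = "\<lambda>n x y. ennreal (hker (1 / real (Suc n)) x y)" and a = a
      and b = "\<lambda>n. \<integral>\<^sup>+(y :: real ^ ('n option)). ennreal (hker (1 / real (Suc n)) base y) \<partial>hvol"])
  show "(\<lambda>p. ennreal (hker (1 / real (Suc n)) (fst p) (snd p :: real ^ ('n option)))) \<in> borel_measurable (borel \<Otimes>\<^sub>M borel)" for n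
    by measurable
  show "ennreal (hker (1 / real (Suc n)) x y) = ennreal (hker (1 / real (Suc n)) y x)" for n and x y :: "real ^ ('n option)"
    by (simp add: hker_def lor_commute)
  show "eventually (\<lambda>n. \<forall>y\<in>hyp. ennreal (hker (1 / real (Suc n)) x y) \<noteq> 0 \<longrightarrow> y \<in> U) sequentially"
    if "x \<in> hyp" "open U" "x \<in> U" for x :: "real ^ ('n option)" and U
    using hker_concentrates[OF that] by eventually_elim auto
  show "(\<integral>\<^sup>+y. ennreal (hker (1 / real (Suc n)) x y) \<partial>hvol) = (\<integral>\<^sup>+(y :: real ^ ('n option)). ennreal (hker (1 / real (Suc n)) base y) \<partial>hvol)"
    if "x \<in> hyp" for n and x :: "real ^ ('n option)"
    unfolding hker_def by (rule nn_integral_hvol_lor[OF that]) measurable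
  show "a n < \<infinity>" for n using a[OF base_in_hyp, of n] nn_integral_hker_finite[OF A base_in_hyp, of "1 / real (Suc n)"] by simp
  show "(\<integral>\<^sup>+(y :: real ^ ('n option)). ennreal (hker (1 / real (Suc n)) base y) \<partial>hvol) < \<infinity>" for n
    by (intro nn_integral_hker_finite loc_fin_hvol) auto
  show "0 < (\<integral>\<^sup>+(y :: real ^ ('n option)). ennreal (hker (1 / real (Suc n)) base y) \<partial>hvol)" for n
    by (intro nn_integral_hvol_hker_pos) auto
qed (use a that in auto)

section \<open>Haar measure and the orbit map\<close>

lemma continuous_on_orbit: "continuous_on UNIV (\<lambda>g :: real ^ 'n::finite ^ 'm::finite. g *v x)"
proof -
  have "linear (\<lambda>g :: real ^ 'n ^ 'm. g *v x)"
    by (rule linearI) (simp_all add: matrix_vector_mult_add_rdistrib scaleR_matrix_vector_assoc)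
  then show ?thesis by (simp add: linear_conv_bounded_linear linear_continuous_on)
qed

lemma continuous_on_left_mult: "continuous_on UNIV (\<lambda>h :: real ^ 'n::finite ^ 'm::finite. g ** h)"
proof -
  have "linear (\<lambda>h :: real ^ 'n ^ 'm. g ** h)"
  proof (rule linearI)
    fix A B :: "real ^ 'n ^ 'm" and c :: real
    show "g ** (A + B) = g ** A + g ** B" by (rule matrix_add_ldistrib)
    show "g ** (c *\<^sub>R A) = c *\<^sub>R (g ** A)"
      by (simp add: vec_eq_iff matrix_matrix_mult_def sum_distrib_left mult_ac)
  qed
  then show ?thesis by (simp add: linear_conv_bounded_linear linear_continuous_on)
qed

lemma continuous_on_det: "continuous_on UNIV (det :: real ^ 'n::finite ^ 'n \<Rightarrow> real)"
  unfolding det_def by (intro continuous_intros)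

lemma closed_SO1: "closed (SO1 :: (real ^ ('n::finite option) ^ ('n option)) set)"
proof -
  let ?T = "UNIV :: (real ^ ('n option) ^ ('n option)) set"
  \<comment> \<open>A time coordinate on the hyperboloid is at least 1, which replaces strict positivity by a closed condition.\<close>
  have eq: "(SO1 :: (real ^ ('n option) ^ ('n option)) set) =
      (\<Inter>x. \<Inter>y. {g. lor (g *v x) (g *v y) = lor x y}) \<inter> {g. det g = 1} \<inter> {g. 1 \<le> (g *v base) $ None}"
  proof safe
    fix g :: "real ^ ('n option) ^ ('n option)" assume "g \<in> SO1"
    then show "1 \<le> (g *v base) $ None" by (intro hyp_nth_ge_1 SO1_hyp) auto
  next
    fix g :: "real ^ ('n option) ^ ('n option)"
    assume g: "g \<in> (\<Inter>x. \<Inter>y. {g. lor (g *v x) (g *v y) = lor x y})" "det g = 1" "1 \<le> (g *v base) $ None"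
    then have l: "lor (g *v x) (g *v y) = lor x y" for x y by auto
    show "g \<in> SO1"
      by (rule SO1I[of g base]) (use l[of base base] g in \<open>auto simp: l hyp_def\<close>)
  qed (auto simp: SO1_lor SO1_det)
  have "closed {g :: real ^ ('n option) ^ ('n option). lor (g *v x) (g *v y) = lor x y}" for x y
    by (intro closed_Collect_eq continuous_intros continuous_on_orbit)
  moreover have "closed {g :: real ^ ('n option) ^ ('n option). det g = 1}"
    by (intro closed_Collect_eq continuous_on_det continuous_intros)
  moreover have "closed {g :: real ^ ('n option) ^ ('n option). 1 \<le> (g *v base) $ None}"
    by (intro closed_Collect_le continuous_intros continuous_on_orbit)
  ultimately show ?thesis unfolding eq by (intro closed_Int closed_INT) auto
qed

text \<open>The Euclidean form is \<open>2 v\<^sub>0\<^sup>2 - lor v v\<close>, and \<open>lor (g v) base\<close>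
  is \<open>lor v (h base)\<close> for the inverse \<open>h\<close> of \<open>g\<close>, where
  \<open>lor (h base) base = lor base (g base)\<close>.\<close>

lemma SO1_norm_le:
  assumes g: "g \<in> SO1" and K: "(g *v base) $ None \<le> K"
  shows "norm (g *v v) \<le> 2 * K * norm v"
proof -
  obtain h where h: "h \<in> SO1" "\<And>x. h *v (g *v x) = x" "\<And>x. g *v (h *v x) = x" using SO1_inverse[OF g] by blast
  define w where "w = h *v base"
  have w: "w \<in> hyp" unfolding w_def by (intro SO1_hyp h) auto
  have "w $ None = lor w base" by simp
  also have "\<dots> = lor (g *v w) (g *v base)" by (simp only: SO1_lor[OF g])
  also have "\<dots> = (g *v base) $ None" by (simp add: w_def h)
  finally have w0: "w $ None \<le> K" using K by simp
  have K1: "K \<ge> 1" using hyp_nth_ge_1[OF w] w0 by simp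
  have "(norm w)\<^sup>2 = 2 * (w $ None)\<^sup>2 - 1" using w by (simp add: norm_eq_lor hyp_def)
  moreover have "(w $ None)\<^sup>2 \<le> K\<^sup>2" using w0 hyp_nth_ge_1[OF w] by (intro power_mono) auto
  ultimately have nw: "(norm w)\<^sup>2 \<le> 2 * K\<^sup>2 - 1" by simp
  define w' where "w' = opt_vec (w $ None) (- spatial w)"
  have nw': "norm w' = norm w"
  proof -
    have "(norm w')\<^sup>2 = (norm w)\<^sup>2" by (simp add: norm_eq_lor lor_eq_inner w'_def)
    then show ?thesis by simp
  qed
  have "(g *v v) $ None = lor (g *v v) (g *v w)" by (simp add: w_def h)
  also have "\<dots> = lor v w" by (rule SO1_lor[OF g])
  also have "\<dots> = v \<bullet> w'" by (simp add: lor_eq_inner inner_vec_def sum_option_UNIV w'_def sum_negf)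
  finally have "\<bar>(g *v v) $ None\<bar> \<le> norm v * norm w" using Cauchy_Schwarz_ineq2[of v w'] nw' by simp
  then have g0: "((g *v v) $ None)\<^sup>2 \<le> (norm v)\<^sup>2 * (norm w)\<^sup>2"
    by (metis abs_le_square_iff abs_mult abs_norm_cancel power_mult_distrib)
  have "(norm v)\<^sup>2 * (norm w)\<^sup>2 \<le> (norm v)\<^sup>2 * (2 * K\<^sup>2 - 1)" by (intro mult_left_mono nw) auto
  with g0 have g1: "((g *v v) $ None)\<^sup>2 \<le> (norm v)\<^sup>2 * (2 * K\<^sup>2 - 1)" by linarith
  have "- lor v v \<le> (norm v)\<^sup>2" using norm_eq_lor[of v] zero_le_power2[of "v $ None"] by linarith
  then have "(norm (g *v v))\<^sup>2 \<le> 2 * ((norm v)\<^sup>2 * (2 * K\<^sup>2 - 1)) + (norm v)\<^sup>2"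
    using g1 by (simp add: norm_eq_lor[of "g *v v"] SO1_lor[OF g])
  also have "\<dots> \<le> (2 * K * norm v)\<^sup>2" by (simp add: power_mult_distrib algebra_simps)
  finally show ?thesis by (rule power2_le_imp_le) (use K1 in auto)
qed

lemma compact_SO1_bounded_orbit:
  "compact {g \<in> (SO1 :: (real ^ ('n::finite option) ^ ('n option)) set). (g *v base) $ None \<le> K}"
    (is "compact ?C")
  unfolding compact_eq_bounded_closed
proof
  show "bounded ?C" unfolding bounded_iff
  proof (intro exI ballI)
    fix g assume g: "g \<in> ?C"
    have K: "K \<ge> 1" using g hyp_nth_ge_1[OF SO1_hyp[of g base]] by auto
    have e: "norm (g $ i $ j) \<le> 2 * K" for i j
    proof -
      have "g $ i $ j = (g *v axis j 1) $ i"
        by (simp add: matrix_vector_mult_basis column_def)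
      moreover have "norm ((g *v axis j 1) $ i) \<le> norm (g *v axis j 1)" by (rule Finite_Cartesian_Product.norm_nth_le)
      moreover have "norm (g *v axis j 1) \<le> 2 * K * norm (axis j 1 :: real ^ ('n option))" using g by (intro SO1_norm_le) auto
      ultimately show ?thesis by simp
    qed
    have "norm g \<le> (\<Sum>i\<in>UNIV. norm (g $ i))" unfolding norm_vec_def by (rule L2_set_le_sum) auto
    also have "\<dots> \<le> (\<Sum>i\<in>(UNIV :: 'n option set). \<Sum>j\<in>(UNIV :: 'n option set). 2 * K)"
    proof (intro sum_mono)
      fix i
      have "norm (g $ i) \<le> (\<Sum>j\<in>UNIV. norm (g $ i $ j))" unfolding norm_vec_def by (rule L2_set_le_sum) auto
      also have "\<dots> \<le> (\<Sum>j\<in>(UNIV :: 'n option set). 2 * K)" by (intro sum_mono e)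
      finally show "norm (g $ i) \<le> (\<Sum>j\<in>(UNIV :: 'n option set). 2 * K)" .
    qed
    finally show "norm g \<le> (\<Sum>i\<in>(UNIV :: 'n option set). \<Sum>j\<in>(UNIV :: 'n option set). 2 * K)" .
  qed
  have "closed {g :: real ^ ('n option) ^ ('n option). (g *v base) $ None \<le> K}"
    by (intro closed_Collect_le continuous_intros continuous_on_orbit)
  then have "closed (SO1 \<inter> {g :: real ^ ('n option) ^ ('n option). (g *v base) $ None \<le> K})"
    using closed_SO1 by (rule closed_Int[rotated])
  then show "closed ?C" by (simp add: Int_def)
qed

lemma haar_sets: "haar_measure m \<Longrightarrow> sets m = sets (restrict_space borel SO1)"
  by (simp add: haar_measure_def)

lemma haar_space: "haar_measure m \<Longrightarrow> space m = SO1"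
  using sets_eq_imp_space_eq[OF haar_sets] by (simp add: space_restrict_space)

lemma measurable_haar_orbit:
  assumes m: "haar_measure (m :: (real ^ ('n::finite option) ^ ('n option)) measure)"
  shows "(\<lambda>g. g *v base) \<in> m \<rightarrow>\<^sub>M hborel"
proof (rule measurable_hborelI)
  have "(\<lambda>g. g *v base) \<in> borel_measurable (restrict_space borel (SO1 :: (real ^ ('n option) ^ ('n option)) set))"
    by (intro measurable_restrict_space1 borel_measurable_continuous_onI continuous_on_orbit)
  then show "(\<lambda>g. g *v base) \<in> borel_measurable m"
    by (simp add: measurable_cong_sets[OF haar_sets[OF m] refl])
qed (auto simp: haar_space[OF m] SO1_hyp)

lemma measurable_haar_left_mult:
  assumes m: "haar_measure (m :: (real ^ ('n::finite option) ^ ('n option)) measure)" and g: "g \<in> SO1"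
  shows "(\<lambda>h. g ** h) \<in> m \<rightarrow>\<^sub>M m"
proof -
  have "(\<lambda>h. g ** h) \<in> restrict_space borel SO1 \<rightarrow>\<^sub>M restrict_space borel SO1"
    using g by (intro measurable_restrict_space2 measurable_restrict_space1
        borel_measurable_continuous_onI continuous_on_left_mult)
      (auto simp: space_restrict_space SO1_mult)
  then show ?thesis by (simp add: measurable_cong_sets[OF haar_sets[OF m] haar_sets[OF m]])
qed

text \<open>The orbit map carries Haar measure to an invariant measure on the hyperboloid, so to a multiple
  of the hyperbolic volume. Local finiteness holds because the isometries that move the base point
  by a bounded distance form a compact set.\<close>

theorem haar_distr_orbit:
  assumes m: "haar_measure (m :: (real ^ ('n::finite option) ^ ('n option)) measure)"
  obtains c where "c > 0" "distr m hborel (\<lambda>g. g *v base) = scale_measure (ennreal c) hvol"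
proof -
  note [measurable] = measurable_haar_orbit[OF m]
  define A where "A = distr m hborel (\<lambda>g. g *v base)"
  have "loc_fin hyp A"
  proof (rule loc_fin_hypI)
    fix B :: "(real ^ ('n option)) set" assume B: "B \<in> sets hborel" "hbounded B"
    then have "bounded B" by (simp add: hbounded_iff_bounded sets_hborel_iff)
    then obtain K where K: "\<And>x. x \<in> B \<Longrightarrow> norm x \<le> K" by (auto simp: bounded_iff)
    let ?C = "{g \<in> (SO1 :: (real ^ ('n option) ^ ('n option)) set). (g *v base) $ None \<le> K}"
    have "?C \<in> sets (restrict_space borel SO1)"
      using compact_imp_closed[OF compact_SO1_bounded_orbit[of K]] closed_SO1
      by (subst sets_restrict_space_iff) (auto intro: borel_closed)
    then have C: "?C \<in> sets m" by (simp add: haar_sets[OF m])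
    have "emeasure A B = emeasure m ((\<lambda>g. g *v base) -` B \<inter> space m)"
      using B by (simp add: A_def emeasure_distr)
    also have "\<dots> \<le> emeasure m ?C"
    proof (rule emeasure_mono[OF _ C], safe)
      fix g assume g: "g *v base \<in> B" "g \<in> space m"
      then show "g \<in> SO1" by (simp add: haar_space[OF m])
      have "(g *v base) $ None \<le> norm (g *v base)" using component_le_norm_cart[of "g *v base" None] by simp
      also have "\<dots> \<le> K" using g by (intro K)
      finally show "(g *v base) $ None \<le> K" .
    qed
    also have "\<dots> < \<infinity>" using m compact_SO1_bounded_orbit[of K] unfolding haar_measure_def by blast
    finally show "emeasure A B < \<infinity>" .
  qed (simp add: A_def)
  moreover have "(\<integral>\<^sup>+y. ennreal (hker r x y) \<partial>A) = (\<integral>\<^sup>+h. ennreal (hker r base (h *v base)) \<partial>m)"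
    if x: "x \<in> hyp" for r x
  proof -
    obtain g where g: "g \<in> SO1" "g *v base = x" using SO1_transitive[OF x] by blast
    have hm [measurable]: "(\<lambda>y. hker r x y) \<in> borel_measurable hborel" for x :: "real ^ ('n option)"
      by (intro borel_measurable_hborelI) measurable
    note [measurable] = measurable_haar_left_mult[OF m g(1)]
    have "distr m m (\<lambda>h. g ** h) = m" using m g by (simp add: haar_measure_def)
    have "(\<integral>\<^sup>+y. ennreal (hker r x y) \<partial>A) = (\<integral>\<^sup>+h. ennreal (hker r x (h *v base)) \<partial>m)"
      unfolding A_def by (subst nn_integral_distr) measurable
    also have "\<dots> = (\<integral>\<^sup>+h. ennreal (hker r x (h *v base)) \<partial>distr m m (\<lambda>h. g ** h))"
      by (simp add: \<open>distr m m (\<lambda>h. g ** h) = m\<close>)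
    also have "\<dots> = (\<integral>\<^sup>+h. ennreal (hker r x ((g ** h) *v base)) \<partial>m)"
      by (subst nn_integral_distr) measurable
    also have "\<dots> = (\<integral>\<^sup>+h. ennreal (hker r base (h *v base)) \<partial>m)"
    proof -
      have "lor x ((g ** h) *v base) = lor base (h *v base)" for h :: "real ^ ('n option) ^ ('n option)"
        using SO1_lor[OF g(1), of base "h *v base"] by (simp add: g(2) matrix_vector_mul_assoc)
      then show ?thesis by (simp add: hker_def)
    qed
    finally show ?thesis .
  qed
  ultimately obtain c where c: "c \<ge> 0" "A = scale_measure (ennreal c) hvol"
    by (rule invariant_measure_unique)
  have "c \<noteq> 0"
  proof
    assume "c = 0"
    have "emeasure A hyp = emeasure m ((\<lambda>g. g *v base) -` hyp \<inter> space m)"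
      unfolding A_def using sets.top[of hborel] by (subst emeasure_distr) auto
    also have "(\<lambda>g. g *v base) -` hyp \<inter> space m = SO1" by (auto simp: haar_space[OF m] SO1_hyp)
    finally show False using m by (simp add: c(2) \<open>c = 0\<close> haar_measure_def)
  qed
  then show ?thesis using that[of c] c by (simp add: A_def)
qed

section \<open>The Abel integral of the cosine\<close>

text \<open>The derivative may blow up at an endpoint as long as the primitive stays continuous there.\<close>

lemma has_bochner_integral_FTC_interior:
  fixes f F :: "real \<Rightarrow> real"
  assumes "a \<le> b" and [measurable]: "f \<in> borel_measurable borel"
    and F: "continuous_on {a..b} F" "\<And>x. a < x \<Longrightarrow> x < b \<Longrightarrow> (F has_real_derivative f x) (at x)"
    and nn: "\<And>x. a \<le> x \<Longrightarrow> x \<le> b \<Longrightarrow> 0 \<le> f x"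
  shows "has_bochner_integral lborel (\<lambda>x. indicator {a..b} x * f x) (F b - F a)"
proof -
  have "(f has_integral (F b - F a)) {a..b}"
    using F by (intro fundamental_theorem_of_calculus_interior[OF assms(1)])
      (auto simp: has_real_derivative_iff_has_vector_derivative)
  then have hi: "((\<lambda>x. indicator {a..b} x * f x) has_integral (F b - F a)) UNIV"
    by (subst (asm) has_integral_restrict_UNIV[symmetric])
      (auto elim!: has_integral_eq[rotated] simp: indicator_def)
  have pos: "0 \<le> indicator {a..b} x * f x" for x using nn by (auto simp: indicator_def)
  have "integral\<^sup>N lborel (\<lambda>x. indicator {a..b} x * f x) = ennreal (F b - F a)"
    using hi pos by (intro nn_integral_has_integral_lborel) auto
  moreover have "0 \<le> F b - F a" using has_integral_nonneg[OF hi] pos by auto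
  ultimately show ?thesis using pos by (intro has_bochner_integral_nn_integral) auto
qed

lemma cosh_real_mono: "0 \<le> s \<Longrightarrow> s \<le> u \<Longrightarrow> cosh s \<le> cosh (u::real)"
  by (subst cosh_real_nonneg_le_iff) auto

lemma continuous_on_abel_kernel:
  fixes \<rho> R :: real
  assumes "\<rho> > 0"
  shows "continuous_on {0..R} (\<lambda>s. (cosh R - cosh s) powr \<rho>)"
proof (rule continuous_on_powr')
  show "\<forall>x\<in>{0..R}. 0 \<le> cosh R - cosh x \<and> (cosh R - cosh x = 0 \<longrightarrow> 0 < \<rho>)"
    using assms by (auto intro: cosh_real_mono)
qed (intro continuous_intros)+

text \<open>The kernel is singular at the diagonal for small \<open>\<rho>\<close>, but its primitive is continuous.\<close>

lemma has_bochner_integral_abel_kernel_upper: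
  fixes \<rho> s R :: real
  assumes "\<rho> > 0" "0 \<le> s" "s \<le> R"
  shows "has_bochner_integral lborel
    (\<lambda>u. indicator {s..R} u * (sinh u * (cosh u - cosh s) powr (\<rho> - 1))) ((cosh R - cosh s) powr \<rho> / \<rho>)"
proof -
  have mono: "cosh s \<le> cosh u" if "s \<le> u" for u using that assms(2) by (intro cosh_real_mono) auto
  have "has_bochner_integral lborel
      (\<lambda>u. indicator {s..R} u * (sinh u * (cosh u - cosh s) powr (\<rho> - 1)))
      ((cosh R - cosh s) powr \<rho> / \<rho> - (cosh s - cosh s) powr \<rho> / \<rho>)"
  proof (rule has_bochner_integral_FTC_interior[OF assms(3)])
    show "(\<lambda>u. sinh u * (cosh u - cosh s) powr (\<rho> - 1)) \<in> borel_measurable borel" by measurable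
    show "continuous_on {s..R} (\<lambda>u. (cosh u - cosh s) powr \<rho> / \<rho>)"
      using assms mono by (intro continuous_intros continuous_on_powr') auto
    show "((\<lambda>u. (cosh u - cosh s) powr \<rho> / \<rho>) has_real_derivative sinh u * (cosh u - cosh s) powr (\<rho> - 1)) (at u)"
      if "s < u" for u
    proof -
      have "cosh s < cosh u" using that assms(2) by (intro cosh_real_strict_mono) auto
      then have "((\<lambda>u. (cosh u - cosh s) powr \<rho>) has_real_derivative \<rho> * (cosh u - cosh s) powr (\<rho> - 1) * sinh u) (at u)"
        by (intro DERIV_chain2[OF has_real_derivative_powr]) (auto intro!: derivative_eq_intros)
      from DERIV_cdivide[OF this, of \<rho>] show ?thesis using assms(1) by (simp add: mult_ac)
    qed
    show "0 \<le> sinh u * (cosh u - cosh s) powr (\<rho> - 1)" if "s \<le> u" for u using that assms(2) by auto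
  qed
  then show ?thesis using assms(1) by simp
qed

lemma has_bochner_integral_abel_kernel_lower:
  fixes \<rho> R :: real
  assumes "\<rho> > 0" "0 \<le> R"
  shows "has_bochner_integral lborel
    (\<lambda>s. indicator {0..R} s * (\<rho> * (cosh R - cosh s) powr (\<rho> - 1) * sinh s)) ((cosh R - 1) powr \<rho>)"
proof -
  have mono: "cosh s \<le> cosh R" if "0 \<le> s" "s \<le> R" for s using that by (intro cosh_real_mono) auto
  have "has_bochner_integral lborel
      (\<lambda>s. indicator {0..R} s * (\<rho> * (cosh R - cosh s) powr (\<rho> - 1) * sinh s))
      (- ((cosh R - cosh R) powr \<rho>) - (- ((cosh R - cosh 0) powr \<rho>)))"
  proof (rule has_bochner_integral_FTC_interior[OF assms(2)])
    show "(\<lambda>s. \<rho> * (cosh R - cosh s) powr (\<rho> - 1) * sinh s) \<in> borel_measurable borel" by measurable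
    show "continuous_on {0..R} (\<lambda>s. - ((cosh R - cosh s) powr \<rho>))"
      using assms mono by (intro continuous_intros continuous_on_powr') auto
    show "((\<lambda>s. - ((cosh R - cosh s) powr \<rho>)) has_real_derivative \<rho> * (cosh R - cosh s) powr (\<rho> - 1) * sinh s) (at s)"
      if "0 < s" "s < R" for s
    proof -
      have "cosh s < cosh R" using that by (intro cosh_real_strict_mono) auto
      then have "((\<lambda>s. (cosh R - cosh s) powr \<rho>) has_real_derivative \<rho> * (cosh R - cosh s) powr (\<rho> - 1) * (- sinh s)) (at s)"
        by (intro DERIV_chain2[OF has_real_derivative_powr]) (auto intro!: derivative_eq_intros)
      from DERIV_minus[OF this] show ?thesis by simp
    qed
    show "0 \<le> \<rho> * (cosh R - cosh s) powr (\<rho> - 1) * sinh s" if "0 \<le> s" for s using that assms(1) by auto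
  qed
  then show ?thesis by simp
qed

text \<open>Up to elementary factors the spherical functions are \<open>abel_cos ((n - 3) / 2) R z\<close>, and the
  transforms of balls will turn out to be \<open>abel_cos ((n - 1) / 2) R z\<close>.\<close>

definition abel_cos :: "real \<Rightarrow> real \<Rightarrow> complex \<Rightarrow> complex" where
  "abel_cos \<rho> R z = (LINT s:{0..R}|lborel. complex_of_real ((cosh R - cosh s) powr \<rho>) * cos (z * complex_of_real s))"

text \<open>Fubini on the triangle \<open>s \<le> u \<le> R\<close>: the weight \<open>sinh u\<close> is the derivative of
  \<open>cosh u\<close>, so the radial integration raises the exponent of the Abel kernel by one.\<close>

lemma integral_sinh_abel_cos:
  assumes \<rho>: "\<rho> > 0" and R: "R \<ge> 0"
  shows "(LINT u:{0..R}|lborel. complex_of_real (sinh u) * abel_cos (\<rho> - 1) u z) = abel_cos \<rho> R z / complex_of_real \<rho>"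
proof -
  have [measurable]: "(\<lambda>s. cos (z * complex_of_real s)) \<in> borel_measurable borel"
    by (intro borel_measurable_continuous_onI continuous_intros)
  define k where "k s u = indicator {0..R} s * (indicator {s..R} u * (sinh u * (cosh u - cosh s) powr (\<rho> - 1)))" for s u :: real
  define G where "G s u = complex_of_real (k s u) * cos (z * complex_of_real s)" for s u
  have k0: "0 \<le> k s u" for s u by (auto simp: k_def indicator_def)
  have [measurable]: "(\<lambda>p. k (fst p) (snd p)) \<in> borel_measurable (lborel \<Otimes>\<^sub>M lborel)"
  proof -
    have "k = (\<lambda>s u. (if 0 \<le> s \<and> s \<le> u \<and> u \<le> R then sinh u * (cosh u - cosh s) powr (\<rho> - 1) else 0))"
      by (auto simp: k_def fun_eq_iff indicator_def)
    then show ?thesis by simp measurable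
  qed
  have kb: "has_bochner_integral lborel (k s) (indicator {0..R} s * ((cosh R - cosh s) powr \<rho> / \<rho>))" for s
  proof (cases "s \<in> {0..R}")
    case True
    then show ?thesis using has_bochner_integral_abel_kernel_upper[OF \<rho>, of s R]
      unfolding k_def by simp
  next
    case False
    then have "k s = (\<lambda>u. 0)" by (auto simp: k_def)
    with False show ?thesis by (simp add: has_bochner_integral_iff)
  qed
  have G: "integrable (lborel \<Otimes>\<^sub>M lborel) (\<lambda>(s, u). G s u)"
  proof (rule lborel_pair.Fubini_integrable)
    show Gm: "(\<lambda>(s, u). G s u) \<in> borel_measurable (lborel \<Otimes>\<^sub>M lborel)"
      unfolding G_def case_prod_beta' by measurable
    have ni: "(\<integral>u. norm (case (s, u) of (s, u) \<Rightarrow> G s u) \<partial>lborel) =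
        indicator {0..R} s * ((cosh R - cosh s) powr \<rho> / \<rho>) * norm (cos (z * complex_of_real s))" for s
    proof -
      have "(\<integral>u. norm (case (s, u) of (s, u) \<Rightarrow> G s u) \<partial>lborel) = (\<integral>u. k s u * norm (cos (z * complex_of_real s)) \<partial>lborel)"
        using k0 by (simp add: G_def norm_mult)
      also have "\<dots> = (\<integral>u. k s u \<partial>lborel) * norm (cos (z * complex_of_real s))" by (rule integral_mult_left_zero)
      finally show ?thesis using kb[of s] by (simp add: has_bochner_integral_iff)
    qed
    have "continuous_on {0..R} (\<lambda>s. ((cosh R - cosh s) powr \<rho> / \<rho>) * norm (cos (z * complex_of_real s)))"
      using \<rho> by (intro continuous_intros continuous_on_abel_kernel) auto
    from borel_integrable_atLeastAtMost'[OF this]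
    show "integrable lborel (\<lambda>s. \<integral>u. norm (case (s, u) of (s, u) \<Rightarrow> G s u) \<partial>lborel)"
      unfolding ni set_integrable_def by (simp add: mult.assoc)
    show "AE s in lborel. integrable lborel (\<lambda>u. case (s, u) of (s, u) \<Rightarrow> G s u)"
      using kb by (auto simp: G_def has_bochner_integral_iff)
  qed
  have "(\<integral>u. (\<integral>s. G s u \<partial>lborel) \<partial>lborel) = (\<integral>s. (\<integral>u. G s u \<partial>lborel) \<partial>lborel)"
    by (rule lborel_pair.Fubini_integral[OF G])
  also have "(\<lambda>u. \<integral>s. G s u \<partial>lborel) = (\<lambda>u. indicator {0..R} u *\<^sub>R (complex_of_real (sinh u) * abel_cos (\<rho> - 1) u z))"
  proof
    fix u
    have "G s u = (indicator {0..R} u * complex_of_real (sinh u)) * (indicator {0..u} s *\<^sub>R (complex_of_real ((cosh u - cosh s) powr (\<rho> - 1)) * cos (z * complex_of_real s)))" for s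
      by (auto simp: G_def k_def indicator_def)
    then have "(\<integral>s. G s u \<partial>lborel) = (indicator {0..R} u * complex_of_real (sinh u)) * abel_cos (\<rho> - 1) u z"
      unfolding abel_cos_def set_lebesgue_integral_def by (simp only: integral_mult_right_zero)
    then show "(\<integral>s. G s u \<partial>lborel) = indicator {0..R} u *\<^sub>R (complex_of_real (sinh u) * abel_cos (\<rho> - 1) u z)"
      by (simp add: indicator_def)
  qed
  also have "(\<lambda>s. \<integral>u. G s u \<partial>lborel) = (\<lambda>s. (indicator {0..R} s *\<^sub>R (complex_of_real ((cosh R - cosh s) powr \<rho>) * cos (z * complex_of_real s))) / complex_of_real \<rho>)"
  proof
    fix s
    have "(\<integral>u. G s u \<partial>lborel) = (\<integral>u. complex_of_real (k s u) \<partial>lborel) * cos (z * complex_of_real s)"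
      unfolding G_def by (rule integral_mult_left_zero)
    also have "(\<integral>u. complex_of_real (k s u) \<partial>lborel) = complex_of_real (indicator {0..R} s * ((cosh R - cosh s) powr \<rho> / \<rho>))"
      using kb[of s] by (simp add: has_bochner_integral_iff)
    finally show "(\<integral>u. G s u \<partial>lborel) = (indicator {0..R} s *\<^sub>R (complex_of_real ((cosh R - cosh s) powr \<rho>) * cos (z * complex_of_real s))) / complex_of_real \<rho>"
      by (simp add: indicator_def)
  qed
  finally show ?thesis by (simp add: set_lebesgue_integral_def abel_cos_def)
qed

section \<open>Lower bounds on the complementary spectrum\<close>

text \<open>The factorisation isolates the growth \<open>exp R\<close> of the Abel kernel; \<open>u\<close> is the distance to the
  endpoint \<open>R\<close>.\<close>

lemma cosh_diff_eq: "cosh R - cosh (R - u) = exp R / 2 * (1 - exp (- u)) * (1 - exp (u - 2 * R))" for R u :: real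
proof -
  have "exp (R - u) = exp R * exp (- u)" "exp (- (R - u)) = exp (- R) * exp u"
    "exp (u - 2 * R) = exp (- R) * exp (- R) * exp u"
    by (simp_all add: exp_add[symmetric])
  moreover have "exp R * exp (- R) = 1" "exp u * exp (- u) = 1" by (simp_all add: exp_add[symmetric])
  ultimately show ?thesis unfolding cosh_field_def by (simp only:) algebra
qed

lemma exp_minus_1_le_half: "exp (- 1 :: real) \<le> 1 / 2"
proof -
  have "exp (1::real) \<ge> 2" using exp_ge_add_one_self[of 1] by simp
  then show ?thesis by (simp add: exp_minus field_simps)
qed

lemma cosh_diff_ge:
  fixes R s :: real
  assumes "1 \<le> R" "0 \<le> s" "s \<le> R - 1"
  shows "cosh R - cosh s \<ge> exp R / 8"
proof -
  have "cosh s \<le> cosh (R - 1)" using assms by (intro cosh_real_mono) auto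
  moreover have "exp R / 8 \<le> exp R / 2 * (1 - exp (- 1)) * (1 - exp (1 - 2 * R))"
  proof -
    have "exp (1 - 2 * R) \<le> exp (-1)" using assms by simp
    then have "1/2 \<le> 1 - exp (1 - 2 * R)" "1/2 \<le> 1 - exp (- 1 :: real)"
      using exp_minus_1_le_half by linarith+
    then have "(1/2) * (1/2) \<le> (1 - exp (- 1)) * (1 - exp (1 - 2 * R))" by (intro mult_mono) auto
    then have "exp R / 2 * ((1/2) * (1/2)) \<le> exp R / 2 * ((1 - exp (- 1)) * (1 - exp (1 - 2 * R)))"
      by (intro mult_left_mono) auto
    then show ?thesis by (simp add: mult.assoc)
  qed
  ultimately show ?thesis using cosh_diff_eq[of R 1] by linarith
qed

lemma cosh_complex_of_real: "cosh (complex_of_real x) = complex_of_real (cosh x)"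
  by (simp add: cosh_field_def exp_of_real[symmetric])

lemma abel_cos_imaginary:
  "abel_cos \<rho> R (\<i> * complex_of_real t) = complex_of_real (LINT s:{0..R}|lborel. (cosh R - cosh s) powr \<rho> * cosh (t * s))"
proof -
  have "cos (\<i> * complex_of_real t * complex_of_real s) = complex_of_real (cosh (t * s))" for s
    using cosh_conv_cos[of "complex_of_real (t * s)"] cosh_complex_of_real[of "t * s"] by (simp add: mult.assoc)
  then show ?thesis
    by (simp add: abel_cos_def set_lebesgue_integral_def flip: integral_complex_of_real) (simp add: scaleR_conv_of_real)
qed

text \<open>At distance at least 1 from the endpoint \<open>R\<close> the Abel kernel has its full size
  \<open>exp (\<rho> * R)\<close> up to a constant, and all integrands are nonnegative.\<close>

lemma abel_cosh_ge:
  fixes \<rho> R a b t :: real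
  assumes \<rho>: "\<rho> > 0" and R: "R \<ge> 1" and ab: "0 \<le> a" "a \<le> b" "b \<le> R - 1" and t: "t \<ge> 0"
  shows "(LINT s:{0..R}|lborel. (cosh R - cosh s) powr \<rho> * cosh (t * s)) \<ge> (b - a) * ((exp R / 8) powr \<rho> * cosh (t * a))"
proof -
  have "continuous_on {0..R} (\<lambda>s. (cosh R - cosh s) powr \<rho> * cosh (t * s))"
    using \<rho> by (intro continuous_on_mult continuous_on_abel_kernel continuous_on_cosh continuous_intros)
  from borel_integrable_atLeastAtMost'[OF this]
  have int: "integrable lborel (\<lambda>s. indicator {0..R} s *\<^sub>R ((cosh R - cosh s) powr \<rho> * cosh (t * s)))"
    by (simp add: set_integrable_def)
  have "(b - a) * ((exp R / 8) powr \<rho> * cosh (t * a)) = (LINT s|lborel. indicator {a..b} s *\<^sub>R ((exp R / 8) powr \<rho> * cosh (t * a)))"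
    using ab by simp
  also have "\<dots> \<le> (LINT s|lborel. indicator {0..R} s *\<^sub>R ((cosh R - cosh s) powr \<rho> * cosh (t * s)))"
  proof (rule integral_mono[OF _ int])
    show "integrable lborel (\<lambda>s. indicator {a..b} s *\<^sub>R ((exp R / 8) powr \<rho> * cosh (t * a)))"
      by (intro integrable_scaleR_left integrable_real_indicator) (auto simp: emeasure_lborel_Icc_eq)
    fix s :: real
    show "indicator {a..b} s *\<^sub>R ((exp R / 8) powr \<rho> * cosh (t * a)) \<le> indicator {0..R} s *\<^sub>R ((cosh R - cosh s) powr \<rho> * cosh (t * s))"
    proof (cases "s \<in> {a..b}")
      case True
      then have "(exp R / 8) powr \<rho> \<le> (cosh R - cosh s) powr \<rho>"
        using R ab \<rho> by (intro powr_mono2 cosh_diff_ge) auto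
      moreover have "cosh (t * a) \<le> cosh (t * s)" using True ab t by (intro cosh_real_mono mult_left_mono) auto
      ultimately show ?thesis using True ab by (auto simp: indicator_def intro!: mult_mono)
    next
      case False
      have "0 \<le> (cosh R - cosh s) powr \<rho> * cosh (t * s)" using cosh_real_nonneg[of "t * s"] by simp
      with False show ?thesis by (auto simp: indicator_def)
    qed
  qed
  finally show ?thesis by (simp add: set_lebesgue_integral_def)
qed

text \<open>At \<open>z = 0\<close> the whole interval \<open>0 \<le> s \<le> R - 1\<close> contributes equally, hence the factor \<open>R\<close>.\<close>

lemma norm_abel_cos_zero_ge:
  assumes "\<rho> > 0" "R \<ge> 2"
  shows "norm (abel_cos \<rho> R 0) \<ge> R / 2 * ((exp R / 8) powr \<rho>)"
proof -
  let ?I = "LINT s:{0..R}|lborel. (cosh R - cosh s) powr \<rho> * cosh (0 * s)"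
  have "R / 2 * (exp R / 8) powr \<rho> \<le> (R - 1 - 0) * ((exp R / 8) powr \<rho> * cosh (0 * 0))"
    using assms(2) by (simp add: mult_right_mono)
  also have "\<dots> \<le> ?I" using assms by (intro abel_cosh_ge) auto
  finally have "R / 2 * (exp R / 8) powr \<rho> \<le> ?I" .
  also have "?I \<le> \<bar>?I\<bar>" by (rule abs_ge_self)
  also have "\<dots> = norm (abel_cos \<rho> R 0)"
    using abel_cos_imaginary[of \<rho> R 0] by (simp only: of_real_0 mult_zero_right norm_of_real)
  finally show ?thesis .
qed

text \<open>The interval \<open>R - 2 \<le> s \<le> R - 1\<close> suffices: there \<open>cosh (t * s)\<close> is comparable to
  \<open>exp (t * R)\<close>, uniformly for bounded \<open>t\<close>.\<close>

lemma norm_abel_cos_imaginary_ge: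
  assumes "\<rho> > 0" "R \<ge> 2" "0 \<le> t" "t \<le> \<rho>"
  shows "norm (abel_cos \<rho> R (\<i> * complex_of_real t)) \<ge> exp (- 2 * \<rho>) / 2 * (exp R / 8) powr \<rho> * exp (t * R)"
proof -
  let ?I = "LINT s:{0..R}|lborel. (cosh R - cosh s) powr \<rho> * cosh (t * s)"
  have "exp (- 2 * \<rho>) * exp (t * R) \<le> exp (t * (R - 2))" using assms by (simp add: exp_add[symmetric] algebra_simps)
  also have "\<dots> \<le> 2 * cosh (t * (R - 2))" using exp_ge_zero[of "- (t * (R - 2))"] unfolding cosh_field_def by simp
  finally have "(exp R / 8) powr \<rho> * (exp (- 2 * \<rho>) * exp (t * R)) \<le> (exp R / 8) powr \<rho> * (2 * cosh (t * (R - 2)))"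
    by (rule mult_left_mono) simp
  then have "exp (- 2 * \<rho>) / 2 * (exp R / 8) powr \<rho> * exp (t * R) \<le> ((R - 1) - (R - 2)) * ((exp R / 8) powr \<rho> * cosh (t * (R - 2)))"
    by (simp add: field_simps)
  also have "\<dots> \<le> ?I" using assms by (intro abel_cosh_ge) auto
  also have "?I \<le> \<bar>?I\<bar>" by (rule abs_ge_self)
  finally show ?thesis unfolding abel_cos_imaginary norm_of_real .
qed

section \<open>Asymptotics on the principal spectrum\<close>

definition beta_density :: "real \<Rightarrow> real \<Rightarrow> real" where
  "beta_density \<rho> u = indicator {0..} u * ((1 - exp (- u)) powr (\<rho> - 1) * exp (- u))"

lemma measurable_beta_density [measurable]: "beta_density \<rho> \<in> borel_measurable borel"
  unfolding beta_density_def by measurable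

lemma beta_density_nonneg: "0 \<le> beta_density \<rho> u"
  by (auto simp: beta_density_def indicator_def)

lemma has_bochner_integral_beta_density_upto:
  fixes \<rho> d :: real
  assumes \<rho>: "\<rho> > 0" and d: "0 \<le> d"
  shows "has_bochner_integral lborel (\<lambda>u. beta_density \<rho> u * indicator {..d} u) ((1 - exp (- d)) powr \<rho> / \<rho>)"
proof -
  have "has_bochner_integral lborel (\<lambda>u. indicator {0..d} u * ((1 - exp (- u)) powr (\<rho> - 1) * exp (- u)))
    ((1 - exp (- d)) powr \<rho> / \<rho> - (1 - exp (- 0)) powr \<rho> / \<rho>)"
  proof (rule has_bochner_integral_FTC_interior[OF d])
    show "(\<lambda>u. (1 - exp (- u)) powr (\<rho> - 1) * exp (- u)) \<in> borel_measurable borel" by measurable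
    have "continuous_on {0..d} (\<lambda>u. (1 - exp (- u)) powr \<rho>)"
      by (rule continuous_on_powr') (use \<rho> in \<open>auto intro!: continuous_intros\<close>)
    then show "continuous_on {0..d} (\<lambda>u. (1 - exp (- u)) powr \<rho> / \<rho>)"
      using \<rho> by (intro continuous_on_divide) auto
    show "((\<lambda>u. (1 - exp (- u)) powr \<rho> / \<rho>) has_real_derivative (1 - exp (- u)) powr (\<rho> - 1) * exp (- u)) (at u)"
      if "0 < u" for u
    proof -
      have "((\<lambda>u. (1 - exp (- u)) powr \<rho>) has_real_derivative \<rho> * (1 - exp (- u)) powr (\<rho> - 1) * exp (- u)) (at u)"
        using that by (intro DERIV_chain2[OF has_real_derivative_powr]) (auto intro!: derivative_eq_intros)
      from DERIV_cdivide[OF this, of \<rho>] show ?thesis using \<rho> by (simp add: mult_ac)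
    qed
  qed auto
  also have "(\<lambda>u. indicator {0..d} u * ((1 - exp (- u)) powr (\<rho> - 1) * exp (- u))) = (\<lambda>u. beta_density \<rho> u * indicator {..d} u)"
    by (auto simp: beta_density_def indicator_def fun_eq_iff)
  finally show ?thesis using \<rho> by simp
qed

lemma has_bochner_integral_beta_density:
  assumes \<rho>: "\<rho> > 0"
  shows "has_bochner_integral lborel (beta_density \<rho>) (1 / \<rho>)"
proof (rule has_bochner_integral_monotone_convergence_at_top)
  show "integrable lborel (\<lambda>u. beta_density \<rho> u * indicator {..y} u)" for y
  proof (cases "y \<ge> 0")
    case True
    then show ?thesis using has_bochner_integral_beta_density_upto[OF \<rho>] by (auto simp: has_bochner_integral_iff)
  next
    case False
    then have "(\<lambda>u. beta_density \<rho> u * indicator {..y} u) = (\<lambda>u. 0)" by (auto simp: beta_density_def indicator_def fun_eq_iff)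
    then show ?thesis by simp
  qed
  have "((\<lambda>y::real. (1 - exp (- y)) powr \<rho> / \<rho>) \<longlongrightarrow> (1 - 0) powr \<rho> / \<rho>) at_top"
    using \<rho> by (intro tendsto_intros filterlim_compose[OF exp_at_bot] filterlim_uminus_at_bot_at_top) auto
  then have "((\<lambda>y::real. (1 - exp (- y)) powr \<rho> / \<rho>) \<longlongrightarrow> 1 / \<rho>) at_top" by simp
  then show "((\<lambda>y. \<integral>u. beta_density \<rho> u * indicator {..y} u \<partial>lborel) \<longlongrightarrow> 1 / \<rho>) at_top"
  proof (rule Lim_transform_eventually)
    show "eventually (\<lambda>y. (1 - exp (- y)) powr \<rho> / \<rho> = (\<integral>u. beta_density \<rho> u * indicator {..y} u \<partial>lborel)) at_top"
      using eventually_ge_at_top[of "0::real"]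
      by eventually_elim (use has_bochner_integral_beta_density_upto[OF \<rho>] in \<open>auto simp: has_bochner_integral_iff\<close>)
  qed
qed (auto simp: beta_density_nonneg)

text \<open>The substitution \<open>x = exp (- u)\<close> turns this into Euler's integral
  \<open>Beta \<rho> (k + 1 + \<i> * l)\<close>.\<close>

definition beta_fourier :: "real \<Rightarrow> real \<Rightarrow> nat \<Rightarrow> complex" where
  "beta_fourier \<rho> l k = (LINT u|lborel. complex_of_real (beta_density \<rho> u * exp (- real k * u)) * exp (- (\<i> * complex_of_real (l * u))))"

lemma integrable_beta_fourier:
  assumes "\<rho> > 0"
  shows "integrable lborel (\<lambda>u. complex_of_real (beta_density \<rho> u * exp (- real k * u)) * exp (- (\<i> * complex_of_real (l * u))))"
proof (rule Bochner_Integration.integrable_bound)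
  show "integrable lborel (beta_density \<rho>)"
    using has_bochner_integral_beta_density[OF assms] by (simp add: has_bochner_integral_iff)
  have [measurable]: "(\<lambda>u. exp (- (\<i> * complex_of_real (l * u)))) \<in> borel_measurable borel"
    by (intro borel_measurable_continuous_onI continuous_intros)
  show "(\<lambda>u. complex_of_real (beta_density \<rho> u * exp (- real k * u)) * exp (- (\<i> * complex_of_real (l * u)))) \<in> borel_measurable lborel"
    by measurable
  have "norm (complex_of_real (beta_density \<rho> u * exp (- real k * u)) * exp (- (\<i> * complex_of_real (l * u)))) \<le> norm (beta_density \<rho> u)" for u
  proof (cases "u \<ge> 0")
    case True
    then have "exp (- real k * u) \<le> 1" by simp
    then show ?thesis using beta_density_nonneg[of \<rho> u]
      by (simp add: norm_mult mult_left_le)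
  qed (simp add: beta_density_def)
  then show "AE u in lborel. norm (complex_of_real (beta_density \<rho> u * exp (- real k * u)) * exp (- (\<i> * complex_of_real (l * u)))) \<le> norm (beta_density \<rho> u)"
    by simp
qed

text \<open>Integrate the derivative of \<open>(1 - exp (- u)) powr \<rho> * exp (- (k + 1 + \<i> * l) * u)\<close>,
  which vanishes at both ends.\<close>

lemma beta_fourier_recurrence:
  assumes \<rho>: "\<rho> > 0"
  shows "(complex_of_real (\<rho> + real (Suc k)) + \<i> * complex_of_real l) * beta_fourier \<rho> l (Suc k)
    = (complex_of_real (real (Suc k)) + \<i> * complex_of_real l) * beta_fourier \<rho> l k"
proof -
  define c where "c = complex_of_real (real (Suc k)) + \<i> * complex_of_real l"
  define q where "q j u = complex_of_real (beta_density \<rho> u * exp (- real j * u)) * exp (- (\<i> * complex_of_real (l * u)))" for j u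
  define f where "f u = (complex_of_real \<rho> + c) * q (Suc k) u - c * q k u" for u
  define H where "H u = complex_of_real ((1 - exp (- u)) powr \<rho>) * exp (- (c * complex_of_real u))" for u
  have qi: "integrable lborel (q j)" for j unfolding q_def by (rule integrable_beta_fourier[OF \<rho>])
  have fi: "integrable lborel f" unfolding f_def by (intro Bochner_Integration.integrable_diff integrable_mult_right qi)
  have f0: "f u = 0" if "u < 0" for u using that by (simp add: f_def q_def beta_density_def)
  have Hd: "(H has_vector_derivative f u) (at u)" if u: "u > 0" for u
  proof -
    have "((\<lambda>u. (1 - exp (- u)) powr \<rho>) has_real_derivative \<rho> * (1 - exp (- u)) powr (\<rho> - 1) * exp (- u)) (at u)"
      using u by (intro DERIV_chain2[OF has_real_derivative_powr]) (auto intro!: derivative_eq_intros)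
    then have 1: "((\<lambda>u. complex_of_real ((1 - exp (- u)) powr \<rho>)) has_vector_derivative
        complex_of_real (\<rho> * (1 - exp (- u)) powr (\<rho> - 1) * exp (- u))) (at u)"
      by (intro has_vector_derivative_of_real) (simp add: has_real_derivative_iff_has_vector_derivative)
    have 2: "((\<lambda>u. exp (- (c * complex_of_real u))) has_vector_derivative - c * exp (- (c * complex_of_real u))) (at u)"
    proof -
      have "((\<lambda>w. exp (- (c * w))) has_field_derivative - c * exp (- (c * complex_of_real u))) (at (complex_of_real u))"
        by (auto intro!: derivative_eq_intros)
      from has_vector_derivative_real_field[OF this] show ?thesis by simp
    qed
    define p where "p = (1 - exp (- u)) powr (\<rho> - 1)"
    define e where "e = exp (- (c * complex_of_real u))"
    have pw: "(1 - exp (- u)) powr \<rho> = p * (1 - exp (- u))"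
      using u by (simp add: p_def powr_diff)
    have ek: "exp (- u) * exp (- real k * u) = exp (- real (Suc k) * u)"
      by (simp add: exp_add[symmetric] algebra_simps)
    have qk: "q k u = complex_of_real p * e"
    proof -
      have "complex_of_real (exp (- real (Suc k) * u)) * exp (- (\<i> * complex_of_real (l * u))) = e"
        by (simp add: e_def c_def exp_of_real[symmetric] exp_add[symmetric] algebra_simps)
      moreover have "beta_density \<rho> u * exp (- real k * u) = p * exp (- real (Suc k) * u)"
        unfolding ek[symmetric] using u by (simp add: beta_density_def p_def)
      ultimately show ?thesis unfolding q_def by (simp only: of_real_mult mult.assoc)
    qed
    have qk1: "q (Suc k) u = complex_of_real (p * exp (- u)) * e"
    proof -
      have "q (Suc k) u = q k u * complex_of_real (exp (- u))"
      proof -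
        have "beta_density \<rho> u * exp (- real (Suc k) * u) = beta_density \<rho> u * exp (- real k * u) * exp (- u)"
          unfolding ek[symmetric] by (simp only: mult_ac)
        then show ?thesis unfolding q_def by (simp only: of_real_mult mult_ac)
      qed
      then show ?thesis by (simp add: qk)
    qed
    have "(H has_vector_derivative complex_of_real ((1 - exp (- u)) powr \<rho>) * (- c * e) + complex_of_real (\<rho> * p * exp (- u)) * e) (at u)"
      unfolding H_def p_def e_def using has_vector_derivative_mult[OF 1 2] by simp
    moreover have "complex_of_real ((1 - exp (- u)) powr \<rho>) * (- c * e) + complex_of_real (\<rho> * p * exp (- u)) * e = f u"
      unfolding f_def qk qk1 pw by (simp add: algebra_simps)
    ultimately show ?thesis by simp
  qed
  have Hc: "continuous_on {0..y} H" for y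
  proof -
    have c1: "continuous_on {0..y} (\<lambda>u. (1 - exp (- u)) powr \<rho>)"
      by (rule continuous_on_powr') (use \<rho> in \<open>auto intro!: continuous_intros\<close>)
    have c2: "continuous_on {0..y} (\<lambda>u. exp (- (c * complex_of_real u)))"
      by (intro continuous_intros)
    show ?thesis unfolding H_def by (rule continuous_on_mult[OF continuous_on_of_real[OF c1] c2])
  qed
  have eq: "(LINT u|lborel. indicator {..y} u *\<^sub>R f u) = H y" if y: "y \<ge> 0" for y
  proof -
    have hi: "(f has_integral H y - H 0) {0..y}"
      using Hd Hc y by (intro fundamental_theorem_of_calculus_interior) auto
    have si: "set_integrable lborel {0..y} f"
      unfolding set_integrable_def using fi by (intro integrable_mult_indicator) auto
    have "(LINT u|lborel. indicator {..y} u *\<^sub>R f u) = (LINT u:{0..y}|lborel. f u)"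
      unfolding set_lebesgue_integral_def
      by (intro Bochner_Integration.integral_cong) (auto simp: indicator_def f0)
    also have "\<dots> = H y - H 0"
      using set_borel_integral_eq_integral(2)[OF si] hi by (simp add: integral_unique)
    finally show ?thesis by (simp add: H_def)
  qed
  have "((\<lambda>y. LINT u|lborel. indicator {..y} u *\<^sub>R f u) \<longlongrightarrow> (LINT u|lborel. f u)) at_top"
    by (rule tendsto_integral_at_top[OF _ fi]) simp
  moreover have "((\<lambda>y. LINT u|lborel. indicator {..y} u *\<^sub>R f u) \<longlongrightarrow> 0) at_top"
  proof (rule Lim_null_comparison)
    show "eventually (\<lambda>y. norm (LINT u|lborel. indicator {..y} u *\<^sub>R f u) \<le> exp (- y)) at_top"
      using eventually_ge_at_top[of "0::real"]
    proof eventually_elim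
      case (elim y)
      have "norm (H y) = (1 - exp (- y)) powr \<rho> * exp (- (real (Suc k) * y))"
        by (simp add: H_def norm_mult c_def)
      also have "\<dots> \<le> 1 * exp (- y)"
      proof (rule mult_mono)
        have "(1 - exp (- y)) powr \<rho> \<le> 1 powr \<rho>" using elim \<rho> by (intro powr_mono2) auto
        then show "(1 - exp (- y)) powr \<rho> \<le> 1" by simp
        show "exp (- (real (Suc k) * y)) \<le> exp (- y)" using elim by (simp add: algebra_simps)
      qed auto
      finally show ?case by (simp add: eq[OF elim])
    qed
    show "((\<lambda>y::real. exp (- y)) \<longlongrightarrow> 0) at_top"
      by (rule filterlim_compose[OF exp_at_bot filterlim_uminus_at_bot_at_top])
  qed
  ultimately have "(LINT u|lborel. f u) = 0" using tendsto_unique trivial_limit_at_top_linorder by blast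
  moreover have "(LINT u|lborel. f u) = (complex_of_real \<rho> + c) * beta_fourier \<rho> l (Suc k) - c * beta_fourier \<rho> l k"
  proof -
    have "(LINT u|lborel. f u) = (LINT u|lborel. (complex_of_real \<rho> + c) * q (Suc k) u) - (LINT u|lborel. c * q k u)"
      unfolding f_def by (intro Bochner_Integration.integral_diff integrable_mult_right qi)
    moreover have "beta_fourier \<rho> l j = (LINT u|lborel. q j u)" for j by (simp add: beta_fourier_def q_def)
    ultimately show ?thesis by simp
  qed
  ultimately show ?thesis by (simp add: c_def algebra_simps)
qed

text \<open>A zero would propagate along the recurrence to all larger \<open>k\<close>, where the mass concentrates
  at \<open>u = 0\<close> and the cosine is positive.\<close>

lemma beta_fourier_nonzero:
  assumes \<rho>: "\<rho> > 0" and l: "l > 0"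
  shows "beta_fourier \<rho> l 0 \<noteq> 0"
proof
  assume z0: "beta_fourier \<rho> l 0 = 0"
  have z: "beta_fourier \<rho> l k = 0" for k
  proof (induction k)
    case (Suc k)
    have "Re (complex_of_real (\<rho> + real (Suc k)) + \<i> * complex_of_real l) > 0" using \<rho> by simp
    then have "complex_of_real (\<rho> + real (Suc k)) + \<i> * complex_of_real l \<noteq> 0" by (metis less_irrefl zero_complex.simps(1))
    then show ?case using beta_fourier_recurrence[OF \<rho>, of k l] Suc by simp
  qed (rule z0)
  \<comment> \<open>Up to \<open>d\<close> the cosine is at least \<open>1/2\<close>; the mass up to \<open>d / 2\<close> beats the tail beyond \<open>d\<close> for large \<open>k\<close>.\<close>
  define d where "d = pi / 3 / l"
  have d: "d > 0" using l by (simp add: d_def)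
  define W where "W = (1 - exp (- (d / 2))) powr \<rho> / \<rho>"
  have W: "W > 0" using \<rho> d by (simp add: W_def)
  define b where "b = beta_density \<rho>"
  have bi: "integrable lborel b" and bI: "(LINT u|lborel. b u) = 1 / \<rho>"
    using has_bochner_integral_beta_density[OF \<rho>] by (auto simp: has_bochner_integral_iff b_def)
  have bdi: "integrable lborel (\<lambda>u. b u * indicator {..d/2} u)" and bdI: "(LINT u|lborel. b u * indicator {..d/2} u) = W"
    using has_bochner_integral_beta_density_upto[OF \<rho>, of "d/2"] d by (auto simp: has_bochner_integral_iff b_def W_def)
  have main: "1/2 * exp (- real k * (d/2)) * W \<le> exp (- real k * d) * (1 / \<rho>)" for k :: nat
  proof -
    have "0 = Re (beta_fourier \<rho> l k)" by (simp add: z)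
    also have "\<dots> = (LINT u|lborel. Re (complex_of_real (beta_density \<rho> u * exp (- real k * u)) * exp (- (\<i> * complex_of_real (l * u)))))"
      unfolding beta_fourier_def by (rule integral_Re[symmetric, OF integrable_beta_fourier[OF \<rho>]])
    also have "\<dots> = (LINT u|lborel. b u * (exp (- real k * u) * cos (l * u)))"
      by (simp add: b_def Re_exp mult.assoc)
    also have "\<dots> \<ge> (LINT u|lborel. 1/2 * exp (- real k * (d/2)) * (b u * indicator {..d/2} u) - exp (- real k * d) * b u)"
    proof (rule integral_mono)
      show "integrable lborel (\<lambda>u. 1/2 * exp (- real k * (d/2)) * (b u * indicator {..d/2} u) - exp (- real k * d) * b u)"
        by (intro Bochner_Integration.integrable_diff integrable_mult_right bi bdi)
      show "integrable lborel (\<lambda>u. b u * (exp (- real k * u) * cos (l * u)))"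
        using integrable_Re[OF integrable_beta_fourier[OF \<rho>, of k l]] by (simp add: b_def Re_exp mult.assoc)
      fix u :: real
      have b0: "b u \<ge> 0" by (simp add: b_def beta_density_nonneg)
      have key: "1/2 * exp (- real k * (d/2)) * indicator {..d/2} u - exp (- real k * d) \<le> exp (- real k * u) * cos (l * u)" if u: "u \<ge> 0"
      proof (cases "u \<le> d")
        case True
        have "l * u \<le> pi / 3" using True l by (simp add: d_def field_simps)
        moreover have "0 \<le> l * u" using u l by simp
        ultimately have "cos (pi / 3) \<le> cos (l * u)" by (intro cos_monotone_0_pi_le) auto
        then have c: "1/2 \<le> cos (l * u)" by (simp add: cos_60)
        show ?thesis
        proof (cases "u \<le> d / 2")
          case True
          then have "real k * u \<le> real k * (d/2)" by (intro mult_left_mono) auto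
          then have "exp (- real k * (d/2)) \<le> exp (- real k * u)" by simp
          then have le: "exp (- real k * (d/2)) * (1/2) \<le> exp (- real k * u) * cos (l * u)" using c by (intro mult_mono) auto
          have ind: "indicator {..d/2} u = (1::real)" using True by simp
          show ?thesis unfolding ind using le exp_ge_zero[of "- real k * d"] by linarith
        next
          case False
          have "0 \<le> exp (- real k * u) * cos (l * u)" using c by simp
          then show ?thesis using False exp_ge_zero[of "- real k * d"] by (simp del: exp_ge_zero)
        qed
      next
        case False
        then have "exp (- real k * u) \<le> exp (- real k * d)" by (simp add: mult_left_mono)
        moreover have "- exp (- real k * u) \<le> exp (- real k * u) * cos (l * u)"
          using mult_left_mono[OF cos_ge_minus_one[of "l * u"], of "exp (- real k * u)"] by simp
        ultimately have le: "- exp (- real k * d) \<le> exp (- real k * u) * cos (l * u)" by linarith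
        have ind: "indicator {..d/2} u = (0::real)" using False d by simp
        show ?thesis unfolding ind using le by linarith
      qed
      show "1/2 * exp (- real k * (d/2)) * (b u * indicator {..d/2} u) - exp (- real k * d) * b u \<le> b u * (exp (- real k * u) * cos (l * u))"
      proof (cases "u \<ge> 0")
        case True
        show ?thesis using mult_left_mono[OF key[OF True] b0] by (simp add: algebra_simps)
      next
        case False
        then have "b u = 0" by (simp add: b_def beta_density_def)
        then show ?thesis by simp
      qed
    qed
    finally have "(LINT u|lborel. 1/2 * exp (- real k * (d/2)) * (b u * indicator {..d/2} u) - exp (- real k * d) * b u) \<le> 0" .
    also have "(LINT u|lborel. 1/2 * exp (- real k * (d/2)) * (b u * indicator {..d/2} u) - exp (- real k * d) * b u)
        = 1/2 * exp (- real k * (d/2)) * W - exp (- real k * d) * (1 / \<rho>)"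
      by (subst Bochner_Integration.integral_diff) (auto intro!: integrable_mult_right bi bdi simp: bI bdI)
    finally show ?thesis by simp
  qed
  have "W / 2 \<le> exp (- (d/2)) ^ k / \<rho>" for k :: nat
  proof -
    define x where "x = exp (- real k * (d/2))"
    have x: "x > 0" by (simp add: x_def)
    have xx: "exp (- real k * d) = x * x" by (simp add: x_def exp_add[symmetric])
    have "1/2 * x * W \<le> x * x * (1 / \<rho>)" using main[of k] unfolding xx x_def[symmetric] .
    then have "x * (W / 2) \<le> x * (x / \<rho>)" by simp
    then have "W / 2 \<le> x / \<rho>" using x by (simp only: mult_le_cancel_left_pos)
    moreover have "x = exp (- (d/2)) ^ k" by (simp add: x_def exp_of_nat_mult[symmetric])
    ultimately show ?thesis by simp
  qed
  moreover have "(\<lambda>k. exp (- (d/2)) ^ k / \<rho>) \<longlonglongrightarrow> 0 / \<rho>"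
    using d \<rho> by (intro tendsto_intros LIMSEQ_realpow_zero) auto
  ultimately have "W / 2 \<le> 0 / \<rho>" by (intro LIMSEQ_le_const) auto
  then show False using W by simp
qed


text \<open>Seen from the endpoint \<open>R\<close>, the normalised Abel kernel tends to a nonzero constant and its cosine
  integral has no limit. Its derivative decays exponentially, and the boundary terms vanish.\<close>

lemma abel_cos_by_parts:
  fixes \<rho> R l :: real
  assumes \<rho>: "\<rho> > 0" and R: "R \<ge> 0" and l: "l \<noteq> 0"
  shows "(LINT s:{0..R}|lborel. (cosh R - cosh s) powr \<rho> * cos (l * s)) =
    (LINT s|lborel. indicator {0..R} s * (\<rho> * (cosh R - cosh s) powr (\<rho> - 1) * sinh s) * sin (l * s)) / l"
proof -
  have [measurable]: "(\<lambda>s. sin (l * s)) \<in> borel_measurable borel"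
    by (intro borel_measurable_continuous_onI continuous_intros)
  define g where "g s = \<rho> * (cosh R - cosh s) powr (\<rho> - 1) * sinh s" for s
  define f1 where "f1 s = (cosh R - cosh s) powr \<rho> * cos (l * s)" for s
  define f2 where "f2 s = g s * sin (l * s) / l" for s
  have s1: "set_integrable lborel {0..R} f1" unfolding f1_def
    by (intro borel_integrable_atLeastAtMost' continuous_on_mult continuous_on_abel_kernel[OF \<rho>] continuous_intros)
  have gi: "integrable lborel (\<lambda>s. indicator {0..R} s * g s)"
    using has_bochner_integral_abel_kernel_lower[OF \<rho> R] by (simp add: has_bochner_integral_iff g_def)
  have "integrable lborel (\<lambda>s. indicator {0..R} s * g s * sin (l * s))"
  proof (rule Bochner_Integration.integrable_bound[OF gi])
    show "(\<lambda>s. indicator {0..R} s * g s * sin (l * s)) \<in> borel_measurable lborel" unfolding g_def by measurable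
    show "AE s in lborel. norm (indicator {0..R} s * g s * sin (l * s)) \<le> norm (indicator {0..R} s * g s)"
      by (simp add: abs_mult mult_left_le)
  qed
  then have s2: "set_integrable lborel {0..R} f2" unfolding set_integrable_def f2_def
    by (simp add: mult.assoc[symmetric])
  have "((\<lambda>s. f1 s - f2 s) has_integral (cosh R - cosh R) powr \<rho> * (sin (l * R) / l) - (cosh R - cosh 0) powr \<rho> * (sin (l * 0) / l)) {0..R}"
  proof (rule fundamental_theorem_of_calculus_interior[OF R])
    show "continuous_on {0..R} (\<lambda>s. (cosh R - cosh s) powr \<rho> * (sin (l * s) / l))"
      using l by (intro continuous_on_mult continuous_on_abel_kernel[OF \<rho>] continuous_intros) auto
    fix s assume s: "s \<in> {0<..<R}"
    then have "cosh s < cosh R" by (intro cosh_real_strict_mono) auto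
    then have "((\<lambda>s. (cosh R - cosh s) powr \<rho>) has_real_derivative \<rho> * (cosh R - cosh s) powr (\<rho> - 1) * (- sinh s)) (at s)"
      by (intro DERIV_chain2[OF has_real_derivative_powr]) (auto intro!: derivative_eq_intros)
    moreover have "((\<lambda>s. sin (l * s) / l) has_real_derivative cos (l * s)) (at s)"
      using l by (auto intro!: derivative_eq_intros)
    ultimately have "((\<lambda>s. (cosh R - cosh s) powr \<rho> * (sin (l * s) / l)) has_real_derivative
        \<rho> * (cosh R - cosh s) powr (\<rho> - 1) * (- sinh s) * (sin (l * s) / l) + cos (l * s) * (cosh R - cosh s) powr \<rho>) (at s)"
      by (rule DERIV_mult)
    then show "((\<lambda>s. (cosh R - cosh s) powr \<rho> * (sin (l * s) / l)) has_vector_derivative f1 s - f2 s) (at s)"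
      by (simp add: has_real_derivative_iff_has_vector_derivative f1_def f2_def g_def algebra_simps)
  qed
  then have "integral {0..R} (\<lambda>s. f1 s - f2 s) = 0" by (simp add: integral_unique)
  then have "integral {0..R} f1 = integral {0..R} f2"
    using set_borel_integral_eq_integral(1)[OF s1] set_borel_integral_eq_integral(1)[OF s2]
    by (simp add: Henstock_Kurzweil_Integration.integral_diff)
  then have "(LINT s:{0..R}|lborel. f1 s) = (LINT s:{0..R}|lborel. f2 s)"
    using set_borel_integral_eq_integral(2)[OF s1] set_borel_integral_eq_integral(2)[OF s2] by simp
  also have "\<dots> = (LINT s|lborel. indicator {0..R} s * g s * sin (l * s)) / l"
    unfolding set_lebesgue_integral_def f2_def by (simp add: mult.assoc[symmetric])
  finally show ?thesis by (simp add: f1_def g_def)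
qed

text \<open>The coefficient of the sine in the previous lemma after the substitution \<open>s = R - u\<close> and division
  by \<open>\<rho> * exp (\<rho> * R)\<close>, with the kernel in factorised form.\<close>

definition abel_tail :: "real \<Rightarrow> real \<Rightarrow> real \<Rightarrow> real" where
  "abel_tail \<rho> R u = indicator {0..R} u *
     ((1/2 * (1 - exp (- u)) * (1 - exp (u - 2 * R))) powr (\<rho> - 1) * (1/2 * (exp (- u) - exp (u - 2 * R))))"

lemma measurable_abel_tail [measurable]: "abel_tail \<rho> R \<in> borel_measurable borel"
  unfolding abel_tail_def by measurable

lemma abel_cos_eq_abel_tail:
  fixes \<rho> R l :: real
  assumes \<rho>: "\<rho> > 0" and R: "R \<ge> 0" and l: "l \<noteq> 0"
  shows "exp (- \<rho> * R) * (LINT s:{0..R}|lborel. (cosh R - cosh s) powr \<rho> * cos (l * s)) =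
    \<rho> / l * (LINT u|lborel. abel_tail \<rho> R u * sin (l * (R - u)))"
proof -
  define F where "F s = indicator {0..R} s * (\<rho> * (cosh R - cosh s) powr (\<rho> - 1) * sinh s) * sin (l * s)" for s
  have "(LINT s|lborel. F s) = (LINT u|lborel. F (R - u))"
    using lborel_integral_real_affine[of "-1" F R] by simp
  moreover have "exp (- \<rho> * R) * F (R - u) = \<rho> * (abel_tail \<rho> R u * sin (l * (R - u)))" for u
  proof (cases "u \<in> {0..R}")
    case True
    then have u: "0 \<le> u" "u \<le> R" by auto
    have e: "exp (- \<rho> * R) = exp (- R) powr (\<rho> - 1) * exp (- R)"
      by (simp add: powr_def exp_add[symmetric] algebra_simps)
    have "exp (- R) * (cosh R - cosh (R - u)) = 1/2 * (1 - exp (- u)) * (1 - exp (u - 2 * R))"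
      by (simp add: cosh_diff_eq exp_minus)
    moreover have "cosh R - cosh (R - u) \<ge> 0" using u by (simp add: cosh_real_mono)
    ultimately have p: "exp (- R) powr (\<rho> - 1) * (cosh R - cosh (R - u)) powr (\<rho> - 1)
        = (1/2 * (1 - exp (- u)) * (1 - exp (u - 2 * R))) powr (\<rho> - 1)"
      by (metis exp_ge_zero powr_mult)
    have "exp (- R) * sinh (R - u) = 1/2 * (exp (- R) * exp (R - u) - exp (- R) * exp (- (R - u)))"
      unfolding sinh_field_def by (simp add: field_simps)
    also have "\<dots> = 1/2 * (exp (- u) - exp (u - 2 * R))" by (simp add: exp_add[symmetric])
    finally have q: "exp (- R) * sinh (R - u) = 1/2 * (exp (- u) - exp (u - 2 * R))" .
    have "exp (- \<rho> * R) * F (R - u) = \<rho> * ((exp (- R) powr (\<rho> - 1) * (cosh R - cosh (R - u)) powr (\<rho> - 1)) * (exp (- R) * sinh (R - u))) * sin (l * (R - u))"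
      unfolding F_def e using u by simp
    also have "\<dots> = \<rho> * (abel_tail \<rho> R u * sin (l * (R - u)))"
      unfolding p q abel_tail_def using u by simp
    finally show ?thesis .
  next
    case False
    then have "R - u \<notin> {0..R}" by auto
    with False show ?thesis by (simp add: F_def abel_tail_def)
  qed
  ultimately have "exp (- \<rho> * R) * (LINT s|lborel. F s) = \<rho> * (LINT u|lborel. abel_tail \<rho> R u * sin (l * (R - u)))"
    by (simp flip: integral_mult_right_zero)
  then show ?thesis unfolding abel_cos_by_parts[OF \<rho> R l] F_def by (simp add: field_simps)
qed

text \<open>Under the power only the factor \<open>1 - exp (u - 2 * R)\<close> depends on \<open>R\<close>. For \<open>u \<le> R\<close> it lies between
  \<open>1/2\<close> and 1, so its power with an exponent above \<open>-1\<close> is at most 2.\<close>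

lemma abel_tail_bound:
  assumes \<rho>: "\<rho> > 0" and R: "R \<ge> 1"
  shows "norm (abel_tail \<rho> R u) \<le> 2 * (1/2) powr \<rho> * beta_density \<rho> u"
proof (cases "u \<in> {0..R}")
  case True
  then have u: "0 \<le> u" "u \<le> R" by auto
  define x where "x = 1 - exp (u - 2 * R)"
  have "exp (u - 2 * R) \<le> exp (- 1)" using u R by simp
  then have x: "1/2 \<le> x" unfolding x_def using exp_minus_1_le_half by linarith
  have x1: "x \<le> 1" by (simp add: x_def)
  have "x powr (\<rho> - 1) \<le> x powr (- 1)" using x x1 \<rho> by (intro powr_mono') auto
  also have "\<dots> = 1 / x" using x by (simp add: powr_minus_divide)
  also have "\<dots> \<le> 2" using x by (simp add: field_simps)
  finally have xp: "x powr (\<rho> - 1) \<le> 2" .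
  have m: "0 \<le> exp (- u) - exp (u - 2 * R)" using u by simp
  have "abel_tail \<rho> R u = (1/2) powr (\<rho> - 1) * (1 - exp (- u)) powr (\<rho> - 1) * x powr (\<rho> - 1) * (1/2 * (exp (- u) - exp (u - 2 * R)))"
  proof -
    have "(1/2 * (1 - exp (- u)) * x) powr (\<rho> - 1) = (1/2) powr (\<rho> - 1) * (1 - exp (- u)) powr (\<rho> - 1) * x powr (\<rho> - 1)"
    proof -
      have a: "(1/2 * (1 - exp (- u)) * x) powr (\<rho> - 1) = (1/2 * (1 - exp (- u))) powr (\<rho> - 1) * x powr (\<rho> - 1)"
        by (rule powr_mult)
      have b: "(1/2 * (1 - exp (- u))) powr (\<rho> - 1) = (1/2) powr (\<rho> - 1) * (1 - exp (- u)) powr (\<rho> - 1)"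
        by (rule powr_mult)
      show ?thesis unfolding a b ..
    qed
    then show ?thesis unfolding abel_tail_def x_def using u by simp
  qed
  also have "\<dots> \<le> (1/2) powr (\<rho> - 1) * (1 - exp (- u)) powr (\<rho> - 1) * 2 * (1/2 * exp (- u))"
    using xp m by (intro mult_mono) auto
  also have "\<dots> = 2 * (1/2) powr \<rho> * beta_density \<rho> u"
  proof -
    have h: "(1/2) powr (\<rho> - 1) = 2 * (1/2) powr \<rho>" by (simp add: powr_diff)
    show ?thesis unfolding h using u by (simp add: beta_density_def)
  qed
  finally have "abel_tail \<rho> R u \<le> 2 * (1/2) powr \<rho> * beta_density \<rho> u" .
  moreover have "0 \<le> abel_tail \<rho> R u" using m u by (simp add: abel_tail_def)
  ultimately show ?thesis by simp
next
  case False
  then have "abel_tail \<rho> R u = 0" by (auto simp: abel_tail_def indicator_def)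
  then show ?thesis using beta_density_nonneg[of \<rho> u] by simp
qed

lemma abel_tail_tendsto:
  assumes "u > 0"
  shows "((\<lambda>R. abel_tail \<rho> R u) \<longlongrightarrow> (1/2) powr \<rho> * beta_density \<rho> u) at_top"
proof -
  have e: "((\<lambda>R. exp (u - 2 * R)) \<longlongrightarrow> 0) at_top"
  proof (rule filterlim_compose[OF exp_at_bot])
    show "filterlim (\<lambda>R. u - 2 * R) at_bot at_top"
      by real_asymp
  qed
  have "((\<lambda>R. (1/2 * (1 - exp (- u)) * (1 - exp (u - 2 * R))) powr (\<rho> - 1) * (1/2 * (exp (- u) - exp (u - 2 * R))))
      \<longlongrightarrow> (1/2 * (1 - exp (- u)) * (1 - 0)) powr (\<rho> - 1) * (1/2 * (exp (- u) - 0))) at_top"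
    using assms by (intro tendsto_intros e) auto
  also have "(1/2 * (1 - exp (- u)) * (1 - 0)) powr (\<rho> - 1) * (1/2 * (exp (- u) - 0)) = (1/2) powr \<rho> * beta_density \<rho> u"
  proof -
    have "(1/2 * (1 - exp (- u))) powr (\<rho> - 1) = (1/2) powr (\<rho> - 1) * (1 - exp (- u)) powr (\<rho> - 1)"
      using assms by (subst powr_mult) auto
    moreover have "(1/2) powr (\<rho> - 1) = 2 * (1/2) powr \<rho>" by (simp add: powr_diff)
    ultimately show ?thesis using assms by (simp add: beta_density_def)
  qed
  finally show ?thesis
  proof (rule Lim_transform_eventually)
    show "eventually (\<lambda>R. (1/2 * (1 - exp (- u)) * (1 - exp (u - 2 * R))) powr (\<rho> - 1) * (1/2 * (exp (- u) - exp (u - 2 * R))) = abel_tail \<rho> R u) at_top"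
      using eventually_ge_at_top[of u] by eventually_elim (use assms in \<open>simp add: abel_tail_def\<close>)
  qed
qed

text \<open>By dominated convergence the coefficient of \<open>exp (\<i> * l * R)\<close> converges, and its limit is a nonzero
  multiple of \<open>beta_fourier \<rho> l 0\<close>.\<close>

lemma abel_cos_real_asymptotics:
  assumes \<rho>: "\<rho> > 0" and l: "l > 0"
  obtains A :: complex where "A \<noteq> 0"
    "((\<lambda>R. exp (- \<rho> * R) * (LINT s:{0..R}|lborel. (cosh R - cosh s) powr \<rho> * cos (l * s))
        - Im (exp (\<i> * complex_of_real (l * R)) * A)) \<longlongrightarrow> 0) at_top"
proof -
  define e where "e u = exp (- (\<i> * complex_of_real (l * u)))" for u
  have [measurable]: "e \<in> borel_measurable borel" unfolding e_def
    by (intro borel_measurable_continuous_onI continuous_intros)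
  have ne: "norm (e u) = 1" for u by (simp add: e_def)
  define B where "B R = (LINT u|lborel. complex_of_real (abel_tail \<rho> R u) * e u)" for R
  define B' where "B' = (LINT u|lborel. complex_of_real ((1/2) powr \<rho> * beta_density \<rho> u) * e u)"
  have bi: "integrable lborel (\<lambda>u. 2 * (1/2) powr \<rho> * beta_density \<rho> u)"
    using has_bochner_integral_beta_density[OF \<rho>] by (simp add: has_bochner_integral_iff)
  have bnd: "norm (complex_of_real (abel_tail \<rho> R u) * e u) \<le> 2 * (1/2) powr \<rho> * beta_density \<rho> u" if "R \<ge> 1" for R u
    using abel_tail_bound[OF \<rho> that, of u] by (simp add: norm_mult ne)
  have Blim: "(B \<longlongrightarrow> B') at_top" unfolding B_def B'_def
  proof (rule integral_dominated_convergence_at_top[OF _ _ bi])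
    show "(\<lambda>u. complex_of_real ((1/2) powr \<rho> * beta_density \<rho> u) * e u) \<in> borel_measurable lborel" by measurable
    show "(\<lambda>u. complex_of_real (abel_tail \<rho> R u) * e u) \<in> borel_measurable lborel" for R by measurable
    show "eventually (\<lambda>R. AE u in lborel. norm (complex_of_real (abel_tail \<rho> R u) * e u) \<le> 2 * (1/2) powr \<rho> * beta_density \<rho> u) at_top"
      using eventually_ge_at_top[of "1::real"] by eventually_elim (use bnd in auto)
    show "AE u in lborel. ((\<lambda>R. complex_of_real (abel_tail \<rho> R u) * e u) \<longlongrightarrow> complex_of_real ((1/2) powr \<rho> * beta_density \<rho> u) * e u) at_top"
      using AE_lborel_singleton[of 0]
    proof eventually_elim
      case (elim u)
      show ?case
      proof (cases "u > 0")
        case True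
        then show ?thesis by (intro tendsto_intros abel_tail_tendsto)
      next
        case False
        with elim have "u < 0" by simp
        then show ?thesis by (simp add: abel_tail_def beta_density_def)
      qed
    qed
  qed
  have B'nz: "B' \<noteq> 0"
  proof -
    have "B' = complex_of_real ((1/2) powr \<rho>) * beta_fourier \<rho> l 0"
      by (simp add: B'_def beta_fourier_def e_def mult.assoc)
    then show ?thesis using beta_fourier_nonzero[OF \<rho> l] by simp
  qed
  define A where "A = complex_of_real (\<rho> / l) * B'"
  have eq: "exp (- \<rho> * R) * (LINT s:{0..R}|lborel. (cosh R - cosh s) powr \<rho> * cos (l * s))
      = Im (exp (\<i> * complex_of_real (l * R)) * (complex_of_real (\<rho> / l) * B R))" if R: "R \<ge> 1" for R
  proof -
    have Bi: "integrable lborel (\<lambda>u. exp (\<i> * complex_of_real (l * R)) * (complex_of_real (abel_tail \<rho> R u) * e u))"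
    proof (rule integrable_mult_right, rule Bochner_Integration.integrable_bound[OF bi])
      show "(\<lambda>u. complex_of_real (abel_tail \<rho> R u) * e u) \<in> borel_measurable lborel" by measurable
      show "AE u in lborel. norm (complex_of_real (abel_tail \<rho> R u) * e u) \<le> norm (2 * (1/2) powr \<rho> * beta_density \<rho> u)"
        using bnd[OF R] beta_density_nonneg[of \<rho>] by simp
    qed
    have "Im (exp (\<i> * complex_of_real (l * R)) * B R)
        = (LINT u|lborel. Im (exp (\<i> * complex_of_real (l * R)) * (complex_of_real (abel_tail \<rho> R u) * e u)))"
      unfolding B_def integral_mult_right_zero[symmetric] by (rule integral_Im[symmetric, OF Bi])
    also have "\<dots> = (LINT u|lborel. abel_tail \<rho> R u * sin (l * (R - u)))"
    proof (intro Bochner_Integration.integral_cong refl)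
      fix u
      have "exp (\<i> * complex_of_real (l * R)) * (complex_of_real (abel_tail \<rho> R u) * e u)
          = complex_of_real (abel_tail \<rho> R u) * exp (\<i> * complex_of_real (l * (R - u)))"
        by (simp add: e_def exp_add[symmetric] algebra_simps)
      then show "Im (exp (\<i> * complex_of_real (l * R)) * (complex_of_real (abel_tail \<rho> R u) * e u)) = abel_tail \<rho> R u * sin (l * (R - u))"
        by (simp only:) (simp add: Im_exp)
    qed
    finally have "Im (exp (\<i> * complex_of_real (l * R)) * B R) = (LINT u|lborel. abel_tail \<rho> R u * sin (l * (R - u)))" .
    moreover have "Im (exp (\<i> * complex_of_real (l * R)) * (complex_of_real (\<rho> / l) * B R)) = \<rho> / l * Im (exp (\<i> * complex_of_real (l * R)) * B R)"
    proof -
      have "exp (\<i> * complex_of_real (l * R)) * (complex_of_real (\<rho> / l) * B R)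
          = complex_of_real (\<rho> / l) * (exp (\<i> * complex_of_real (l * R)) * B R)" by (simp only: mult_ac)
      moreover have "Im (complex_of_real x * z) = x * Im z" for x z by simp
      ultimately show ?thesis by (simp only:)
    qed
    ultimately show ?thesis using abel_cos_eq_abel_tail[OF \<rho>, of R l] R l by simp
  qed
  have "((\<lambda>R. exp (- \<rho> * R) * (LINT s:{0..R}|lborel. (cosh R - cosh s) powr \<rho> * cos (l * s))
        - Im (exp (\<i> * complex_of_real (l * R)) * A)) \<longlongrightarrow> 0) at_top"
  proof (rule Lim_null_comparison)
    show "eventually (\<lambda>R. norm (exp (- \<rho> * R) * (LINT s:{0..R}|lborel. (cosh R - cosh s) powr \<rho> * cos (l * s))
        - Im (exp (\<i> * complex_of_real (l * R)) * A)) \<le> \<rho> / l * norm (B R - B')) at_top"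
      using eventually_ge_at_top[of "1::real"]
    proof eventually_elim
      case (elim R)
      have "exp (- \<rho> * R) * (LINT s:{0..R}|lborel. (cosh R - cosh s) powr \<rho> * cos (l * s)) - Im (exp (\<i> * complex_of_real (l * R)) * A)
          = Im (exp (\<i> * complex_of_real (l * R)) * (complex_of_real (\<rho> / l) * (B R - B')))"
        unfolding eq[OF elim] A_def by (simp only: right_diff_distrib minus_complex.simps)
      also have "norm \<dots> \<le> norm (exp (\<i> * complex_of_real (l * R)) * (complex_of_real (\<rho> / l) * (B R - B')))"
        unfolding real_norm_def by (rule abs_Im_le_cmod)
      also have "\<dots> = \<rho> / l * norm (B R - B')" using \<rho> l by (simp add: norm_mult norm_divide)
      finally show ?case .
    qed
    have "((\<lambda>R. \<rho> / l * norm (B R - B')) \<longlongrightarrow> \<rho> / l * norm (B' - B')) at_top"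
      by (intro tendsto_intros Blim)
    then show "((\<lambda>R. \<rho> / l * norm (B R - B')) \<longlongrightarrow> 0) at_top" by simp
  qed
  moreover have "A \<noteq> 0" using B'nz \<rho> l by (simp add: A_def)
  ultimately show ?thesis using that by blast
qed

lemma abel_cos_real:
  "abel_cos \<rho> R (complex_of_real l) = complex_of_real (LINT s:{0..R}|lborel. (cosh R - cosh s) powr \<rho> * cos (l * s))"
proof -
  have "cos (complex_of_real l * complex_of_real s) = complex_of_real (cos (l * s))" for s
    by (simp add: cos_of_real[symmetric])
  then show ?thesis
    by (simp add: abel_cos_def set_lebesgue_integral_def flip: integral_complex_of_real) (simp add: scaleR_conv_of_real)
qed

text \<open>An oscillation cannot be small at two radii whose distance is not a multiple of half the period.\<close>

lemma Im_sq_rotation_ge: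
  "(norm v)\<^sup>2 * (sin \<theta>)\<^sup>2 \<le> 3 * ((Im v)\<^sup>2 + (Im (exp (\<i> * complex_of_real \<theta>) * v))\<^sup>2)"
proof -
  define a b x where "a = Im v" and "b = Im (exp (\<i> * complex_of_real \<theta>) * v)" and "x = Re v"
  have b: "b = x * sin \<theta> + a * cos \<theta>" by (simp add: b_def a_def x_def Re_exp Im_exp algebra_simps)
  have sc: "(sin \<theta>)\<^sup>2 \<le> 1" "(cos \<theta>)\<^sup>2 \<le> 1" by (simp_all add: abs_square_le_1)
  have "(norm v)\<^sup>2 * (sin \<theta>)\<^sup>2 = (b - a * cos \<theta>)\<^sup>2 + a\<^sup>2 * (sin \<theta>)\<^sup>2"
    by (simp add: b cmod_power2 a_def[symmetric] x_def[symmetric] power_mult_distrib algebra_simps)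
  also have "(b - a * cos \<theta>)\<^sup>2 \<le> 2 * b\<^sup>2 + 2 * (a\<^sup>2 * (cos \<theta>)\<^sup>2)"
    using zero_le_power2[of "b + a * cos \<theta>"] by (simp add: power2_sum power2_diff power_mult_distrib)
  also have "a\<^sup>2 * (cos \<theta>)\<^sup>2 \<le> a\<^sup>2 * 1" by (intro mult_left_mono sc) auto
  finally have "(norm v)\<^sup>2 * (sin \<theta>)\<^sup>2 \<le> 2 * b\<^sup>2 + 2 * a\<^sup>2 + a\<^sup>2 * (sin \<theta>)\<^sup>2" by simp
  moreover have "a\<^sup>2 * (sin \<theta>)\<^sup>2 \<le> a\<^sup>2 * 1" by (intro mult_left_mono sc) auto
  moreover have "N \<le> 3 * (P + B)" if "N \<le> 2 * B + 2 * P + Q" "Q \<le> P * 1" "0 \<le> B" for N B P Q :: real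
    unfolding distrib_left using that by linarith
  ultimately show ?thesis unfolding a_def[symmetric] b_def[symmetric] using zero_le_power2[of b] by blast
qed

text \<open>The condition on \<open>h\<close> keeps \<open>sin (l * h)\<close> away from zero.\<close>

lemma abel_cos_real_two_radii:
  assumes \<rho>: "\<rho> > 0" and l: "l > 0" and h: "h > 0" "l * h < pi"
  obtains \<epsilon> where "\<epsilon> > 0"
    "eventually (\<lambda>R. \<epsilon> \<le> (exp (- \<rho> * R) * norm (abel_cos \<rho> R (complex_of_real l)))\<^sup>2
        + (exp (- \<rho> * (R + h)) * norm (abel_cos \<rho> (R + h) (complex_of_real l)))\<^sup>2) at_top"
proof -
  define X where "X R = exp (- \<rho> * R) * (LINT s:{0..R}|lborel. (cosh R - cosh s) powr \<rho> * cos (l * s))" for R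
  obtain A :: complex where A: "A \<noteq> 0" "((\<lambda>R. X R - Im (exp (\<i> * complex_of_real (l * R)) * A)) \<longlongrightarrow> 0) at_top"
    using abel_cos_real_asymptotics[OF \<rho> l] unfolding X_def by blast
  define Y where "Y R = Im (exp (\<i> * complex_of_real (l * R)) * A)" for R
  have XY: "((\<lambda>R. X R - Y R) \<longlongrightarrow> 0) at_top" using A(2) by (simp add: Y_def)
  have "((\<lambda>R. X (R + h) - Y (R + h)) \<longlongrightarrow> 0) at_top"
    by (rule filterlim_compose[OF XY]) real_asymp
  then have "((\<lambda>R. (X R - Y R)\<^sup>2 + (X (R + h) - Y (R + h))\<^sup>2) \<longlongrightarrow> 0\<^sup>2 + 0\<^sup>2) at_top"
    by (intro tendsto_intros XY)
  then have lim: "((\<lambda>R. (X R - Y R)\<^sup>2 + (X (R + h) - Y (R + h))\<^sup>2) \<longlongrightarrow> 0) at_top" by simp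
  define \<epsilon> where "\<epsilon> = (norm A)\<^sup>2 * (sin (l * h))\<^sup>2 / 12"
  have "sin (l * h) > 0" using l h by (intro sin_gt_zero) auto
  then have \<epsilon>: "\<epsilon> > 0" using A(1) by (simp add: \<epsilon>_def)
  have Yge: "4 * \<epsilon> \<le> (Y R)\<^sup>2 + (Y (R + h))\<^sup>2" for R
  proof -
    define v where "v = exp (\<i> * complex_of_real (l * R)) * A"
    have "exp (\<i> * complex_of_real (l * (R + h))) = exp (\<i> * complex_of_real (l * h)) * exp (\<i> * complex_of_real (l * R))"
      by (simp add: exp_add[symmetric] algebra_simps)
    then have "Y (R + h) = Im (exp (\<i> * complex_of_real (l * h)) * v)" by (simp only: Y_def v_def mult.assoc)
    moreover have "Y R = Im v" by (simp only: Y_def v_def)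
    moreover have "norm v = norm A" by (simp add: v_def norm_mult)
    ultimately have "(norm A)\<^sup>2 * (sin (l * h))\<^sup>2 \<le> 3 * ((Y R)\<^sup>2 + (Y (R + h))\<^sup>2)"
      using Im_sq_rotation_ge[of v "l * h"] by (simp only:)
    then show ?thesis by (simp add: \<epsilon>_def)
  qed
  have "eventually (\<lambda>R. (X R - Y R)\<^sup>2 + (X (R + h) - Y (R + h))\<^sup>2 < \<epsilon>) at_top"
    using order_tendstoD(2)[OF lim \<epsilon>] .
  then have "eventually (\<lambda>R. \<epsilon> \<le> (X R)\<^sup>2 + (X (R + h))\<^sup>2) at_top"
  proof eventually_elim
    case (elim R)
    have sq: "y\<^sup>2 \<le> 2 * x\<^sup>2 + 2 * (x - y)\<^sup>2" for x y :: real
      using zero_le_power2[of "2 * x - y"] by (simp add: power2_diff algebra_simps)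
    show ?case using Yge[of R] sq[of "Y R" "X R"] sq[of "Y (R + h)" "X (R + h)"] elim by linarith
  qed
  moreover have "(exp (- \<rho> * R) * norm (abel_cos \<rho> R (complex_of_real l)))\<^sup>2 = (X R)\<^sup>2" for R
    unfolding abel_cos_real X_def by (simp add: power_mult_distrib)
  ultimately show ?thesis using that[OF \<epsilon>] by simp
qed

section \<open>The spherical transform of a ball\<close>

definition sph_const :: "real \<Rightarrow> real" where
  "sph_const n = 2 powr ((n - 1) / 2) * Gamma (n / 2) / (sqrt pi * Gamma ((n - 1) / 2))"

lemma sph_const_pos: "n > 1 \<Longrightarrow> sph_const n > 0"
  unfolding sph_const_def by (intro divide_pos_pos mult_pos_pos Gamma_real_pos) auto

definition radial_spherical :: "real \<Rightarrow> complex \<Rightarrow> real \<Rightarrow> complex" where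
  "radial_spherical n z l = (if l = 0 then 1
     else complex_of_real (sph_const n * sinh l powr (2 - n)) * abel_cos ((n - 3) / 2) l z)"

lemma spherical_eq_radial:
  assumes g: "(g :: real ^ ('n::finite option) ^ ('n option)) \<in> SO1"
  shows "spherical z g = radial_spherical (real CARD('n)) z (hdist (g *v base) base)"
proof -
  have h: "g *v base \<in> hyp" by (intro SO1_hyp[OF g]) auto
  have "hdist (g *v base) base = 0 \<longleftrightarrow> (g *v base) $ None = 1"
    using hyp_nth_ge_1[OF h] cosh_arcosh_real[of "(g *v base) $ None"] by (auto simp: hdist_base)
  then have "g \<in> stab \<longleftrightarrow> hdist (g *v base) base = 0"
    using g hyp_eq_base_iff[OF h] by (auto simp: stab_def)
  then show ?thesis
    by (simp add: spherical_def radial_spherical_def sph_const_def abel_cos_def Let_def)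
qed

lemma measurable_abel_cos [measurable]: "(\<lambda>l. abel_cos a l z) \<in> borel_measurable borel"
proof -
  have [measurable]: "(\<lambda>s. cos (z * complex_of_real s)) \<in> borel_measurable borel"
    by (intro borel_measurable_continuous_onI continuous_intros)
  have eq: "abel_cos a l z = (LINT s|lborel. (if 0 \<le> s \<and> s \<le> l then complex_of_real ((cosh l - cosh s) powr a) * cos (z * complex_of_real s) else 0))" for l
    unfolding abel_cos_def set_lebesgue_integral_def
    by (intro Bochner_Integration.integral_cong) (auto simp: indicator_def)
  show ?thesis unfolding eq by measurable
qed

lemma measurable_radial_spherical [measurable]: "radial_spherical n z \<in> borel_measurable borel"
  unfolding radial_spherical_def by measurable

lemma borel_measurable_cnj [measurable (raw)]:
  "f \<in> borel_measurable M \<Longrightarrow> (\<lambda>x. cnj (f x)) \<in> borel_measurable M"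
  by (rule borel_measurable_continuous_on) (intro continuous_intros)

lemma scale_measure_eq_density: "scale_measure c M = density M (\<lambda>_. c)"
  by (rule measure_eqI) (auto simp: emeasure_density nn_integral_cmult_indicator)

lemma cnj_set_lebesgue_integral:
  "cnj (LINT u:A|M. f u) = (LINT u:A|M. cnj (f u))"
  unfolding set_lebesgue_integral_def by (subst Bochner_Integration.integral_cnj[symmetric]) simp

text \<open>In polar coordinates the factor \<open>sinh powr (2 - n)\<close> of the spherical function cancels all but one
  power of \<open>sinh\<close> in the volume density, and the remaining double integral is an Abel integral.\<close>

theorem spherical_transform_ball:
  assumes m: "haar_measure (m :: (real ^ ('n::finite option) ^ ('n option)) measure)" and n: "CARD('n) \<ge> 2"
  obtains K where "K > 0"
    "\<And>R z. R \<ge> 0 \<Longrightarrow> spherical_transform m (\<lambda>g. complex_of_real (indicator (hball R) (g *v base))) z =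
       complex_of_real K * cnj (abel_cos ((real CARD('n) - 1) / 2) R z)"
proof -
  define N where "N = real CARD('n)"
  have N: "N \<ge> 2" using n by (simp add: N_def)
  define \<rho> where "\<rho> = (N - 1) / 2"
  have \<rho>: "\<rho> > 0" using N by (simp add: \<rho>_def)
  obtain c where c: "c > 0" "distr m hborel (\<lambda>g. g *v base) = scale_measure (ennreal c) hvol"
    using haar_distr_orbit[OF m] by blast
  define S where "S = sphere_area CARD('n)"
  have S: "S > 0" unfolding S_def by (rule sphere_area_pos) simp
  define K where "K = c * (S * sph_const N) / \<rho>"
  have K: "K > 0" unfolding K_def using c S sph_const_pos[of N] N \<rho> by simp
  have main: "spherical_transform m (\<lambda>g. complex_of_real (indicator (hball R) (g *v base))) z = complex_of_real K * cnj (abel_cos \<rho> R z)"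
    if R: "R \<ge> 0" for R z
  proof -
    define h where "h u = (if u < R then cnj (radial_spherical N z u) else 0)" for u
    have hm [measurable]: "h \<in> borel_measurable borel" unfolding h_def by measurable
    have hd [measurable]: "(\<lambda>x :: real ^ ('n option). h (hdist x base)) \<in> borel_measurable hborel" by measurable
    have "spherical_transform m (\<lambda>g. complex_of_real (indicator (hball R) (g *v base))) z = (LINT g|m. h (hdist (g *v base) base))"
      unfolding spherical_transform_def
    proof (intro Bochner_Integration.integral_cong refl)
      fix g assume "g \<in> space m"
      then have g: "g \<in> SO1" by (simp add: haar_space[OF m])
      have "g *v base \<in> hball R \<longleftrightarrow> hdist (g *v base) base < R"
        using SO1_hyp[OF g base_in_hyp] by (simp add: hball_def)
      then show "complex_of_real (indicator (hball R) (g *v base)) * cnj (spherical z g) = h (hdist (g *v base) base)"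
        by (simp add: h_def spherical_eq_radial[OF g] N_def indicator_def)
    qed
    also have "\<dots> = (LINT x|distr m hborel (\<lambda>g. g *v base). h (hdist x base))"
      by (rule integral_distr[symmetric, OF measurable_haar_orbit[OF m] hd])
    also have "\<dots> = (LINT x|(hvol :: (real ^ ('n option)) measure). c *\<^sub>R h (hdist x base))"
      unfolding c(2) scale_measure_eq_density using c(1)
      by (subst integral_density) (auto cong: measurable_cong_sets)
    also have "\<dots> = c *\<^sub>R (LINT x|(hvol :: (real ^ ('n option)) measure). h (hdist x base))" by simp
    also have "(LINT x|(hvol :: (real ^ ('n option)) measure). h (hdist x base))
        = (LINT u|lborel. (S * sinh u ^ (CARD('n) - 1) * indicator {0..} u) *\<^sub>R h u)"
      unfolding S_def by (rule integral_hvol_radial[OF hm])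
    also have "\<dots> = (LINT u:{0..R}|lborel. complex_of_real (S * sph_const N) * cnj (complex_of_real (sinh u) * abel_cos (\<rho> - 1) u z))"
      unfolding set_lebesgue_integral_def
    proof (rule integral_cong_AE)
      show "(\<lambda>u. (S * sinh u ^ (CARD('n) - 1) * indicator {0..} u) *\<^sub>R h u) \<in> borel_measurable lborel" by measurable
      show "(\<lambda>u. indicator {0..R} u *\<^sub>R (complex_of_real (S * sph_const N) * cnj (complex_of_real (sinh u) * abel_cos (\<rho> - 1) u z))) \<in> borel_measurable lborel"
        unfolding complex_cnj_mult by measurable
      show "AE u in lborel. (S * sinh u ^ (CARD('n) - 1) * indicator {0..} u) *\<^sub>R h u =
          indicator {0..R} u *\<^sub>R (complex_of_real (S * sph_const N) * cnj (complex_of_real (sinh u) * abel_cos (\<rho> - 1) u z))"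
        using AE_lborel_singleton[of 0] AE_lborel_singleton[of R]
      proof eventually_elim
        case (elim u)
        show ?case
        proof (cases "0 < u \<and> u < R")
          case True
          then have s: "sinh u > 0" by simp
          have "sinh u ^ (CARD('n) - 1) = sinh u powr (N - 1)"
            using s n by (simp add: powr_realpow[symmetric] N_def of_nat_diff)
          then have "sinh u ^ (CARD('n) - 1) * sinh u powr (2 - N) = sinh u powr 1"
            by (simp add: powr_add[symmetric])
          then have e: "sinh u ^ (CARD('n) - 1) * sinh u powr (2 - N) = sinh u" using s by simp
          have r: "(N - 3) / 2 = \<rho> - 1" by (simp add: \<rho>_def field_simps)
          have "(S * sinh u ^ (CARD('n) - 1)) *\<^sub>R h u =
              complex_of_real (S * sph_const N * (sinh u ^ (CARD('n) - 1) * sinh u powr (2 - N))) * cnj (abel_cos (\<rho> - 1) u z)"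
            using True by (simp add: h_def radial_spherical_def r scaleR_conv_of_real)
          then show ?thesis using True unfolding e by simp
        next
          case False
          with elim have "u < 0 \<or> R < u" by auto
          then show ?thesis by (auto simp: h_def indicator_def)
        qed
      qed
    qed
    also have "\<dots> = complex_of_real (S * sph_const N) * cnj (LINT u:{0..R}|lborel. complex_of_real (sinh u) * abel_cos (\<rho> - 1) u z)"
      unfolding cnj_set_lebesgue_integral 
      by (simp only: set_lebesgue_integral_def integral_mult_right_zero[symmetric] mult_scaleR_right)
    also have "(LINT u:{0..R}|lborel. complex_of_real (sinh u) * abel_cos (\<rho> - 1) u z) = abel_cos \<rho> R z / complex_of_real \<rho>"
      by (rule integral_sinh_abel_cos[OF \<rho> R])
    finally show ?thesis by (simp add: K_def scaleR_conv_of_real)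
  qed
  show ?thesis using that[OF K] main unfolding \<rho>_def N_def by blast
qed

section \<open>Variances as spectral integrals\<close>

lemma linstat_complex_of_real: "linstat (\<lambda>x. complex_of_real (f x)) p = complex_of_real (linstat f p)"
  by (simp add: linstat_def)

lemma covar_complex_of_real:
  "covar \<mu> (\<lambda>p. complex_of_real (X p)) (\<lambda>p. complex_of_real (X p)) = complex_of_real (LINT p|\<mu>. (X p - (LINT q|\<mu>. X q))\<^sup>2)"
proof -
  have "(complex_of_real (X p) - (LINT q|\<mu>. complex_of_real (X q))) * cnj (complex_of_real (X p) - (LINT q|\<mu>. complex_of_real (X q)))
      = complex_of_real ((X p - (LINT q|\<mu>. X q))\<^sup>2)" for p
    by (simp add: power2_eq_square)
  then show ?thesis unfolding covar_def by (simp only: integral_complex_of_real)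
qed

text \<open>For a real statistic the covariance with itself is the variance, and the covariance identity
  applies to the complexified test function.\<close>

lemma variance_eq_spectral:
  fixes f :: "real ^ ('n::finite option) \<Rightarrow> real"
  assumes d: "diffraction_measure m \<mu> \<eta>" and f: "test_fun f"
    and rad: "\<And>k x. k \<in> stab \<Longrightarrow> x \<in> hyp \<Longrightarrow> f (k *v x) = f x"
  defines "F \<equiv> spherical_transform m (\<lambda>g. complex_of_real (f (g *v base)))"
  shows "ennreal (LINT p|\<mu>. (linstat f p - (LINT q|\<mu>. linstat f q))\<^sup>2) = (\<integral>\<^sup>+z. ennreal ((norm (F z))\<^sup>2) \<partial>\<eta>)"
    and "(\<lambda>z. (norm (F z))\<^sup>2) \<in> borel_measurable \<eta>"
proof -
  define g where "g x = complex_of_real (f x)" for x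
  have fm: "f \<in> borel_measurable hborel" and fb: "bounded (f ` hyp)" and fs: "hbounded {x \<in> hyp. f x \<noteq> 0}"
    using f by (auto simp: test_fun_def)
  have "test_fun g" unfolding test_fun_def
  proof (intro conjI)
    show "g \<in> borel_measurable hborel" unfolding g_def using fm by measurable
    show "bounded (g ` hyp)" using fb unfolding bounded_iff g_def by auto
    show "hbounded {x \<in> hyp. g x \<noteq> 0}" using fs by (simp add: g_def)
  qed
  moreover have "\<forall>k\<in>stab. \<forall>x\<in>hyp. g (k *v x) = g x" by (simp add: g_def rad)
  ultimately have I: "integrable \<eta> (\<lambda>z. F z * cnj (F z))"
    and C: "covar \<mu> (linstat g) (linstat g) = (LINT z|\<eta>. F z * cnj (F z))"
    using d unfolding diffraction_measure_def Let_def F_def g_def by blast+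
  have eq: "F z * cnj (F z) = complex_of_real ((norm (F z))\<^sup>2)" for z
    by (rule complex_norm_square[symmetric])
  have I': "integrable \<eta> (\<lambda>z. (norm (F z))\<^sup>2)" using I unfolding eq complex_of_real_integrable_eq .
  then show "(\<lambda>z. (norm (F z))\<^sup>2) \<in> borel_measurable \<eta>" by simp
  have "linstat g = (\<lambda>p. complex_of_real (linstat f p))"
    unfolding g_def by (intro ext) (rule linstat_complex_of_real)
  then have "complex_of_real (LINT p|\<mu>. (linstat f p - (LINT q|\<mu>. linstat f q))\<^sup>2) = complex_of_real (LINT z|\<eta>. (norm (F z))\<^sup>2)"
    using C unfolding eq by (simp only: covar_complex_of_real integral_complex_of_real)
  then have "(LINT p|\<mu>. (linstat f p - (LINT q|\<mu>. linstat f q))\<^sup>2) = (LINT z|\<eta>. (norm (F z))\<^sup>2)"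
    by (simp only: of_real_eq_iff)
  then show "ennreal (LINT p|\<mu>. (linstat f p - (LINT q|\<mu>. linstat f q))\<^sup>2) = (\<integral>\<^sup>+z. ennreal ((norm (F z))\<^sup>2) \<partial>\<eta>)"
    using nn_integral_eq_integral[OF I'] by simp
qed

lemma stab_hdist_base:
  assumes "k \<in> stab" shows "hdist (k *v x) base = hdist x base"
proof -
  have k: "k \<in> SO1" "k *v base = base" using assms by (auto simp: stab_def)
  have "lor (k *v x) base = lor (k *v x) (k *v base)" by (simp only: k)
  also have "\<dots> = lor x base" by (rule SO1_lor[OF k(1)])
  finally show ?thesis by (simp add: hdist_def)
qed

lemma test_fun_indicator_hball: "test_fun (indicator (hball R) :: real ^ ('n::finite option) \<Rightarrow> real)"
  unfolding test_fun_def
proof (intro conjI)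
  show "(indicator (hball R) :: real ^ ('n option) \<Rightarrow> real) \<in> borel_measurable hborel" by measurable
  show "bounded ((indicator (hball R) :: real ^ ('n option) \<Rightarrow> real) ` hyp)"
    unfolding bounded_iff by (auto simp: indicator_def intro!: exI[of _ 1])
  show "hbounded {x \<in> hyp. (indicator (hball R) x :: real) \<noteq> 0}"
    by (rule hbounded_subset[of "hball R"]) (auto simp: indicator_def split: if_splits)
qed

lemma number_variance_eq_spectral:
  fixes \<mu> :: "(real ^ ('n::finite option)) measure measure"
  assumes m: "haar_measure m" and d: "diffraction_measure m \<mu> \<eta>" and n: "CARD('n) \<ge> 2"
  obtains K where "K > 0"
    "\<And>R. R \<ge> 0 \<Longrightarrow> ennreal (number_variance \<mu> R) =
       (\<integral>\<^sup>+z. ennreal ((K * norm (abel_cos ((real CARD('n) - 1) / 2) R z))\<^sup>2) \<partial>\<eta>)"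
    "\<And>R. R \<ge> 0 \<Longrightarrow> (\<lambda>z. (norm (abel_cos ((real CARD('n) - 1) / 2) R z))\<^sup>2) \<in> borel_measurable \<eta>"
proof -
  obtain K where K: "K > 0" "\<And>R z. R \<ge> 0 \<Longrightarrow> spherical_transform m (\<lambda>g. complex_of_real (indicator (hball R) (g *v base))) z =
       complex_of_real K * cnj (abel_cos ((real CARD('n) - 1) / 2) R z)"
    using spherical_transform_ball[OF m n] by blast
  have rad: "indicator (hball R) (k *v x) = (indicator (hball R) x :: real)" if "k \<in> stab" "x \<in> hyp" for R k and x :: "real ^ ('n option)"
    using that SO1_hyp[of k x] stab_hdist_base[OF that(1), of x] by (auto simp: indicator_def hball_def stab_def)
  show ?thesis
  proof (rule that[OF K(1)])
    fix R :: real assume R: "R \<ge> 0"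
    have nn: "(norm (complex_of_real K * cnj (abel_cos ((real CARD('n) - 1) / 2) R z)))\<^sup>2 = (K * norm (abel_cos ((real CARD('n) - 1) / 2) R z))\<^sup>2" for z
      using K(1) by (simp add: norm_mult)
    show "ennreal (number_variance \<mu> R) = (\<integral>\<^sup>+z. ennreal ((K * norm (abel_cos ((real CARD('n) - 1) / 2) R z))\<^sup>2) \<partial>\<eta>)"
      using variance_eq_spectral(1)[OF d test_fun_indicator_hball rad, of R]
      unfolding number_variance_def K(2)[OF R] nn .
    have "(\<lambda>z. (K * norm (abel_cos ((real CARD('n) - 1) / 2) R z))\<^sup>2) \<in> borel_measurable \<eta>"
      using variance_eq_spectral(2)[OF d test_fun_indicator_hball rad, of R] unfolding K(2)[OF R] nn .
    then have "(\<lambda>z. (K * norm (abel_cos ((real CARD('n) - 1) / 2) R z))\<^sup>2 / K\<^sup>2) \<in> borel_measurable \<eta>" by measurable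
    then show "(\<lambda>z. (norm (abel_cos ((real CARD('n) - 1) / 2) R z))\<^sup>2) \<in> borel_measurable \<eta>"
      using K(1) by (simp add: power_mult_distrib)
  qed
qed

section \<open>Growth of the number variance\<close>

lemma number_variance_nonneg: "0 \<le> number_variance \<mu> R"
  by (simp add: number_variance_def)

lemma measure_hvol_hball_bounds:
  assumes "R > 0" "CARD('n::finite) \<ge> 2"
  shows "0 < measure hvol (hball R :: (real ^ ('n option)) set)"
    and "measure hvol (hball R :: (real ^ ('n option)) set) \<le> sphere_area CARD('n) * exp ((real CARD('n) - 1) * R)"
proof -
  have fin: "emeasure hvol (hball R :: (real ^ ('n option)) set) < \<infinity>" by (rule emeasure_hvol_hball_finite)
  then have eq: "emeasure hvol (hball R :: (real ^ ('n option)) set) = ennreal (measure hvol (hball R :: (real ^ ('n option)) set))"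
    by (intro emeasure_eq_ennreal_measure) auto
  show "0 < measure hvol (hball R :: (real ^ ('n option)) set)"
    using emeasure_hvol_hball_pos[OF assms(1), where 'n = 'n] unfolding eq by simp
  have "0 \<le> sphere_area CARD('n) * exp ((real CARD('n) - 1) * R)" by (simp add: sphere_area_def)
  then show "measure hvol (hball R :: (real ^ ('n option)) set) \<le> sphere_area CARD('n) * exp ((real CARD('n) - 1) * R)"
    using emeasure_hvol_hball_le[of R, where 'n = 'n] assms unfolding eq by (simp add: ennreal_le_iff)
qed

lemma ennreal_pos_lower: "0 < x \<Longrightarrow> \<exists>e>0. ennreal e \<le> x"
  by (cases x) (auto intro: exI[of _ 1])

text \<open>The constant \<open>e\<close> stands in for the mass of \<open>E\<close>, which may be infinite.\<close>

lemma nn_integral_ge_on_set: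
  assumes "E \<in> sets M" "0 < emeasure M E"
  obtains e where "e > 0" "\<And>c f. c \<ge> 0 \<Longrightarrow> (\<And>z. z \<in> E \<Longrightarrow> c \<le> f z) \<Longrightarrow> ennreal (c * e) \<le> (\<integral>\<^sup>+z. ennreal (f z) \<partial>M)"
proof -
  obtain e where e: "e > 0" "ennreal e \<le> emeasure M E" using ennreal_pos_lower[OF assms(2)] by blast
  have "ennreal (c * e) \<le> (\<integral>\<^sup>+z. ennreal (f z) \<partial>M)" if c: "c \<ge> 0" "\<And>z. z \<in> E \<Longrightarrow> c \<le> f z" for c f
  proof -
    have "ennreal (c * e) = ennreal c * ennreal e" using c e by (simp add: ennreal_mult)
    also have "\<dots> \<le> ennreal c * emeasure M E" by (intro mult_left_mono e) auto
    also have "\<dots> = (\<integral>\<^sup>+z. ennreal c * indicator E z \<partial>M)" by (rule nn_integral_cmult_indicator[symmetric, OF assms(1)])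
    also have "\<dots> \<le> (\<integral>\<^sup>+z. ennreal (f z) \<partial>M)"
      by (intro nn_integral_mono) (auto simp: indicator_def intro!: ennreal_leI c)
    finally show ?thesis .
  qed
  with e(1) that show ?thesis by blast
qed

lemma sets_diffraction: "diffraction_measure m (\<mu> :: (real ^ ('n::finite option)) measure measure) \<eta> \<Longrightarrow>
    sets \<eta> = sets (restrict_space borel (Omega_plus CARD('n)))"
  by (simp add: diffraction_measure_def)

lemma imaginary_segment_eq:
  "(\<lambda>t. \<i> * complex_of_real t) ` B = {z. Re z = 0 \<and> Im z \<in> B}"
proof safe
  fix z assume "Re z = 0" "Im z \<in> B"
  then show "z \<in> (\<lambda>t. \<i> * complex_of_real t) ` B"
    by (intro image_eqI[of _ _ "Im z"]) (auto simp: complex_eq_iff)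
qed auto

lemma borel_imaginary_segment:
  assumes "B \<in> sets borel" shows "(\<lambda>t. \<i> * complex_of_real t) ` B \<in> sets borel"
proof -
  have [measurable]: "Im \<in> borel_measurable borel" "Re \<in> borel_measurable borel"
    by (intro borel_measurable_continuous_onI continuous_intros)+
  have "{z. Re z = 0 \<and> Im z \<in> B} \<in> sets borel" using assms by measurable
  then show ?thesis unfolding imaginary_segment_eq .
qed

lemma borel_Omega_plus: "Omega_plus n \<in> sets borel"
proof -
  have [measurable]: "Im \<in> borel_measurable borel" "Re \<in> borel_measurable borel"
    by (intro borel_measurable_continuous_onI continuous_intros)+
  have "complex_of_real ` {0<..} = {z. Im z = 0 \<and> Re z > 0}"
  proof safe
    fix z assume "Im z = 0" "0 < Re z"
    then show "z \<in> complex_of_real ` {0<..}"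
      by (intro image_eqI[of _ _ "Re z"]) (auto simp: complex_eq_iff)
  qed auto
  moreover have "{z. Im z = 0 \<and> Re z > 0} \<in> sets borel" by measurable
  ultimately show ?thesis unfolding Omega_plus_def by (intro sets.Un borel_imaginary_segment) auto
qed

lemma emeasure_complementary:
  assumes s: "sets \<eta> = sets (restrict_space borel (Omega_plus n))"
    and B: "B \<in> sets borel" "B \<subseteq> {0..<(real n - 1) / 2}"
  shows "(\<lambda>t. \<i> * complex_of_real t) ` B \<in> sets \<eta>"
    and "emeasure (complementary_diffraction n \<eta>) B = emeasure \<eta> ((\<lambda>t. \<i> * complex_of_real t) ` B)"
proof -
  let ?j = "\<lambda>t. \<i> * complex_of_real t" and ?I = "{0..<(real n - 1) / 2}"
  have sp: "space \<eta> = Omega_plus n" using sets_eq_imp_space_eq[OF s] by (simp add: space_restrict_space)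
  have sub: "?j ` C \<in> sets \<eta>" if "C \<in> sets borel" "C \<subseteq> ?I" for C
    unfolding s using that borel_Omega_plus borel_imaginary_segment[OF that(1)]
    by (subst sets_restrict_space_iff) (auto simp: Omega_plus_def)
  show "?j ` B \<in> sets \<eta>" using sub B by auto
  have I: "?j ` ?I \<in> sets \<eta>" by (intro sub) auto
  have "(\<lambda>z. z) \<in> \<eta> \<rightarrow>\<^sub>M borel" by (simp add: measurable_cong_sets[OF s refl] measurable_restrict_space1)
  moreover have "Im \<in> borel_measurable borel" by (intro borel_measurable_continuous_onI continuous_intros)
  ultimately have "Im \<in> borel_measurable \<eta>" using measurable_compose by blast
  then have Im [measurable]: "Im \<in> restrict_space \<eta> (?j ` ?I) \<rightarrow>\<^sub>M restrict_space borel ?I"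
    by (intro measurable_restrict_space2 measurable_restrict_space1) (auto simp: space_restrict_space)
  have "Im -` B \<inter> space (restrict_space \<eta> (?j ` ?I)) = ?j ` B"
  proof -
    have "z \<in> space \<eta>" if "Re z = 0" "Im z \<in> B" for z
      using sets.sets_into_space[OF sub[OF B]] that unfolding imaginary_segment_eq by blast
    then show ?thesis using B(2) by (auto simp: space_restrict_space imaginary_segment_eq)
  qed
  moreover have "B \<in> sets (restrict_space borel ?I)" using B by (subst sets_restrict_space_iff) auto
  ultimately have "emeasure (complementary_diffraction n \<eta>) B = emeasure (restrict_space \<eta> (?j ` ?I)) (?j ` B)"
    unfolding complementary_diffraction_def using Im by (subst emeasure_distr) auto
  also have "\<dots> = emeasure \<eta> (?j ` B)"
    using B(2) I by (intro emeasure_restrict_space) (auto intro: sets.Int_space_eq2)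
  finally show "emeasure (complementary_diffraction n \<eta>) B = emeasure \<eta> (?j ` B)" .
qed

lemma Liminf_pos_of_ratio_ge:
  fixes N V :: "real \<Rightarrow> real"
  assumes "C > 0" "eventually (\<lambda>R. V R > 0 \<and> C * V R \<le> N R) at_top"
  shows "Liminf at_top (\<lambda>R. ereal (N R / V R)) > 0"
proof -
  have "eventually (\<lambda>R. ereal C \<le> ereal (N R / V R)) at_top"
    using assms(2) by eventually_elim (simp add: field_simps)
  then have "ereal C \<le> Liminf at_top (\<lambda>R. ereal (N R / V R))" by (rule Liminf_bounded)
  then show ?thesis using assms(1) by (meson ereal_less(2) less_le_trans)
qed

lemma exp_eighth_powr: "(exp R / 8) powr \<rho> = 8 powr (- \<rho>) * exp (\<rho> * R)" for R \<rho> :: real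
  by (simp add: powr_def ln_div exp_add[symmetric] algebra_simps)

text \<open>The squared factor \<open>exp (\<rho> * R)\<close> accounts for the volume of the ball, so a uniform gain \<open>s R\<close> over
  it on a spectral set of positive mass passes to the variance as \<open>(s R)\<^sup>2\<close>.\<close>

lemma number_variance_lower_bound:
  fixes \<mu> :: "(real ^ ('n::finite option)) measure measure"
  assumes m: "haar_measure m" and d: "diffraction_measure m \<mu> \<eta>" and n: "CARD('n) \<ge> 2"
    and E: "E \<in> sets \<eta>" "emeasure \<eta> E > 0"
    and s: "\<And>R. R \<ge> 2 \<Longrightarrow> s R > 0"
      "\<And>R z. R \<ge> 2 \<Longrightarrow> z \<in> E \<Longrightarrow> s R * exp ((real CARD('n) - 1) / 2 * R) \<le> norm (abel_cos ((real CARD('n) - 1) / 2) R z)"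
  obtains C where "C > 0"
    "\<And>R. R \<ge> 2 \<Longrightarrow> C * ((s R)\<^sup>2 * measure hvol (hball R :: (real ^ ('n option)) set)) \<le> number_variance \<mu> R"
proof -
  define \<rho> where "\<rho> = (real CARD('n) - 1) / 2"
  have r2: "real CARD('n) - 1 = 2 * \<rho>" by (simp add: \<rho>_def)
  obtain K where K: "K > 0" and NV: "\<And>R. R \<ge> 0 \<Longrightarrow> ennreal (number_variance \<mu> R) = (\<integral>\<^sup>+z. ennreal ((K * norm (abel_cos \<rho> R z))\<^sup>2) \<partial>\<eta>)"
    using number_variance_eq_spectral[OF m d n, folded \<rho>_def] by metis
  obtain e where e: "e > 0" "\<And>c f. c \<ge> 0 \<Longrightarrow> (\<And>z. z \<in> E \<Longrightarrow> c \<le> f z) \<Longrightarrow> ennreal (c * e) \<le> (\<integral>\<^sup>+z. ennreal (f z) \<partial>\<eta>)"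
    using nn_integral_ge_on_set[OF E] by blast
  define S where "S = sphere_area CARD('n)"
  have S: "S > 0" unfolding S_def by (rule sphere_area_pos) simp
  define C where "C = K\<^sup>2 * e / S"
  have C: "C > 0" using K e S by (simp add: C_def)
  show ?thesis
  proof (rule that[OF C])
    fix R :: real assume R: "R \<ge> 2"
    define V where "V = measure hvol (hball R :: (real ^ ('n option)) set)"
    have V: "V \<le> S * exp (2 * \<rho> * R)"
      using measure_hvol_hball_bounds(2)[of R, where 'n = 'n] R n unfolding r2 by (auto simp: V_def S_def)
    define c where "c = (K * (s R * exp (\<rho> * R)))\<^sup>2"
    have "ennreal (c * e) \<le> (\<integral>\<^sup>+z. ennreal ((K * norm (abel_cos \<rho> R z))\<^sup>2) \<partial>\<eta>)"
    proof (rule e(2))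
      fix z assume "z \<in> E"
      then show "c \<le> (K * norm (abel_cos \<rho> R z))\<^sup>2"
        using s(2)[OF R, folded \<rho>_def] s(1)[OF R] K unfolding c_def by (intro power_mono mult_left_mono) auto
    qed (simp add: c_def)
    also have "\<dots> = ennreal (number_variance \<mu> R)" by (rule NV[symmetric]) (use R in simp)
    finally have "c * e \<le> number_variance \<mu> R" by (simp add: ennreal_le_iff number_variance_nonneg)
    moreover have "C * ((s R)\<^sup>2 * V) \<le> C * ((s R)\<^sup>2 * (S * exp (2 * \<rho> * R)))"
      using V C by (intro mult_left_mono) auto
    moreover have "C * ((s R)\<^sup>2 * (S * exp (2 * \<rho> * R))) = c * e"
    proof -
      have "exp (2 * \<rho> * R) = (exp (\<rho> * R))\<^sup>2" by (simp add: exp_double[symmetric] mult.assoc)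
      then show ?thesis using S by (simp add: C_def c_def power_mult_distrib)
    qed
    ultimately show "C * ((s R)\<^sup>2 * measure hvol (hball R :: (real ^ ('n option)) set)) \<le> number_variance \<mu> R"
      by (simp add: V_def)
  qed
qed

theorem number_variance_growth_at_zero:
  fixes \<mu> :: "(real ^ ('n::finite option)) measure measure"
  assumes m: "haar_measure m" and d: "diffraction_measure m \<mu> \<eta>" and n: "CARD('n) \<ge> 2"
    and pos: "emeasure (complementary_diffraction CARD('n) \<eta>) {0} > 0"
  shows "Liminf at_top (\<lambda>R::real. ereal
    (number_variance \<mu> R / (R\<^sup>2 * measure hvol (hball R :: (real ^ ('n option)) set)))) > 0"
proof -
  define \<rho> where "\<rho> = (real CARD('n) - 1) / 2"
  have \<rho>: "\<rho> > 0" using n by (simp add: \<rho>_def)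
  have E: "{0} \<in> sets \<eta>" "emeasure \<eta> {0} > 0"
    using emeasure_complementary[OF sets_diffraction[OF d], of "{0}"] pos n by auto
  define q :: real where "q = 8 powr (- \<rho>) / 2"
  have q: "q > 0" by (simp add: q_def)
  obtain C where C: "C > 0" "\<And>R. R \<ge> 2 \<Longrightarrow>
      C * ((q * R)\<^sup>2 * measure hvol (hball R :: (real ^ ('n option)) set)) \<le> number_variance \<mu> R"
  proof (rule number_variance_lower_bound[OF m d n E, folded \<rho>_def])
    show "q * R * exp (\<rho> * R) \<le> norm (abel_cos \<rho> R z)" if "R \<ge> 2" "z \<in> {0}" for R z
      using norm_abel_cos_zero_ge[OF \<rho> that(1)] that(2) unfolding exp_eighth_powr q_def by (simp add: mult_ac)
  qed (use q in auto)
  show ?thesis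
  proof (rule Liminf_pos_of_ratio_ge[of "C * q\<^sup>2"], use C q in simp,
      use eventually_ge_at_top[of "2::real"] in eventually_elim)
    case (elim R)
    then show ?case using C(2)[OF elim] measure_hvol_hball_bounds(1)[of R, where 'n = 'n] n
      by (simp add: power_mult_distrib mult_ac)
  qed
qed

text \<open>Here the gain is at least \<open>exp (\<delta> * \<rho> * R)\<close>, whose square dominates the additional factor
  \<open>Vol powr \<delta>\<close>.\<close>

theorem number_variance_growth_complementary:
  fixes \<mu> :: "(real ^ ('n::finite option)) measure measure"
  assumes m: "haar_measure m" and d: "diffraction_measure m \<mu> \<eta>" and n: "CARD('n) \<ge> 2"
    and \<delta>: "0 < \<delta>" "\<delta> < 1"
    and pos: "emeasure (complementary_diffraction CARD('n) \<eta>)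
      {\<delta> * ((real CARD('n) - 1) / 2) ..< (real CARD('n) - 1) / 2} > 0"
  shows "Liminf at_top (\<lambda>R::real. ereal
    (number_variance \<mu> R / measure hvol (hball R :: (real ^ ('n option)) set) powr (1 + \<delta>))) > 0"
proof -
  define \<rho> where "\<rho> = (real CARD('n) - 1) / 2"
  have \<rho>: "\<rho> > 0" using n by (simp add: \<rho>_def)
  have r2: "real CARD('n) - 1 = 2 * \<rho>" by (simp add: \<rho>_def)
  define E where "E = (\<lambda>t. \<i> * complex_of_real t) ` {\<delta> * \<rho>..<\<rho>}"
  have sub: "{\<delta> * \<rho>..<\<rho>} \<subseteq> {0..<(real CARD('n) - 1) / 2}" using \<delta> \<rho> by (auto simp: \<rho>_def[symmetric] intro: order_trans[OF mult_nonneg_nonneg])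
  have E: "E \<in> sets \<eta>" "emeasure \<eta> E > 0"
    using emeasure_complementary[OF sets_diffraction[OF d] _ sub] pos by (auto simp: E_def \<rho>_def[symmetric])
  define q :: real where "q = exp (- 2 * \<rho>) / 2 * 8 powr (- \<rho>)"
  have q: "q > 0" by (simp add: q_def)
  obtain C where C: "C > 0" "\<And>R. R \<ge> 2 \<Longrightarrow>
      C * ((q * exp (\<delta> * \<rho> * R))\<^sup>2 * measure hvol (hball R :: (real ^ ('n option)) set)) \<le> number_variance \<mu> R"
  proof (rule number_variance_lower_bound[OF m d n E, folded \<rho>_def])
    fix R :: real and z assume R: "R \<ge> 2" and "z \<in> E"
    then obtain t where t: "z = \<i> * complex_of_real t" "\<delta> * \<rho> \<le> t" "t < \<rho>" by (auto simp: E_def)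
    have "t \<ge> 0" using t \<delta> \<rho> by (meson less_imp_le mult_nonneg_nonneg order_trans)
    have "q * exp (\<delta> * \<rho> * R) * exp (\<rho> * R) \<le> q * exp (t * R) * exp (\<rho> * R)"
      using t R q by (intro mult_left_mono mult_right_mono) auto
    also have "\<dots> \<le> norm (abel_cos \<rho> R z)"
      using norm_abel_cos_imaginary_ge[OF \<rho> R \<open>t \<ge> 0\<close>] t unfolding exp_eighth_powr q_def by (simp add: mult_ac)
    finally show "q * exp (\<delta> * \<rho> * R) * exp (\<rho> * R) \<le> norm (abel_cos \<rho> R z)" .
  qed (use q in auto)
  define S where "S = sphere_area CARD('n)"
  have S: "S > 0" unfolding S_def by (rule sphere_area_pos) simp
  show ?thesis
  proof (rule Liminf_pos_of_ratio_ge[of "C * q\<^sup>2 / S powr \<delta>"], use C q S in simp,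
      use eventually_ge_at_top[of "2::real"] in eventually_elim)
    case (elim R)
    define V where "V = measure hvol (hball R :: (real ^ ('n option)) set)"
    have V: "0 < V" "V \<le> S * exp (2 * \<rho> * R)"
      using measure_hvol_hball_bounds[of R, where 'n = 'n] elim n unfolding r2 by (auto simp: V_def S_def)
    have "V powr \<delta> \<le> (S * exp (2 * \<rho> * R)) powr \<delta>" using V \<delta> by (intro powr_mono2) auto
    also have "\<dots> = S powr \<delta> * (exp (\<delta> * \<rho> * R))\<^sup>2"
      using S by (simp add: powr_mult) (simp add: powr_def exp_double[symmetric] mult_ac)
    finally have "C * q\<^sup>2 / S powr \<delta> * (V * V powr \<delta>) \<le> C * q\<^sup>2 / S powr \<delta> * (V * (S powr \<delta> * (exp (\<delta> * \<rho> * R))\<^sup>2))"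
      using C q V by (intro mult_left_mono) auto
    also have "\<dots> = C * ((q * exp (\<delta> * \<rho> * R))\<^sup>2 * V)" using S by (simp add: power_mult_distrib)
    also have "\<dots> \<le> number_variance \<mu> R" unfolding V_def by (rule C(2)[OF elim])
    finally show ?case using V(1) by (simp add: V_def[symmetric] powr_add)
  qed
qed

section \<open>Vanishing of the normalised variance\<close>

text \<open>Fatou along integer radii: a spectral value \<open>z\<close> survives when the normalised transforms at
  the two radii \<open>k\<close> and \<open>k + h\<close> are not both small. Every \<open>z\<close> survives for small \<open>h\<close>, so
  variances of smaller order than the volume leave no room for a diffraction measure.\<close>

lemma normalised_abel_cos_pair_liminf_pos:
  assumes \<rho>: "\<rho> > 0"
    and z: "(\<exists>t. 0 \<le> t \<and> t \<le> \<rho> \<and> z = \<i> * complex_of_real t) \<or> (\<exists>l>0. l * h < pi \<and> z = complex_of_real l)" and h: "h > 0"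
  shows "liminf (\<lambda>k. ennreal ((exp (- \<rho> * real k) * norm (abel_cos \<rho> (real k) z))\<^sup>2)
      + ennreal ((exp (- \<rho> * (real k + h)) * norm (abel_cos \<rho> (real k + h) z))\<^sup>2)) > 0"
proof -
  have "\<exists>\<epsilon>>0. eventually (\<lambda>R. \<epsilon> \<le> (exp (- \<rho> * R) * norm (abel_cos \<rho> R z))\<^sup>2
      + (exp (- \<rho> * (R + h)) * norm (abel_cos \<rho> (R + h) z))\<^sup>2) at_top"
    using z
  proof (elim disjE exE conjE)
    fix t assume t: "0 \<le> t" "t \<le> \<rho>" "z = \<i> * complex_of_real t"
    define q :: real where "q = exp (- 2 * \<rho>) / 2 * 8 powr (- \<rho>)"
    have q: "q > 0" by (simp add: q_def)
    have "eventually (\<lambda>R. q\<^sup>2 \<le> (exp (- \<rho> * R) * norm (abel_cos \<rho> R z))\<^sup>2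
        + (exp (- \<rho> * (R + h)) * norm (abel_cos \<rho> (R + h) z))\<^sup>2) at_top"
      using eventually_ge_at_top[of "2::real"]
    proof eventually_elim
      case (elim R)
      have "q = exp (- \<rho> * R) * (q * exp (\<rho> * R) * 1)" by (simp add: exp_minus field_simps)
      also have "\<dots> \<le> exp (- \<rho> * R) * (q * exp (\<rho> * R) * exp (t * R))"
        using q t elim by (intro mult_left_mono) auto
      also have "\<dots> \<le> exp (- \<rho> * R) * norm (abel_cos \<rho> R z)"
        using norm_abel_cos_imaginary_ge[OF \<rho> elim t(1,2)] unfolding exp_eighth_powr q_def t(3)
        by (intro mult_left_mono) (auto simp: mult.assoc)
      finally have "q\<^sup>2 \<le> (exp (- \<rho> * R) * norm (abel_cos \<rho> R z))\<^sup>2" using q by (intro power_mono) auto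
      then show ?case
        using zero_le_power2[of "exp (- \<rho> * (R + h)) * norm (abel_cos \<rho> (R + h) z)"] by linarith
    qed
    then show ?thesis using q by (intro exI[of _ "q\<^sup>2"]) auto
  next
    fix l assume l: "l > 0" "l * h < pi" "z = complex_of_real l"
    show ?thesis unfolding l(3)
      by (rule abel_cos_real_two_radii[OF \<rho> l(1) h l(2)]) (intro exI conjI)
  qed
  then obtain \<epsilon> where \<epsilon>: "\<epsilon> > 0" "eventually (\<lambda>R. \<epsilon> \<le> (exp (- \<rho> * R) * norm (abel_cos \<rho> R z))\<^sup>2
      + (exp (- \<rho> * (R + h)) * norm (abel_cos \<rho> (R + h) z))\<^sup>2) at_top" by blast
  have "eventually (\<lambda>k. \<epsilon> \<le> (exp (- \<rho> * real k) * norm (abel_cos \<rho> (real k) z))\<^sup>2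
      + (exp (- \<rho> * (real k + h)) * norm (abel_cos \<rho> (real k + h) z))\<^sup>2) sequentially"
    by (rule eventually_compose_filterlim[OF \<epsilon>(2) filterlim_real_sequentially])
  then have "eventually (\<lambda>k. ennreal \<epsilon> \<le> ennreal ((exp (- \<rho> * real k) * norm (abel_cos \<rho> (real k) z))\<^sup>2)
      + ennreal ((exp (- \<rho> * (real k + h)) * norm (abel_cos \<rho> (real k + h) z))\<^sup>2)) sequentially"
    by eventually_elim (simp add: ennreal_plus[symmetric] ennreal_leI del: ennreal_plus)
  then have "ennreal \<epsilon> \<le> liminf (\<lambda>k. ennreal ((exp (- \<rho> * real k) * norm (abel_cos \<rho> (real k) z))\<^sup>2)
      + ennreal ((exp (- \<rho> * (real k + h)) * norm (abel_cos \<rho> (real k + h) z))\<^sup>2))"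
    by (rule Liminf_bounded)
  moreover have "0 < ennreal \<epsilon>" using \<epsilon>(1) by simp
  ultimately show ?thesis by (rule less_le_trans[rotated])
qed

theorem diffraction_null_of_small_variance:
  fixes \<mu> :: "(real ^ ('n::finite option)) measure measure"
  assumes m: "haar_measure m" and d: "diffraction_measure m \<mu> \<eta>" and n: "CARD('n) \<ge> 2"
    and small: "\<not> Limsup at_top (\<lambda>R::real. ereal
        (number_variance \<mu> R / measure hvol (hball R :: (real ^ ('n option)) set))) > 0"
  shows "AE z in \<eta>. False"
proof -
  define \<rho> where "\<rho> = (real CARD('n) - 1) / 2"
  have \<rho>: "\<rho> > 0" using n by (simp add: \<rho>_def)
  have r2: "real CARD('n) - 1 = 2 * \<rho>" by (simp add: \<rho>_def)
  obtain K where K: "K > 0" and NV: "\<And>R. R \<ge> 0 \<Longrightarrow> ennreal (number_variance \<mu> R) = (\<integral>\<^sup>+z. ennreal ((K * norm (abel_cos \<rho> R z))\<^sup>2) \<partial>\<eta>)"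
    and meas: "\<And>R. R \<ge> 0 \<Longrightarrow> (\<lambda>z. (norm (abel_cos \<rho> R z))\<^sup>2) \<in> borel_measurable \<eta>"
    using number_variance_eq_spectral[OF m d n, folded \<rho>_def] by metis
  define X where "X R z = (exp (- \<rho> * R) * norm (abel_cos \<rho> R z))\<^sup>2" for R z
  have Xm: "X R \<in> borel_measurable \<eta>" if "R \<ge> 0" for R
    unfolding X_def power_mult_distrib by (intro borel_measurable_times borel_measurable_const meas that)
  define Q where "Q R = number_variance \<mu> R * exp (- 2 * \<rho> * R) / K\<^sup>2" for R
  have XQ: "(\<integral>\<^sup>+z. ennreal (X R z) \<partial>\<eta>) = ennreal (Q R)" if R: "R \<ge> 0" for R
  proof -
    have "X R z = exp (- 2 * \<rho> * R) / K\<^sup>2 * (K * norm (abel_cos \<rho> R z))\<^sup>2" for z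
    proof -
      have "exp (- 2 * \<rho> * R) = (exp (- \<rho> * R))\<^sup>2" by (simp add: exp_double[symmetric] mult.assoc)
      then show ?thesis using K by (simp add: X_def power_mult_distrib)
    qed
    then have "(\<integral>\<^sup>+z. ennreal (X R z) \<partial>\<eta>) = (\<integral>\<^sup>+z. ennreal (exp (- 2 * \<rho> * R) / K\<^sup>2) * ennreal ((K * norm (abel_cos \<rho> R z))\<^sup>2) \<partial>\<eta>)"
      by (simp only: ennreal_mult'[symmetric] divide_nonneg_nonneg exp_ge_zero zero_le_power2)
    also have "\<dots> = ennreal (exp (- 2 * \<rho> * R) / K\<^sup>2) * ennreal (number_variance \<mu> R)"
      unfolding NV[OF R] using meas[OF R] by (intro nn_integral_cmult) (simp add: power_mult_distrib)
    also have "\<dots> = ennreal (Q R)" by (simp add: Q_def ennreal_mult'[symmetric] number_variance_nonneg mult_ac)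
    finally show ?thesis .
  qed
  define S where "S = sphere_area CARD('n)"
  have S: "S > 0" unfolding S_def by (rule sphere_area_pos) simp
  have Q0: "0 \<le> Q R" for R by (simp add: Q_def number_variance_nonneg)
  have Qlim: "(Q \<longlongrightarrow> 0) at_top"
  proof (rule tendstoI)
    fix e :: real assume e: "e > 0"
    define \<epsilon> where "\<epsilon> = e * K\<^sup>2 / S"
    have \<epsilon>: "\<epsilon> > 0" using e K S by (simp add: \<epsilon>_def)
    have "Limsup at_top (\<lambda>R::real. ereal
        (number_variance \<mu> R / measure hvol (hball R :: (real ^ ('n option)) set))) < ereal \<epsilon>"
      using small \<epsilon> by (meson ereal_less(2) le_less_trans not_less)
    from Limsup_lessD[OF this] eventually_gt_at_top[of "0::real"]
    show "eventually (\<lambda>R. dist (Q R) 0 < e) at_top"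
    proof eventually_elim
      case (elim R)
      define V where "V = measure hvol (hball R :: (real ^ ('n option)) set)"
      have V: "0 < V" "V \<le> S * exp (2 * \<rho> * R)"
        using measure_hvol_hball_bounds[of R, where 'n = 'n] elim n unfolding r2 by (auto simp: V_def S_def)
      have "number_variance \<mu> R < \<epsilon> * V" using elim V(1) by (simp add: V_def[symmetric] field_simps)
      also have "\<dots> \<le> \<epsilon> * (S * exp (2 * \<rho> * R))" using V \<epsilon> by simp
      also have "\<dots> = e * K\<^sup>2 * exp (2 * \<rho> * R)" using S by (simp add: \<epsilon>_def)
      finally have "number_variance \<mu> R * exp (- 2 * \<rho> * R) < e * K\<^sup>2 * exp (2 * \<rho> * R) * exp (- 2 * \<rho> * R)"
        by (rule mult_strict_right_mono) simp
      also have "\<dots> = e * K\<^sup>2" by (simp add: mult.assoc exp_add[symmetric])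
      finally have "Q R < e" using K by (simp add: Q_def field_simps)
      then show ?case using Q0[of R] by simp
    qed
  qed
  have AEh: "AE z in \<eta>. \<not> liminf (\<lambda>k. ennreal (X (real k) z) + ennreal (X (real k + h) z)) > 0" if h: "h > 0" for h
  proof -
    have [measurable]: "(\<lambda>z. X (real k) z) \<in> borel_measurable \<eta>" "(\<lambda>z. X (real k + h) z) \<in> borel_measurable \<eta>" for k
      using Xm h by auto
    have "(\<lambda>k. Q (real k)) \<longlonglongrightarrow> 0" by (rule filterlim_compose[OF Qlim filterlim_real_sequentially])
    moreover have "(\<lambda>k. Q (real k + h)) \<longlonglongrightarrow> 0"
      by (rule filterlim_compose[OF Qlim]) real_asymp
    ultimately have "(\<lambda>k. Q (real k) + Q (real k + h)) \<longlonglongrightarrow> 0 + 0" by (rule tendsto_add)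
    then have "(\<lambda>k. ennreal (Q (real k) + Q (real k + h))) \<longlonglongrightarrow> ennreal 0" by (intro tendsto_ennrealI) simp
    then have l0: "liminf (\<lambda>k. ennreal (Q (real k) + Q (real k + h))) = 0" by (intro lim_imp_Liminf) auto
    have "(\<integral>\<^sup>+z. liminf (\<lambda>k. ennreal (X (real k) z) + ennreal (X (real k + h) z)) \<partial>\<eta>)
        \<le> liminf (\<lambda>k. \<integral>\<^sup>+z. ennreal (X (real k) z) + ennreal (X (real k + h) z) \<partial>\<eta>)"
      by (rule nn_integral_liminf) measurable
    also have "\<dots> = liminf (\<lambda>k. ennreal (Q (real k) + Q (real k + h)))"
      using h Q0 by (subst nn_integral_add) (auto simp: XQ ennreal_plus)
    finally have "(\<integral>\<^sup>+z. liminf (\<lambda>k. ennreal (X (real k) z) + ennreal (X (real k + h) z)) \<partial>\<eta>) = 0"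
      by (simp add: l0)
    then have "AE z in \<eta>. liminf (\<lambda>k. ennreal (X (real k) z) + ennreal (X (real k + h) z)) = 0"
      by (subst (asm) nn_integral_0_iff_AE) measurable
    then show ?thesis by eventually_elim simp
  qed
  then have "AE z in \<eta>. \<forall>N. \<not> liminf (\<lambda>k. ennreal (X (real k) z) + ennreal (X (real k + 1 / real (Suc N)) z)) > 0"
    by (subst AE_all_countable) auto
  moreover have "AE z in \<eta>. z \<in> space \<eta>" by (rule AE_space)
  ultimately show ?thesis
  proof eventually_elim
    case (elim z)
    have z: "z \<in> Omega_plus CARD('n)"
      using elim(2) sets_eq_imp_space_eq[OF sets_diffraction[OF d]] by (simp add: space_restrict_space)
    \<comment> \<open>For real \<open>z\<close> the shift \<open>1 / (N + 1)\<close> is below half a period once \<open>N\<close> exceeds \<open>z\<close>.\<close>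
    obtain N :: nat where N: "(\<exists>t. 0 \<le> t \<and> t \<le> \<rho> \<and> z = \<i> * complex_of_real t) \<or> (\<exists>l>0. l * (1 / real (Suc N)) < pi \<and> z = complex_of_real l)"
    proof (cases "\<exists>t. 0 \<le> t \<and> t \<le> \<rho> \<and> z = \<i> * complex_of_real t")
      case False
      with z obtain l where l: "l > 0" "z = complex_of_real l" by (auto simp: Omega_plus_def \<rho>_def)
      obtain N :: nat where "l < real N" using reals_Archimedean2 by blast
      then have "l * (1 / real (Suc N)) < 1" by (simp add: field_simps)
      then have "l * (1 / real (Suc N)) < pi" using pi_gt3 by linarith
      then show ?thesis using that l by blast
    qed (use that in blast)
    from normalised_abel_cos_pair_liminf_pos[OF \<rho> N] elim(1) show False unfolding X_def by auto
  qed
qed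

section \<open>Random measures with vanishing diffraction\<close>

lemma lf_measuresD:
  assumes "p \<in> lf_measures"
  shows "sets p = sets hborel" "space p = hyp" "B \<in> sets hborel \<Longrightarrow> hbounded B \<Longrightarrow> emeasure p B < \<infinity>"
    "loc_fin hyp p"
proof -
  show s: "sets p = sets hborel" and f: "B \<in> sets hborel \<Longrightarrow> hbounded B \<Longrightarrow> emeasure p B < \<infinity>" for B
    using assms by (auto simp: lf_measures_def)
  show "space p = hyp" using sets_eq_imp_space_eq[OF s] by simp
  show "loc_fin hyp p" using s f by (rule loc_fin_hypI)
qed

lemma space_lf_algebra: "space lf_algebra = lf_measures"
  unfolding lf_algebra_def by (rule space_measure_of_conv)

lemma linstat_set_in_lf_algebra:
  fixes f :: "real ^ ('n::finite option) \<Rightarrow> real"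
  assumes "test_fun f" "U \<in> sets borel"
  shows "{p \<in> lf_measures. linstat f p \<in> U} \<in> sets lf_algebra"
  unfolding lf_algebra_def using assms by (intro in_measure_of) auto

lemma measurable_linstat:
  fixes f :: "real ^ ('n::finite option) \<Rightarrow> real"
  assumes s: "sets \<mu> = sets lf_algebra" and f: "test_fun f"
  shows "linstat f \<in> borel_measurable \<mu>"
proof (rule measurableI)
  fix U :: "real set" assume "U \<in> sets borel"
  moreover have "space \<mu> = lf_measures" using sets_eq_imp_space_eq[OF s] by (simp add: space_lf_algebra)
  ultimately show "linstat f -` U \<inter> space \<mu> \<in> sets \<mu>"
    using linstat_set_in_lf_algebra[OF f] by (simp add: s vimage_def Int_def conj_commute)
qed auto

lemma SO1_hbounded_vimage:
  fixes g :: "real ^ ('n::finite option) ^ ('n option)"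
  assumes g: "g \<in> SO1" and B: "B \<subseteq> hyp" "hbounded B"
  shows "hbounded {x \<in> hyp. g *v x \<in> B}"
proof -
  obtain h where h: "h \<in> SO1" "\<And>x. h *v (g *v x) = x" using SO1_inverse[OF g] by metis
  have "{x \<in> hyp. g *v x \<in> B} \<subseteq> (\<lambda>x. h *v x) ` B"
    using h(2) by (auto intro!: image_eqI[of _ _ "g *v _"])
  moreover have "bounded ((\<lambda>x. h *v x) ` B)"
    using B by (intro bounded_linear_image matrix_vector_mul_bounded_linear) (simp add: hbounded_iff_bounded)
  ultimately have "bounded {x \<in> hyp. g *v x \<in> B}" by (rule bounded_subset[rotated])
  then show ?thesis by (subst hbounded_iff_bounded) auto
qed

lemma test_fun_SO1:
  fixes f :: "real ^ ('n::finite option) \<Rightarrow> real"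
  assumes f: "test_fun f" and g: "g \<in> SO1"
  shows "test_fun (\<lambda>x. f (g *v x))"
  unfolding test_fun_def
proof (intro conjI)
  have fm: "f \<in> borel_measurable hborel" and fb: "bounded (f ` hyp)" and fs: "hbounded {x \<in> hyp. f x \<noteq> 0}"
    using f by (auto simp: test_fun_def)
  show "(\<lambda>x. f (g *v x)) \<in> borel_measurable hborel"
    by (rule measurable_compose[OF measurable_SO1_hborel[OF g] fm])
  show "bounded ((\<lambda>x. f (g *v x)) ` hyp)"
    by (rule bounded_subset[OF fb]) (auto simp: SO1_hyp[OF g])
  have "hbounded {x \<in> hyp. g *v x \<in> {x \<in> hyp. f x \<noteq> 0}}" by (rule SO1_hbounded_vimage[OF g _ fs]) auto
  then show "hbounded {x \<in> hyp. f (g *v x) \<noteq> 0}" by (rule hbounded_subset) (auto simp: SO1_hyp[OF g])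
qed

lemma linstat_distr_SO1:
  fixes f :: "real ^ ('n::finite option) \<Rightarrow> real"
  assumes p: "p \<in> lf_measures" and g: "g \<in> SO1" and f: "f \<in> borel_measurable hborel"
  shows "linstat f (distr p hborel (\<lambda>x. g *v x)) = linstat (\<lambda>x. f (g *v x)) p"
proof -
  have "(\<lambda>x. g *v x) \<in> p \<rightarrow>\<^sub>M hborel"
    using measurable_SO1_hborel[OF g] by (simp add: measurable_cong_sets[OF lf_measuresD(1)[OF p] refl])
  then show ?thesis unfolding linstat_def by (rule integral_distr[OF _ f])
qed

text \<open>Translating a random measure by \<open>g\<close> amounts to replacing each test function \<open>f\<close> by \<open>f \<circ> g\<close>, which is
  again a test function; so generators pull back to generators.\<close>

lemma measurable_SO1_action:
  fixes g :: "real ^ ('n::finite option) ^ ('n option)"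
  assumes s: "sets \<mu> = sets lf_algebra" and g: "g \<in> SO1"
  shows "(\<lambda>p. distr p hborel (\<lambda>x. g *v x)) \<in> \<mu> \<rightarrow>\<^sub>M lf_algebra"
proof -
  have sp: "space \<mu> = lf_measures" using sets_eq_imp_space_eq[OF s] by (simp add: space_lf_algebra)
  have lf: "distr p hborel (\<lambda>x. g *v x) \<in> lf_measures" if p: "p \<in> lf_measures" for p
  proof -
    have gm: "(\<lambda>x. g *v x) \<in> p \<rightarrow>\<^sub>M hborel"
      using measurable_SO1_hborel[OF g] by (simp add: measurable_cong_sets[OF lf_measuresD(1)[OF p] refl])
    have "emeasure (distr p hborel (\<lambda>x. g *v x)) B < \<infinity>" if B: "B \<in> sets hborel" "hbounded B" for B
    proof -
      have eq: "(\<lambda>x. g *v x) -` B \<inter> space p = {x \<in> hyp. g *v x \<in> B}" by (auto simp: lf_measuresD(2)[OF p])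
      have "{x \<in> hyp. g *v x \<in> B} \<in> sets hborel" "hbounded {x \<in> hyp. g *v x \<in> B}"
        using measurable_sets[OF gm B(1)] SO1_hbounded_vimage[OF g _ B(2)] B(1)
        by (auto simp: eq lf_measuresD(1)[OF p] sets_hborel_iff)
      then show ?thesis using lf_measuresD(3)[OF p] by (simp add: emeasure_distr[OF gm B(1)] eq)
    qed
    then show ?thesis by (auto simp: lf_measures_def)
  qed
  show ?thesis unfolding lf_algebra_def
  proof (rule measurable_measure_of)
    show "(\<lambda>p. distr p hborel (\<lambda>x. g *v x)) \<in> space \<mu> \<rightarrow> lf_measures" using lf by (auto simp: sp)
    fix A assume "A \<in> {{p \<in> lf_measures. linstat f p \<in> U} | (f :: real ^ ('n option) \<Rightarrow> real) U. test_fun f \<and> U \<in> sets borel}"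
    then obtain f :: "real ^ ('n option) \<Rightarrow> real" and U where A: "A = {p \<in> lf_measures. linstat f p \<in> U}" "test_fun f" "U \<in> sets borel" by blast
    have "f \<in> borel_measurable hborel" using A(2) by (simp add: test_fun_def)
    then have "(\<lambda>p. distr p hborel (\<lambda>x. g *v x)) -` A \<inter> space \<mu> = {p \<in> lf_measures. linstat (\<lambda>x. f (g *v x)) p \<in> U}"
      using lf linstat_distr_SO1[OF _ g] by (auto simp: A(1) sp)
    then show "(\<lambda>p. distr p hborel (\<lambda>x. g *v x)) -` A \<inter> space \<mu> \<in> sets \<mu>"
      using linstat_set_in_lf_algebra[OF test_fun_SO1[OF A(2) g] A(3)] by (simp add: s)
  qed auto
qed

lemma borel_measurable_hker_hborel: "hker r x \<in> borel_measurable hborel"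
  by (intro borel_measurable_hborelI) measurable

lemma test_fun_hker:
  assumes x: "x \<in> hyp" and r: "r \<ge> 0"
  shows "test_fun (hker r x)"
  unfolding test_fun_def
proof (intro conjI borel_measurable_hker_hborel)
  show "bounded (hker r x ` hyp)"
    unfolding bounded_iff using hker_le[OF x _ r] by (intro exI[of _ r]) auto
  show "hbounded {y \<in> hyp. hker r x y \<noteq> 0}"
    by (rule hbounded_subset[OF hbounded_hball[of "arcosh (2 * x $ None * (1 + r) + 1)"]])
      (use hker_nonzero_in_hball[OF x _ _ order_refl r] in auto)
qed

text \<open>The variance is an integral against the null measure \<open>\<eta>\<close>. Square integrability is what allows to
  conclude from a vanishing variance that the statistic is almost surely equal to its mean.\<close>

lemma linstat_AE_const:
  fixes \<mu> :: "(real ^ ('n::finite option)) measure measure"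
  assumes rm: "random_measure \<mu>" and sq: "locally_square_integrable \<mu>"
    and d: "diffraction_measure m \<mu> \<eta>" and null: "AE z in \<eta>. False"
    and r: "0 \<le> r" "r \<le> 1"
  shows "AE p in \<mu>. linstat (hker r base) p = (LINT q|\<mu>. linstat (hker r base) q)"
    and "0 \<le> (LINT q|\<mu>. linstat (hker r base) q)"
proof -
  interpret prob_space \<mu> using rm by (simp add: random_measure_def)
  have s: "sets \<mu> = sets lf_algebra" using rm by (simp add: random_measure_def)
  have sp: "space \<mu> = lf_measures" using sets_eq_imp_space_eq[OF s] by (simp add: space_lf_algebra)
  define f :: "real ^ ('n option) \<Rightarrow> real" where "f = hker r base"
  have tf: "test_fun f" unfolding f_def by (rule test_fun_hker) (use r in auto)
  define X where "X = linstat f"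
  have [measurable]: "X \<in> borel_measurable \<mu>" unfolding X_def by (rule measurable_linstat[OF s tf])
  have X0: "0 \<le> X p" for p unfolding X_def linstat_def f_def by simp
  then show "0 \<le> (LINT q|\<mu>. linstat (hker r base) q)" by (simp add: X_def f_def)
  \<comment> \<open>As \<open>r \<le> 1\<close>, the tent lies below the indicator of a ball, whose count is square integrable.\<close>
  define B where "B = (hball (arcosh (2 * 1 * (1 + r) + 1)) :: (real ^ ('n option)) set)"
  have fB: "f y \<le> indicator B y" if "y \<in> hyp" for y
  proof (cases "f y = 0")
    case False
    then have "y \<in> B" using hker_nonzero_in_hball[OF base_in_hyp that, of r 1] r by (simp add: B_def f_def)
    moreover have "f y \<le> r" unfolding f_def using that r by (intro hker_le) auto
    ultimately show ?thesis using r by simp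
  qed simp
  have XB: "ennreal (X p) \<le> emeasure p B" if p: "p \<in> lf_measures" for p
  proof -
    have B: "B \<in> sets p" by (simp add: B_def lf_measuresD(1)[OF p])
    have Bf: "emeasure p B < \<infinity>" by (rule lf_measuresD(3)[OF p]) (auto simp: B_def)
    have "X p \<le> (LINT y|p. indicator B y)"
      unfolding X_def linstat_def
    proof (rule integral_mono_AE')
      show "integrable p (indicator B :: _ \<Rightarrow> real)" using B Bf by (rule integrable_real_indicator)
      show "AE y in p. f y \<le> indicator B y" using fB by (intro AE_I2) (simp add: lf_measuresD(2)[OF p])
      show "AE y in p. (0::real) \<le> indicator B y" by simp
    qed
    then have "X p \<le> measure p B" using B by simp
    then have "ennreal (X p) \<le> ennreal (measure p B)" by (rule ennreal_leI)
    also have "\<dots> = emeasure p B" using Bf by (intro emeasure_eq_ennreal_measure[symmetric]) auto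
    finally show ?thesis .
  qed
  have "(\<integral>\<^sup>+p. ennreal ((X p)\<^sup>2) \<partial>\<mu>) \<le> (\<integral>\<^sup>+p. (emeasure p B)\<^sup>2 \<partial>\<mu>)"
  proof (intro nn_integral_mono)
    fix p assume "p \<in> space \<mu>"
    then have "(ennreal (X p))\<^sup>2 \<le> (emeasure p B)\<^sup>2" using XB by (intro power_mono) (auto simp: sp)
    then show "ennreal ((X p)\<^sup>2) \<le> (emeasure p B)\<^sup>2" using X0 by (simp add: ennreal_power)
  qed
  also have "\<dots> < \<infinity>"
    using sq unfolding locally_square_integrable_def B_def by (metis sets_hball hbounded_hball)
  finally have "(\<integral>\<^sup>+p. ennreal ((X p)\<^sup>2) \<partial>\<mu>) < \<infinity>" .
  then have X2: "integrable \<mu> (\<lambda>p. (X p)\<^sup>2)" by (intro integrableI_nonneg) auto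
  have X1: "integrable \<mu> X" by (rule square_integrable_imp_integrable[OF _ X2]) measurable
  define a where "a = (LINT q|\<mu>. X q)"
  have I: "integrable \<mu> (\<lambda>p. (X p - a)\<^sup>2)"
    unfolding power2_diff using X1 X2 by auto
  have rad: "f (k *v x) = f x" if "k \<in> stab" "x \<in> hyp" for k x
  proof -
    have k: "k \<in> SO1" "k *v base = base" using that by (auto simp: stab_def)
    have "lor base (k *v x) = lor (k *v base) (k *v x)" by (simp only: k)
    also have "\<dots> = lor base x" by (rule SO1_lor[OF k(1)])
    finally show ?thesis by (simp add: f_def hker_def)
  qed
  have "ennreal (LINT p|\<mu>. (X p - a)\<^sup>2) = 0" unfolding X_def a_def
  proof (rule trans[OF variance_eq_spectral(1)[OF d tf rad]])
    show "(\<integral>\<^sup>+z. ennreal ((norm (spherical_transform m (\<lambda>g. complex_of_real (f (g *v base))) z))\<^sup>2) \<partial>\<eta>) = 0"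
      using null by (subst nn_integral_cong_AE[of _ "\<lambda>_. 0"]) auto
  qed
  then have "(LINT p|\<mu>. (X p - a)\<^sup>2) \<le> 0" by (simp add: ennreal_eq_0_iff)
  moreover have "0 \<le> (LINT p|\<mu>. (X p - a)\<^sup>2)" by (rule Bochner_Integration.integral_nonneg) simp
  ultimately have "(LINT p|\<mu>. (X p - a)\<^sup>2) = 0" by (rule antisym)
  then have "AE p in \<mu>. (X p - a)\<^sup>2 = 0"
    using integral_nonneg_eq_0_iff_AE[OF I] by simp
  then show "AE p in \<mu>. linstat (hker r base) p = (LINT q|\<mu>. linstat (hker r base) q)"
    by eventually_elim (simp add: X_def a_def f_def)
qed

text \<open>An isometry takes \<open>x\<close> to the base point, and it preserves the law of the random measure.\<close>

lemma linstat_hker_AE_const_everywhere: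
  fixes \<mu> :: "(real ^ ('n::finite option)) measure measure"
  assumes rm: "random_measure \<mu>" and inv: "invariant_rm \<mu>"
    and c: "AE p in \<mu>. linstat (hker r base) p = a" and x: "x \<in> hyp"
  shows "AE p in \<mu>. linstat (hker r x) p = a"
proof -
  have s: "sets \<mu> = sets lf_algebra" using rm by (simp add: random_measure_def)
  have sp: "space \<mu> = lf_measures" using sets_eq_imp_space_eq[OF s] by (simp add: space_lf_algebra)
  obtain g where g: "g \<in> SO1" "g *v x = base" using SO1_to_base[OF x] by blast
  have eq: "distr \<mu> lf_algebra (\<lambda>p. distr p hborel (\<lambda>x. g *v x)) = \<mu>" using inv g by (simp add: invariant_rm_def)
  have "AE p in distr \<mu> lf_algebra (\<lambda>p. distr p hborel (\<lambda>x. g *v x)). linstat (hker r base) p = a"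
    unfolding eq by (rule c)
  then have "AE p in \<mu>. linstat (hker r base) (distr p hborel (\<lambda>x. g *v x)) = a"
    by (rule AE_distrD[OF measurable_SO1_action[OF s g(1)]])
  moreover have "AE p in \<mu>. p \<in> space \<mu>" by (rule AE_space)
  ultimately show ?thesis
  proof eventually_elim
    case (elim p)
    have "(\<lambda>y. hker r base (g *v y)) = hker r x"
    proof
      fix y
      have "lor base (g *v y) = lor (g *v x) (g *v y)" by (simp only: g(2))
      also have "\<dots> = lor x y" by (rule SO1_lor[OF g(1)])
      finally show "hker r base (g *v y) = hker r x y" by (simp add: hker_def)
    qed
    then show ?case using elim linstat_distr_SO1[OF _ g(1) borel_measurable_hker_hborel, of p r base] by (simp add: sp)
  qed
qed

text \<open>The supports of the tents about a convergent sequence of centres lie in one ball, of finite mass.\<close>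

lemma linstat_hker_continuous:
  fixes x :: "real ^ ('n::finite option)"
  assumes p: "p \<in> lf_measures" and x: "x \<in> hyp" and X: "\<And>k. X k \<in> hyp" "X \<longlonglongrightarrow> x" and r: "r \<ge> 0"
  shows "(\<lambda>k. linstat (hker r (X k)) p) \<longlonglongrightarrow> linstat (hker r x) p"
proof -
  obtain M where M: "\<And>k. norm (X k) \<le> M" using convergent_imp_Bseq[of X] X(2) by (auto simp: convergent_def Bseq_def)
  define B where "B = (hball (arcosh (2 * M * (1 + r) + 1)) :: (real ^ ('n option)) set)"
  have B: "B \<in> sets p" unfolding B_def lf_measuresD(1)[OF p] by (rule sets_hball)
  have Bf: "emeasure p B < \<infinity>" unfolding B_def by (rule lf_measuresD(3)[OF p sets_hball hbounded_hball])
  have hm: "hker r y \<in> borel_measurable p" for y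
    using borel_measurable_hker_hborel[of r y] by (simp add: measurable_cong_sets[OF lf_measuresD(1)[OF p] refl])
  show ?thesis unfolding linstat_def
  proof (rule integral_dominated_convergence[where w = "\<lambda>y. r * indicator B y"])
    show "integrable p (\<lambda>y. r * indicator B y)" using B Bf by (intro integrable_mult_right integrable_real_indicator)
    show "AE y in p. (\<lambda>k. hker r (X k) y) \<longlonglongrightarrow> hker r x y"
    proof (intro AE_I2)
      fix y :: "real ^ ('n option)"
      have "continuous_on UNIV (\<lambda>w. hker r w y)" unfolding hker_def by (intro continuous_intros)
      then show "(\<lambda>k. hker r (X k) y) \<longlonglongrightarrow> hker r x y"
        using X(2) by (rule continuous_on_tendsto_compose) auto
    qed
    show "AE y in p. norm (hker r (X k) y) \<le> r * indicator B y" for k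
    proof (intro AE_I2)
      fix y assume y: "y \<in> space p"
      then have yh: "y \<in> hyp" by (simp add: lf_measuresD(2)[OF p])
      have "X k $ None \<le> M" using component_le_norm_cart[of "X k" None] M[of k] by simp
      then show "norm (hker r (X k) y) \<le> r * indicator B y"
        using hker_nonzero_in_hball[OF X(1) yh _ _ r, of k M] hker_le[OF X(1) yh r] y
        by (cases "hker r (X k) y = 0") (auto simp: B_def r)
    qed
  qed (rule hm)+
qed

text \<open>Almost surely the tents about a countable dense set of centres all have their expected mass; by
  continuity so have the tents about every centre. Each such realisation is a multiple of the
  volume, and the expected mass of one tent determines the factor.\<close>

theorem deterministic_of_null_diffraction:
  fixes \<mu> :: "(real ^ ('n::finite option)) measure measure"
  assumes rm: "random_measure \<mu>" and inv: "invariant_rm \<mu>" and sq: "locally_square_integrable \<mu>"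
    and d: "diffraction_measure m \<mu> \<eta>" and null: "AE z in \<eta>. False"
  shows "deterministic_rm \<mu>"
proof -
  have s: "sets \<mu> = sets lf_algebra" using rm by (simp add: random_measure_def)
  have sp: "space \<mu> = lf_measures" using sets_eq_imp_space_eq[OF s] by (simp add: space_lf_algebra)
  define r where "r n = 1 / real (Suc n)" for n
  have r: "0 \<le> r n" "r n \<le> 1" for n by (auto simp: r_def)
  define a where "a n = (LINT q|\<mu>. linstat (hker (r n) base) q)" for n
  have a0: "0 \<le> a n" for n unfolding a_def by (rule linstat_AE_const(2)[OF rm sq d null r])
  obtain D :: "(real ^ ('n option)) set" where D: "countable D" "D \<subseteq> hyp" "hyp \<subseteq> closure D" using separable by blast
  define b where "b = (\<integral>\<^sup>+(y :: real ^ ('n option)). ennreal (hker (r 0) base y) \<partial>hvol)"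
  have b: "0 < b" "b < \<infinity>" unfolding b_def
    by (rule nn_integral_hvol_hker_pos, simp add: r_def)
      (rule nn_integral_hker_finite[OF loc_fin_hvol base_in_hyp r(1)])
  define c where "c = a 0 / enn2real b"
  have "AE p in \<mu>. \<forall>x\<in>D. \<forall>n. linstat (hker (r n) x) p = a n"
    unfolding AE_ball_countable[OF D(1)] AE_all_countable
  proof (intro ballI allI)
    fix x n assume "x \<in> D"
    then have "x \<in> hyp" using D(2) by blast
    moreover have "AE p in \<mu>. linstat (hker (r n) base) p = a n"
      using linstat_AE_const(1)[OF rm sq d null r(1)[of n] r(2)[of n]] unfolding a_def .
    ultimately show "AE p in \<mu>. linstat (hker (r n) x) p = a n"
      by (rule linstat_hker_AE_const_everywhere[OF rm inv, rotated])
  qed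
  moreover have "AE p in \<mu>. p \<in> space \<mu>" by (rule AE_space)
  ultimately have "AE p in \<mu>. p = scale_measure (ennreal c) hvol"
  proof eventually_elim
    case (elim p)
    then have p: "p \<in> lf_measures" by (simp add: sp)
    have const: "linstat (hker (r n) x) p = a n" if x: "x \<in> hyp" for n x
    proof -
      obtain X where X: "\<And>k. X k \<in> D" "X \<longlonglongrightarrow> x"
        using x D(3) closure_sequential[of x D] by auto
      have "(\<lambda>k. linstat (hker (r n) (X k)) p) \<longlonglongrightarrow> linstat (hker (r n) x) p"
        using X D(2) by (intro linstat_hker_continuous[OF p x _ _ r(1)]) auto
      moreover have "(\<lambda>k. linstat (hker (r n) (X k)) p) = (\<lambda>k. a n)" using elim(1) X(1) by auto
      ultimately show ?thesis by (simp add: LIMSEQ_const_iff)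
    qed
    have nn: "(\<integral>\<^sup>+y. ennreal (hker (r n) x y) \<partial>p) = ennreal (a n)" if x: "x \<in> hyp" for n x
    proof -
      have hm: "hker (r n) x \<in> borel_measurable p"
        using borel_measurable_hker_hborel[of "r n" x] by (simp add: measurable_cong_sets[OF lf_measuresD(1)[OF p] refl])
      have "integrable p (hker (r n) x)"
        using nn_integral_hker_finite[OF lf_measuresD(4)[OF p] x r(1)] hm by (intro integrableI_nonneg) auto
      then show ?thesis using const[OF x] by (simp add: nn_integral_eq_integral linstat_def)
    qed
    obtain c' where c': "c' \<ge> 0" "p = scale_measure (ennreal c') hvol"
      using invariant_measure_unique[OF lf_measuresD(4)[OF p], of "\<lambda>n. ennreal (a n)"] nn unfolding r_def by blast
    have "ennreal (a 0) = ennreal c' * b"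
    proof -
      have "(\<lambda>y. ennreal (hker (r 0) base y)) \<in> borel_measurable (hvol :: (real ^ ('n option)) measure)"
        using borel_measurable_hker_hborel[of "r 0" base]
        by (simp add: measurable_cong_sets[OF sets_hvol refl])
      then show ?thesis using nn[OF base_in_hyp, of 0] unfolding c'(2) b_def by (simp add: nn_integral_scale_measure)
    qed
    also have "b = ennreal (enn2real b)" using b by simp
    finally have "a 0 = c' * enn2real b" using a0 c'(1) by (simp add: ennreal_mult'[symmetric])
    moreover have "enn2real b > 0" using b by (simp add: enn2real_positive_iff)
    ultimately have "c' = c" by (simp add: c_def)
    then show ?case using c' by simp
  qed
  moreover have "c \<ge> 0" using a0 by (simp add: c_def)
  ultimately show ?thesis by (auto simp: deterministic_rm_def)
qed

text \<open>Both lower limits come from the complementary spectrum alone. The upper limit is argued by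
  contradiction, because the oscillating principal spectrum gives no lower bound at a prescribed
  radius.\<close>

theorem theorem1p4:
  fixes \<mu> :: "(real ^ ('n::finite option)) measure measure"
    and m :: "(real ^ ('n option) ^ ('n option)) measure"
    and \<eta> :: "complex measure"
  assumes "CARD('n) \<ge> 2"
    and "random_measure \<mu>"
    and "invariant_rm \<mu>"
    and "locally_square_integrable \<mu>"
    and "haar_measure m"
    and "diffraction_measure m \<mu> \<eta>"
  shows "(\<not> deterministic_rm \<mu> \<longrightarrow>
            Limsup at_top (\<lambda>R::real. ereal
              (number_variance \<mu> R / measure hvol (hball R :: (real ^ ('n option)) set))) > 0)
       \<and> (emeasure (complementary_diffraction CARD('n) \<eta>) {0} > 0 \<longrightarrow>
            Liminf at_top (\<lambda>R::real. ereal
              (number_variance \<mu> R / (R\<^sup>2 * measure hvol (hball R :: (real ^ ('n option)) set)))) > 0)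
       \<and> (\<forall>\<delta>::real. 0 < \<delta> \<and> \<delta> < 1 \<and>
            emeasure (complementary_diffraction CARD('n) \<eta>)
              {\<delta> * ((real CARD('n) - 1) / 2) ..< (real CARD('n) - 1) / 2} > 0 \<longrightarrow>
            Liminf at_top (\<lambda>R::real. ereal
              (number_variance \<mu> R /
                measure hvol (hball R :: (real ^ ('n option)) set) powr (1 + \<delta>))) > 0)"
proof (intro conjI impI allI)
  assume nd: "\<not> deterministic_rm \<mu>"
  show "Limsup at_top (\<lambda>R::real. ereal
      (number_variance \<mu> R / measure hvol (hball R :: (real ^ ('n option)) set))) > 0"
  proof (rule ccontr)
    assume "\<not> ?thesis"
    then have "AE z in \<eta>. False" by (rule diffraction_null_of_small_variance[OF assms(5,6,1)])
    then have "deterministic_rm \<mu>" by (rule deterministic_of_null_diffraction[OF assms(2,3,4,6)])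
    with nd show False ..
  qed
next
  assume "emeasure (complementary_diffraction CARD('n) \<eta>) {0} > 0"
  then show "Liminf at_top (\<lambda>R::real. ereal
      (number_variance \<mu> R / (R\<^sup>2 * measure hvol (hball R :: (real ^ ('n option)) set)))) > 0"
    by (rule number_variance_growth_at_zero[OF assms(5,6,1)])
next
  fix \<delta> :: real
  assume "0 < \<delta> \<and> \<delta> < 1 \<and> emeasure (complementary_diffraction CARD('n) \<eta>)
      {\<delta> * ((real CARD('n) - 1) / 2) ..< (real CARD('n) - 1) / 2} > 0"
  then show "Liminf at_top (\<lambda>R::real. ereal
      (number_variance \<mu> R / measure hvol (hball R :: (real ^ ('n option)) set) powr (1 + \<delta>))) > 0"
    by (intro number_variance_growth_complementary[OF assms(5,6,1)]) auto
qed

end
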